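(* The following assertions hold. (i) For $D\geq 1$, there is a one-to-one correspondence between the elements of $\mathcal{E}_D$ and the isomorphism classes of the multiplicity-free $2D$-dimensional irreducible $\widetilde{\mathcal H}$-modules with an adapted block basis. (ii) For $D\geq 0$, there is a one-to-one correspondence between the elements of $\mathcal{O}_D$ and the isomorphism classes of the multiplicity-free $(2D+1)$-dimensional irreducible $\widetilde{\mathcal H}$-modules with an adapted block basis.
   Context: **Algebra.** Fix nonzero $r_0,r_1\in\mathbb{C}$. $\widetilde{\mathcal H}=\widetilde{\mathcal H}(r_0,r_1)$ is the unital associative $\mathbb{C}$-algebra generated by $t_0,u_0,t_1,u_1$ subject to the relations (i) $(t_i-r_i)(t_i-r_i^{-1})=0$ for $i\in\{0,1\}$; (ii) $u_0^2=u_0$; (iii) $u_1^2=0$; (iv) $u_0t_0t_1u_1=0=t_1u_1u_0t_0$. It is called a nil-DAHA of type $(C_1^\vee,C_1)$. Set $A=u_0t_0$ and $B=t_1u_1$. **Multiplicity-free.** For a finite-dimensional $\widetilde{\mathcal H}$-module $V$ and $\alpha,\beta\in\mathbb{C}$ let $V_{\alpha,\beta}=\{v\in V: Av=\alpha v,\ Bv=\beta v\}$. $V$ is multiplicity-free (short for $(A,B)$-multiplicity-free) if $A$ and $B$ are diagonalizable on $V$ and every nonzero $V_{\alpha,\beta}$ is one-dimensional. A module is irreducible if it has no nonzero proper submodule. **Adapted block basis.** "$t_i$ preserves $W$" means $t_iW\subseteq W$. If $\dim V=2D$ with $D\ge 1$, an (even) adapted block basis is an ordered basis $b_0,a_1,b_1,\ldots,a_{D-1},b_{D-1},a_D$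 of $V$ for which there are nonzero scalars $\lambda_1,\dots,\lambda_D,\mu_0,\dots,\mu_{D-1}$ such that: $a_i\in V_{\lambda_i,0}$ for $1\le i\le D$; $b_i\in V_{0,\mu_i}$ for $0\le i\le D-1$; $t_0$ preserves $\mathbb{C}b_0$ and $\mathbb{C}a_D$; $t_0$ preserves $\mathrm{span}\{a_i,b_i\}$ for $1\le i\le D-1$; $t_1$ preserves $\mathrm{span}\{b_i,a_{i+1}\}$ for $0\le i\le D-1$. If $\dim V=2D+1$ with $D\ge 1$, an (odd) adapted block basis is an ordered basis $a_0,b_0,a_1,b_1,\ldots,a_{D-1},b_{D-1},a_D$ of $V$ for which there are nonzero scalars $\lambda_0,\dots,\lambda_D,\mu_0,\dots,\mu_{D-1}$ such that: $a_i\in V_{\lambda_i,0}$ for $0\le i\le D$; $b_i\in V_{0,\mu_i}$ for $0\le i\le D-1$; $t_0$ preserves $\mathbb{C}a_D$ and $t_1$ preserves $\mathbb{C}a_0$; $t_0$ preserves $\mathrm{span}\{a_i,b_i\}$ for $0\le i\le D-1$; $t_1$ preserves $\mathrm{span}\{b_i,a_{i+1}\}$ for $0\le i\le D-1$. If $\dim V=1$, a basis $\{a_0\}$ is an (odd) adapted block basis if $a_0\in V_{\lambda_0,0}$ for some $\lambda_0\in\mathbb{C}^\times$. **Parameter sets.** For $D\ge1$, $\mathcal{E}_D$ is the set of tuples of parameters $(\rho_-,\rho_+;\lambda,\mu)$ with $\rho_-,\rho_+\in\{r_0,r_0^{-1}\}$, $\lambda=(\lambda_1,\dots,\lambda_{D-1})$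 with mutually distinct entries in $\mathbb{C}^\times\setminus\{r_0,r_0^{-1}\}$ (empty if $D=1$), and $\mu=(\mu_0,\dots,\mu_{D-1})$ with mutually distinct entries in $\mathbb{C}^\times$. $\mathcal{O}_0$ is the set of pairs $(\rho,\sigma)$ with $\rho\in\{r_0,r_0^{-1}\}$, $\sigma\in\{r_1,r_1^{-1}\}$. For $D\ge1$, $\mathcal{O}_D$ is the set of tuples of parameters $(\rho,\sigma;\lambda,\mu)$ with $\rho\in\{r_0,r_0^{-1}\}$, $\sigma\in\{r_1,r_1^{-1}\}$, $\lambda=(\lambda_0,\dots,\lambda_{D-1})$ with mutually distinct entries in $\mathbb{C}^\times\setminus\{r_0,r_0^{-1}\}$, and $\mu=(\mu_0,\dots,\mu_{D-1})$ with mutually distinct entries in $\mathbb{C}^\times$. *)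

theory Defs
  imports
    "Jordan_Normal_Form.VS_Connect"
    "HOL-Library.Poly_Mapping"
    "HOL-Algebra.QuotRing"
begin

section \<open>The nil-DAHA by generators and relations\<close>

datatype generator = T0 | U0 | T1 | U1

text \<open>The free monoid on the four generators is written additively, because
  the product on \<open>'k \<Rightarrow>\<^sub>0 complex\<close> in \<^theory>\<open>HOL-Library.Poly_Mapping\<close> is the
  convolution with respect to \<open>+\<close> on the keys.  With words as keys this is the
  (noncommutative) free algebra.\<close>

datatype word = Word (letters: "generator list")

instantiation word :: monoid_add
begin

definition zero_word :: word where
  "0 = Word []"

definition plus_word :: "word \<Rightarrow> word \<Rightarrow> word" where
  "v + w = Word (letters v @ letters w)"

instance
  by standard (simp_all add: zero_word_def plus_word_def)

end

type_synonym free_alg = "word \<Rightarrow>\<^sub>0 complex"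

definition gen :: "generator \<Rightarrow> free_alg" where
  "gen g = Poly_Mapping.single (Word [g]) 1"

definition scal :: "complex \<Rightarrow> free_alg" where
  "scal c = Poly_Mapping.single 0 c"

definition relators :: "complex \<Rightarrow> complex \<Rightarrow> free_alg set" where
  "relators r0 r1 =
    {(gen T0 - scal r0) * (gen T0 - scal (inverse r0)),
     (gen T1 - scal r1) * (gen T1 - scal (inverse r1)),
     gen U0 ^ 2 - gen U0,
     gen U1 ^ 2,
     gen U0 * gen T0 * gen T1 * gen U1,
     gen T1 * gen U1 * gen U0 * gen T0}"

text \<open>\<^const>\<open>genideal\<close> is the generated two-sided ideal.\<close>

definition relation_ideal :: "complex \<Rightarrow> complex \<Rightarrow> free_alg set" where
  "relation_ideal r0 r1 = genideal class_ring (relators r0 r1)"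

definition nil_daha :: "complex \<Rightarrow> complex \<Rightarrow> free_alg set ring" where
  "nil_daha r0 r1 = class_ring Quot relation_ideal r0 r1"

definition quot_map :: "complex \<Rightarrow> complex \<Rightarrow> free_alg \<Rightarrow> free_alg set" where
  "quot_map r0 r1 x = relation_ideal r0 r1 +>\<^bsub>class_ring\<^esub> x"

definition elt_t0 :: "complex \<Rightarrow> complex \<Rightarrow> free_alg set" where
  "elt_t0 r0 r1 = quot_map r0 r1 (gen T0)"

definition elt_u0 :: "complex \<Rightarrow> complex \<Rightarrow> free_alg set" where
  "elt_u0 r0 r1 = quot_map r0 r1 (gen U0)"

definition elt_t1 :: "complex \<Rightarrow> complex \<Rightarrow> free_alg set" where
  "elt_t1 r0 r1 = quot_map r0 r1 (gen T1)"

definition elt_u1 :: "complex \<Rightarrow> complex \<Rightarrow> free_alg set" where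
  "elt_u1 r0 r1 = quot_map r0 r1 (gen U1)"

definition elt_A :: "complex \<Rightarrow> complex \<Rightarrow> free_alg set" where
  "elt_A r0 r1 = elt_u0 r0 r1 \<otimes>\<^bsub>nil_daha r0 r1\<^esub> elt_t0 r0 r1"

definition elt_B :: "complex \<Rightarrow> complex \<Rightarrow> free_alg set" where
  "elt_B r0 r1 = elt_t1 r0 r1 \<otimes>\<^bsub>nil_daha r0 r1\<^esub> elt_u1 r0 r1"


section \<open>Modules\<close>

text \<open>Unital left modules over a not necessarily commutative ring: the axioms of
  \<^locale>\<open>module\<close>, which itself requires \<^locale>\<open>cring\<close>.  The fields \<^const>\<open>mult\<close> and
  \<^const>\<open>one\<close> of a module record play no role.\<close>

locale left_module = R?: ring R + M?: abelian_group M
  for R :: "('a, 'c) ring_scheme" (structure) and M :: "('a, 'b, 'd) module_scheme" (structure) +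
  assumes smult_closed [simp, intro]:
      "\<lbrakk>a \<in> carrier R; x \<in> carrier M\<rbrakk> \<Longrightarrow> a \<odot>\<^bsub>M\<^esub> x \<in> carrier M"
    and smult_l_distr:
      "\<lbrakk>a \<in> carrier R; b \<in> carrier R; x \<in> carrier M\<rbrakk> \<Longrightarrow>
        (a \<oplus> b) \<odot>\<^bsub>M\<^esub> x = a \<odot>\<^bsub>M\<^esub> x \<oplus>\<^bsub>M\<^esub> b \<odot>\<^bsub>M\<^esub> x"
    and smult_r_distr:
      "\<lbrakk>a \<in> carrier R; x \<in> carrier M; y \<in> carrier M\<rbrakk> \<Longrightarrow>
        a \<odot>\<^bsub>M\<^esub> (x \<oplus>\<^bsub>M\<^esub> y) = a \<odot>\<^bsub>M\<^esub> x \<oplus>\<^bsub>M\<^esub> a \<odot>\<^bsub>M\<^esub> y"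
    and smult_assoc:
      "\<lbrakk>a \<in> carrier R; b \<in> carrier R; x \<in> carrier M\<rbrakk> \<Longrightarrow>
        (a \<otimes> b) \<odot>\<^bsub>M\<^esub> x = a \<odot>\<^bsub>M\<^esub> (b \<odot>\<^bsub>M\<^esub> x)"
    and smult_one [simp]:
      "x \<in> carrier M \<Longrightarrow> \<one> \<odot>\<^bsub>M\<^esub> x = x"

definition left_submodule :: "('a, 'c) ring_scheme \<Rightarrow> 'b set \<Rightarrow> ('a, 'b, 'd) module_scheme \<Rightarrow> bool"
  where "left_submodule R W M \<longleftrightarrow> additive_subgroup W M \<and>
    (\<forall>a\<in>carrier R. \<forall>w\<in>W. a \<odot>\<^bsub>M\<^esub> w \<in> W)"

definition irreducible_module :: "('a, 'c) ring_scheme \<Rightarrow> ('a, 'b, 'd) module_scheme \<Rightarrow> bool"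
  where "irreducible_module R M \<longleftrightarrow>
    \<not> (\<exists>W. left_submodule R W M \<and> W \<noteq> {\<zero>\<^bsub>M\<^esub>} \<and> W \<noteq> carrier M)"

definition isomorphic_modules ::
  "('a, 'c) ring_scheme \<Rightarrow> ('a, 'b1, 'd1) module_scheme \<Rightarrow> ('a, 'b2, 'd2) module_scheme \<Rightarrow> bool"
  where "isomorphic_modules R M N \<longleftrightarrow>
    (\<exists>f \<in> LinearCombinations.module_hom R M N. bij_betw f (carrier M) (carrier N))"

definition iso_classes ::
  "('a, 'c) ring_scheme \<Rightarrow> ('a, 'b) module set \<Rightarrow> ('a, 'b) module set set"
  where "iso_classes R X = X // {(M, N). M \<in> X \<and> N \<in> X \<and> isomorphic_modules R M N}"

type_synonym 'v daha_module = "(free_alg set, 'v) module"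

text \<open>The complex vector space underlying a module: \<open>c\<close> acts as the image of
  \<open>c \<cdot> 1\<close> in the algebra.\<close>

definition cspace :: "complex \<Rightarrow> complex \<Rightarrow> 'v daha_module \<Rightarrow> (complex, 'v) module" where
  "cspace r0 r1 M = \<lparr>carrier = carrier M, mult = mult M, one = one M, zero = zero M, add = add M,
     smult = \<lambda>c v. quot_map r0 r1 (scal c) \<odot>\<^bsub>M\<^esub> v\<rparr>"

lemma relation_ideal_ideal: "ideal (relation_ideal r0 r1) class_ring"
  unfolding relation_ideal_def by (rule ring.genideal_ideal[OF class_ring.ring_axioms]) simp

lemma quot_map_ring_hom: "quot_map r0 r1 \<in> Ring.ring_hom class_ring (nil_daha r0 r1)"
  using ideal.rcos_ring_hom[OF relation_ideal_ideal, of r0 r1]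
  by (simp add: quot_map_def[abs_def] nil_daha_def)

lemma scal_ring_hom: "scal \<in> Ring.ring_hom class_ring class_ring"
  by (rule ring_hom_memI) (simp_all add: scal_def mult_single single_add)

lemma cspace_vectorspace:
  assumes "left_module (nil_daha r0 r1) M"
  shows "vectorspace class_ring (cspace r0 r1 M)"
proof -
  interpret left_module "nil_daha r0 r1" M by fact
  let ?c = "\<lambda>c. quot_map r0 r1 (scal c)"
  have h: "?c \<in> Ring.ring_hom class_ring (nil_daha r0 r1)"
    using ring_hom_trans[OF scal_ring_hom quot_map_ring_hom] by (simp add: comp_def)
  have c: "?c c \<in> carrier (nil_daha r0 r1)" for c
    using ring_hom_closed[OF h, of c] by simp
  have ab: "abelian_group (cspace r0 r1 M)"
    by (rule abelian_groupI)
      (auto simp: cspace_def M.a_ac intro: M.l_neg M.a_inv_closed)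
  have "module class_ring (cspace r0 r1 M)"
  proof (rule moduleI)
    show "cring (class_ring :: complex ring)" by (rule class_cring.cring_axioms)
    show "abelian_group (cspace r0 r1 M)" by (rule ab)
  qed (use c ring_hom_add[OF h] ring_hom_mult[OF h] ring_hom_one[OF h]
       in \<open>simp_all add: cspace_def smult_l_distr smult_r_distr smult_assoc\<close>)
  then show ?thesis
    by (intro vectorspace.intro class_field.field_axioms)
qed

definition weight_space ::
  "complex \<Rightarrow> complex \<Rightarrow> 'v daha_module \<Rightarrow> complex \<Rightarrow> complex \<Rightarrow> 'v set" where
  "weight_space r0 r1 M \<alpha> \<beta> = {v \<in> carrier M.
     elt_A r0 r1 \<odot>\<^bsub>M\<^esub> v = \<alpha> \<odot>\<^bsub>cspace r0 r1 M\<^esub> v \<and>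
     elt_B r0 r1 \<odot>\<^bsub>M\<^esub> v = \<beta> \<odot>\<^bsub>cspace r0 r1 M\<^esub> v}"

definition acts_diagonalizably ::
  "complex \<Rightarrow> complex \<Rightarrow> 'v daha_module \<Rightarrow> free_alg set \<Rightarrow> bool" where
  "acts_diagonalizably r0 r1 M h \<longleftrightarrow>
    (\<exists>\<B>. vectorspace.basis class_ring (cspace r0 r1 M) \<B> \<and>
       (\<forall>v\<in>\<B>. \<exists>\<alpha>. h \<odot>\<^bsub>M\<^esub> v = \<alpha> \<odot>\<^bsub>cspace r0 r1 M\<^esub> v))"

definition multiplicity_free :: "complex \<Rightarrow> complex \<Rightarrow> 'v daha_module \<Rightarrow> bool" where
  "multiplicity_free r0 r1 M \<longleftrightarrow>
    acts_diagonalizably r0 r1 M (elt_A r0 r1) \<and>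
    acts_diagonalizably r0 r1 M (elt_B r0 r1) \<and>
    (\<forall>\<alpha> \<beta>. weight_space r0 r1 M \<alpha> \<beta> \<noteq> {\<zero>\<^bsub>M\<^esub>} \<longrightarrow>
       vectorspace.dim class_ring (cspace r0 r1 M\<lparr>carrier := weight_space r0 r1 M \<alpha> \<beta>\<rparr>) = 1)"


section \<open>Adapted block bases\<close>

definition preserves :: "complex \<Rightarrow> complex \<Rightarrow> 'v daha_module \<Rightarrow> free_alg set \<Rightarrow> 'v set \<Rightarrow> bool"
  where "preserves r0 r1 M h S \<longleftrightarrow>
    (\<lambda>v. h \<odot>\<^bsub>M\<^esub> v) ` LinearCombinations.module.span class_ring (cspace r0 r1 M) S
      \<subseteq> LinearCombinations.module.span class_ring (cspace r0 r1 M) S"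

definition ordered_basis :: "complex \<Rightarrow> complex \<Rightarrow> 'v daha_module \<Rightarrow> 'v list \<Rightarrow> bool" where
  "ordered_basis r0 r1 M vs \<longleftrightarrow>
    distinct vs \<and> vectorspace.basis class_ring (cspace r0 r1 M) (set vs)"

text \<open>The list \<open>b 0, a 1, b 1, a 2, \<dots>, b (D-1), a D\<close>.\<close>

definition alternating :: "nat \<Rightarrow> (nat \<Rightarrow> 'v) \<Rightarrow> (nat \<Rightarrow> 'v) \<Rightarrow> 'v list" where
  "alternating D a b = concat (map (\<lambda>i. [b i, a (i + 1)]) [0..<D])"

definition even_adapted ::
  "complex \<Rightarrow> complex \<Rightarrow> 'v daha_module \<Rightarrow> nat \<Rightarrow> (nat \<Rightarrow> 'v) \<Rightarrow> (nat \<Rightarrow> 'v) \<Rightarrow>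
    (nat \<Rightarrow> complex) \<Rightarrow> (nat \<Rightarrow> complex) \<Rightarrow> bool" where
  "even_adapted r0 r1 M D a b lam mu \<longleftrightarrow>
    ordered_basis r0 r1 M (alternating D a b) \<and>
    (\<forall>i\<in>{1..D}. lam i \<noteq> 0 \<and> a i \<in> weight_space r0 r1 M (lam i) 0) \<and>
    (\<forall>i\<in>{0..<D}. mu i \<noteq> 0 \<and> b i \<in> weight_space r0 r1 M 0 (mu i)) \<and>
    preserves r0 r1 M (elt_t0 r0 r1) {b 0} \<and>
    preserves r0 r1 M (elt_t0 r0 r1) {a D} \<and>
    (\<forall>i\<in>{1..<D}. preserves r0 r1 M (elt_t0 r0 r1) {a i, b i}) \<and>
    (\<forall>i\<in>{0..<D}. preserves r0 r1 M (elt_t1 r0 r1) {b i, a (i + 1)})"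

text \<open>For \<open>D = 0\<close> (dimension one) only the weight condition on \<open>a 0\<close> remains.\<close>

definition odd_adapted ::
  "complex \<Rightarrow> complex \<Rightarrow> 'v daha_module \<Rightarrow> nat \<Rightarrow> (nat \<Rightarrow> 'v) \<Rightarrow> (nat \<Rightarrow> 'v) \<Rightarrow>
    (nat \<Rightarrow> complex) \<Rightarrow> (nat \<Rightarrow> complex) \<Rightarrow> bool" where
  "odd_adapted r0 r1 M D a b lam mu \<longleftrightarrow>
    ordered_basis r0 r1 M (a 0 # alternating D a b) \<and>
    (\<forall>i\<in>{0..D}. lam i \<noteq> 0 \<and> a i \<in> weight_space r0 r1 M (lam i) 0) \<and>
    (\<forall>i\<in>{0..<D}. mu i \<noteq> 0 \<and> b i \<in> weight_space r0 r1 M 0 (mu i)) \<and>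
    (D \<ge> 1 \<longrightarrow> preserves r0 r1 M (elt_t0 r0 r1) {a D} \<and>
               preserves r0 r1 M (elt_t1 r0 r1) {a 0}) \<and>
    (\<forall>i\<in>{0..<D}. preserves r0 r1 M (elt_t0 r0 r1) {a i, b i}) \<and>
    (\<forall>i\<in>{0..<D}. preserves r0 r1 M (elt_t1 r0 r1) {b i, a (i + 1)})"


section \<open>The two families of modules and their parameters\<close>

text \<open>Isomorphism classes are formed among the modules whose carrier is a subset of a fixed
  type \<open>'v\<close>.  A nonzero finite-dimensional complex space has exactly as many elements as
  \<open>complex\<close>, so as soon as \<open>complex\<close> embeds into \<open>'v\<close> every such module is isomorphic to one
  with carrier inside \<open>'v\<close>, and otherwise there is none.\<close>

definition mf_irreducible :: "complex \<Rightarrow> complex \<Rightarrow> nat \<Rightarrow> 'v daha_module \<Rightarrow> bool" where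
  "mf_irreducible r0 r1 n M \<longleftrightarrow>
    left_module (nil_daha r0 r1) M \<and>
    vectorspace.fin_dim class_ring (cspace r0 r1 M) \<and>
    vectorspace.dim class_ring (cspace r0 r1 M) = n \<and>
    multiplicity_free r0 r1 M \<and>
    irreducible_module (nil_daha r0 r1) M"

definition even_modules :: "complex \<Rightarrow> complex \<Rightarrow> nat \<Rightarrow> 'v daha_module set" where
  "even_modules r0 r1 D =
    {M. mf_irreducible r0 r1 (2 * D) M \<and> (\<exists>a b lam mu. even_adapted r0 r1 M D a b lam mu)}"

definition odd_modules :: "complex \<Rightarrow> complex \<Rightarrow> nat \<Rightarrow> 'v daha_module set" where
  "odd_modules r0 r1 D =
    {M. mf_irreducible r0 r1 (2 * D + 1) M \<and> (\<exists>a b lam mu. odd_adapted r0 r1 M D a b lam mu)}"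

type_synonym params = "complex \<times> complex \<times> complex list \<times> complex list"

text \<open>\<open>(\<rho>\<^sub>-, \<rho>\<^sub>+, [\<lambda>\<^sub>1, \<dots>, \<lambda>\<^bsub>D-1\<^esub>], [\<mu>\<^sub>0, \<dots>, \<mu>\<^bsub>D-1\<^esub>])\<close>, for \<open>D \<ge> 1\<close>.\<close>

definition even_params :: "complex \<Rightarrow> nat \<Rightarrow> params set" where
  "even_params r0 D = {(\<rho>m, \<rho>p, ls, ms).
     \<rho>m \<in> {r0, inverse r0} \<and> \<rho>p \<in> {r0, inverse r0} \<and>
     length ls = D - 1 \<and> distinct ls \<and> set ls \<inter> {0, r0, inverse r0} = {} \<and>
     length ms = D \<and> distinct ms \<and> 0 \<notin> set ms}"

text \<open>\<open>(\<rho>, \<sigma>, [\<lambda>\<^sub>0, \<dots>, \<lambda>\<^bsub>D-1\<^esub>], [\<mu>\<^sub>0, \<dots>, \<mu>\<^bsub>D-1\<^esub>])\<close>; for \<open>D = 0\<close> both lists are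
  empty and only the pair \<open>(\<rho>, \<sigma>)\<close> remains.\<close>

definition odd_params :: "complex \<Rightarrow> complex \<Rightarrow> nat \<Rightarrow> params set" where
  "odd_params r0 r1 D = {(\<rho>, \<sigma>, ls, ms).
     \<rho> \<in> {r0, inverse r0} \<and> \<sigma> \<in> {r1, inverse r1} \<and>
     length ls = D \<and> distinct ls \<and> set ls \<inter> {0, r0, inverse r0} = {} \<and>
     length ms = D \<and> distinct ms \<and> 0 \<notin> set ms}"

text \<open>The parameters read off from an adapted block basis: the weights, and the scalars
  by which \<open>t\<^sub>0\<close> and \<open>t\<^sub>1\<close> act on the end vectors.  The last weight \<open>\<lambda>\<^sub>D\<close> is not listed:
  \<open>A a\<^sub>D = u\<^sub>0 t\<^sub>0 a\<^sub>D\<close> with \<open>u\<^sub>0\<close> idempotent forces it to be \<open>\<rho>\<^sub>+\<close> (resp. \<open>\<rho>\<close>).\<close>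

fun has_even_params :: "complex \<Rightarrow> complex \<Rightarrow> nat \<Rightarrow> 'v daha_module \<Rightarrow> params \<Rightarrow> bool" where
  "has_even_params r0 r1 D M (\<rho>m, \<rho>p, ls, ms) \<longleftrightarrow>
    (\<exists>a b lam mu. even_adapted r0 r1 M D a b lam mu \<and>
       elt_t0 r0 r1 \<odot>\<^bsub>M\<^esub> b 0 = \<rho>m \<odot>\<^bsub>cspace r0 r1 M\<^esub> b 0 \<and>
       elt_t0 r0 r1 \<odot>\<^bsub>M\<^esub> a D = \<rho>p \<odot>\<^bsub>cspace r0 r1 M\<^esub> a D \<and>
       ls = map lam [1..<D] \<and> ms = map mu [0..<D])"

fun has_odd_params :: "complex \<Rightarrow> complex \<Rightarrow> nat \<Rightarrow> 'v daha_module \<Rightarrow> params \<Rightarrow> bool" where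
  "has_odd_params r0 r1 D M (\<rho>, \<sigma>, ls, ms) \<longleftrightarrow>
    (\<exists>a b lam mu. odd_adapted r0 r1 M D a b lam mu \<and>
       elt_t0 r0 r1 \<odot>\<^bsub>M\<^esub> a D = \<rho> \<odot>\<^bsub>cspace r0 r1 M\<^esub> a D \<and>
       elt_t1 r0 r1 \<odot>\<^bsub>M\<^esub> a 0 = \<sigma> \<odot>\<^bsub>cspace r0 r1 M\<^esub> a 0 \<and>
       ls = map lam [0..<D] \<and> ms = map mu [0..<D])"

end

theory Submission
  imports Defs "HOL-Library.Function_Algebras"
begin

text \<open>
  Let \<open>M\<close> be one of the modules in question, and read its adapted block basis from the right, as
  \<open>a\<^sub>D, b\<^bsub>D-1\<^esub>, a\<^bsub>D-1\<^esub>, b\<^bsub>D-2\<^esub>, \<dots>\<close>.  In this order both parities of the dimension begin in the same way, with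
  an eigenvector \<open>a\<^sub>D\<close> of \<open>t\<^sub>0\<close>; after that \<open>t\<^sub>1\<close> and \<open>t\<^sub>0\<close> alternately preserve the span of two
  neighbours, and the last vector is an eigenvector of \<open>t\<^sub>0\<close> or \<open>t\<^sub>1\<close> according to parity.

  Since \<open>u\<^sub>0\<close> is idempotent and \<open>A = u\<^sub>0t\<^sub>0\<close>, the vectors \<open>a\<^sub>i\<close> are fixed by \<open>u\<^sub>0\<close>; since \<open>t\<^sub>1\<close> is invertible
  and \<open>B = t\<^sub>1u\<^sub>1\<close>, they are killed by \<open>u\<^sub>1\<close>.  Together with \<open>u\<^sub>1\<^sup>2 = 0\<close> and the quadratic relations, which fix trace and
  determinant of the two-dimensional blocks, this determines every block from the weights \<open>\<lambda>\<^sub>i\<close>, \<open>\<mu>\<^sub>i\<close> up to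
  rescaling of the basis, provided that the off-diagonal entries do not vanish.  A vanishing entry would cut the chain
  and make one part of it span a proper submodule, so irreducibility excludes it; for \<open>t\<^sub>0\<close> the nonvanishing also
  says that \<open>\<lambda>\<^sub>i\<close> is neither \<open>r\<^sub>0\<close> nor \<open>r\<^sub>0\<inverse>\<close> for \<open>i < D\<close>.  Multiplicity-freeness makes the weights distinct.
  Hence \<open>M\<close> has the normal form \<open>std\<close>, with parameters in the required set: this is \<open>adapted_chain_std\<close>.

  Conversely, for all such parameters the operators \<open>std\<close> satisfy the defining relations, and they define a module on a
  subset of any type into which the complex numbers embed (\<open>ex_std_module\<close>).  In the normal form \<open>A\<close> and \<open>B\<close> are diagonal with
  pairwise distinct joint weights.  This makes the module multiplicity-free, and irreducible because a nonzero
  submodule contains a basis vector and from it reaches all others along the nonzero off-diagonal entries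
  (\<open>std_module_mf_irreducible\<close>).

  Two modules with the same normal form are isomorphic, and a module has only one normal form: \<open>a\<^sub>D\<close> is, up to scaling, the
  only \<open>A\<close>-eigenvector with eigenvalue in \<open>{r\<^sub>0, r\<^sub>0\<inverse>}\<close>, and the remaining basis vectors and their weights are
  recovered from it by applying \<open>t\<^sub>1\<close> and \<open>t\<^sub>0\<close> in turn (\<open>std_parameters_unique\<close>).  So parameters, normal
  forms and isomorphism classes correspond to one another.
\<close>

section \<open>Coordinates on finite-dimensional complex spaces\<close>

text \<open>Every dimension is realised inside the one type of sequences, as those vanishing from index
  \<open>n\<close> on, so that spaces of different dimension, and sums and scalings of their vectors, need no
  carrier bookkeeping.\<close>

type_synonym seq = "nat \<Rightarrow> complex"

definition coords :: "nat \<Rightarrow> seq set" where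
  "coords n = {x. \<forall>j\<ge>n. x j = 0}"

definition e_vec :: "nat \<Rightarrow> seq" where
  "e_vec j = (\<lambda>i. if i = j then 1 else 0)"

definition coordinates ::
  "nat \<Rightarrow> (complex, 'v, 'd) module_scheme \<Rightarrow> (seq \<Rightarrow> 'v) \<Rightarrow> bool" where
  "coordinates n V \<phi> \<longleftrightarrow> bij_betw \<phi> (coords n) (carrier V) \<and>
    (\<forall>x\<in>coords n. \<forall>y\<in>coords n. \<phi> (x + y) = \<phi> x \<oplus>\<^bsub>V\<^esub> \<phi> y) \<and>
    (\<forall>c. \<forall>x\<in>coords n. \<phi> (\<lambda>j. c * x j) = c \<odot>\<^bsub>V\<^esub> \<phi> x)"

lemma e_vec_other: "i \<noteq> k \<Longrightarrow> e_vec k i = 0"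
  by (simp add: e_vec_def)

lemma coords_zero [simp]: "0 \<in> coords n"
  by (simp add: coords_def)

lemma coords_add [simp]: "x \<in> coords n \<Longrightarrow> y \<in> coords n \<Longrightarrow> x + y \<in> coords n"
  by (simp add: coords_def)

lemma coords_scale [simp]: "x \<in> coords n \<Longrightarrow> (\<lambda>j. c * x j) \<in> coords n"
  by (simp add: coords_def)

lemma coords_e_vec [simp]: "j < n \<Longrightarrow> e_vec j \<in> coords n"
  by (simp add: coords_def e_vec_def)

lemma coords_sum: "(\<And>i. i \<in> I \<Longrightarrow> f i \<in> coords n) \<Longrightarrow> sum f I \<in> coords n"
  by (induction I rule: infinite_finite_induct) auto

lemma sum_fun_apply: "(sum f I) (i :: 'i) = (\<Sum>j\<in>I. f j i :: complex)"
  by (induction I rule: infinite_finite_induct) auto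

lemma coords_expansion_support:
  assumes "J \<subseteq> {..<n}" and "\<And>j. j \<notin> J \<Longrightarrow> x j = 0"
  shows "x = (\<Sum>j\<in>J. (\<lambda>i. x j * e_vec j i))"
proof
  fix i
  have f: "finite J"
    using assms(1) finite_subset by blast
  have "(\<Sum>j\<in>J. x j * e_vec j i) = (\<Sum>j\<in>J. if j = i then x j else 0)"
    by (rule sum.cong) (auto simp: e_vec_def)
  then show "x i = (\<Sum>j\<in>J. (\<lambda>i. x j * e_vec j i)) i"
    using assms f by (auto simp: sum_fun_apply)
qed

lemma coords_expansion: "x \<in> coords n \<Longrightarrow> x = (\<Sum>j<n. (\<lambda>i. x j * e_vec j i))"
  by (rule coords_expansion_support) (auto simp: coords_def)

lemma linear_zero:
  assumes "\<And>c x. x \<in> coords n \<Longrightarrow> T (\<lambda>j. c * x j) = (\<lambda>j. c * T x j :: complex)"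
  shows "T 0 = 0"
proof -
  have z: "(\<lambda>j. 0 * (0 :: seq) j) = 0"
    by (simp add: fun_eq_iff)
  show ?thesis
    using assms[OF coords_zero, of 0] unfolding z by (simp add: fun_eq_iff)
qed

text \<open>Expand \<open>x\<close> in unit vectors.  This is the only form in which matrices are used: the numbers
  \<open>T (e_vec j) i\<close> are the matrix entries of \<open>T\<close>.\<close>

lemma linear_on_units:
  assumes add: "\<And>x y. x \<in> coords n \<Longrightarrow> y \<in> coords n \<Longrightarrow> T (x + y) = T x + T y"
    and scale: "\<And>c x. x \<in> coords n \<Longrightarrow> T (\<lambda>j. c * x j) = (\<lambda>j. c * T x j)"
    and x: "x \<in> coords n"
  shows "T x i = (\<Sum>j<n. x j * (T (e_vec j) i :: complex))"
proof -
  have z: "T 0 = 0"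
    by (rule linear_zero[OF scale])
  have "T (\<Sum>j\<in>I. (\<lambda>i. x j * e_vec j i)) = (\<Sum>j\<in>I. (\<lambda>i. x j * T (e_vec j) i))"
    if "finite I" "I \<subseteq> {..<n}" for I
    using that
  proof (induction I)
    case (insert k I)
    have "(\<Sum>j\<in>I. (\<lambda>i. x j * e_vec j i)) \<in> coords n"
      using insert by (intro coords_sum) auto
    then have "T ((\<lambda>i. x k * e_vec k i) + (\<Sum>j\<in>I. (\<lambda>i. x j * e_vec j i))) =
        (\<lambda>i. x k * T (e_vec k) i) + (\<Sum>j\<in>I. (\<lambda>i. x j * T (e_vec j) i))"
      using insert by (subst add) (auto simp only: scale coords_scale coords_e_vec insert_subset lessThan_iff)
    then show ?case
      by (simp only: sum.insert[OF insert(1,2)])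
  qed (simp add: z)
  from this[of "{..<n}"] have "T x = (\<Sum>j<n. (\<lambda>i. x j * T (e_vec j) i))"
    unfolding coords_expansion[OF x, symmetric] by simp
  from fun_cong[OF this, of i] show ?thesis
    by (simp only: sum_fun_apply)
qed

lemma coordinates_closed:
  "coordinates n V \<phi> \<Longrightarrow> x \<in> coords n \<Longrightarrow> \<phi> x \<in> carrier V"
  by (auto simp: coordinates_def bij_betw_def)

lemma coordinates_add:
  "coordinates n V \<phi> \<Longrightarrow> x \<in> coords n \<Longrightarrow> y \<in> coords n \<Longrightarrow> \<phi> (x + y) = \<phi> x \<oplus>\<^bsub>V\<^esub> \<phi> y"
  by (auto simp: coordinates_def)

lemma coordinates_scale:
  "coordinates n V \<phi> \<Longrightarrow> x \<in> coords n \<Longrightarrow> \<phi> (\<lambda>j. c * x j) = c \<odot>\<^bsub>V\<^esub> \<phi> x"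
  by (auto simp: coordinates_def)

lemma coordinates_surj:
  "coordinates n V \<phi> \<Longrightarrow> v \<in> carrier V \<Longrightarrow> \<exists>x\<in>coords n. v = \<phi> x"
  by (auto simp: coordinates_def bij_betw_def)

lemma coordinates_eq_iff:
  "coordinates n V \<phi> \<Longrightarrow> x \<in> coords n \<Longrightarrow> y \<in> coords n \<Longrightarrow> \<phi> x = \<phi> y \<longleftrightarrow> x = y"
  by (auto simp: coordinates_def bij_betw_def inj_on_def)

text \<open>Bases indexed by an initial segment of the naturals and coordinate isomorphisms are the same
  thing: \<open>units_basis\<close> and \<open>basis_coordinates\<close> pass between them, so afterwards all linear algebra
  can be done on sequences.\<close>

locale complex_space = vectorspace "class_ring :: complex ring" V for V :: "(complex, 'v) module"
begin

lemma coordinates_zero: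
  assumes "coordinates n V \<phi>" shows "\<phi> 0 = \<zero>\<^bsub>V\<^esub>"
proof -
  have z: "(\<lambda>j. 0 * (0 :: seq) j) = 0"
    by (simp add: fun_eq_iff)
  have "\<phi> (\<lambda>j. 0 * (0 :: seq) j) = 0 \<odot>\<^bsub>V\<^esub> \<phi> 0"
    by (rule coordinates_scale[OF assms coords_zero])
  also have "\<dots> = \<zero>\<^bsub>V\<^esub>"
    using lmult_0[of "\<phi> 0"] coordinates_closed[OF assms, of 0] by simp
  finally show ?thesis
    unfolding z .
qed

lemma coordinates_sum:
  assumes \<phi>: "coordinates n V \<phi>" and "finite J" and "\<And>j. j \<in> J \<Longrightarrow> f j \<in> coords n"
  shows "\<phi> (sum f J) = (\<Oplus>\<^bsub>V\<^esub>j\<in>J. \<phi> (f j))"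
  using assms(2,3)
proof (induction J)
  case empty
  then show ?case by (simp only: sum.empty finsum_empty coordinates_zero[OF \<phi>])
next
  case (insert k J)
  have "\<phi> (f k + sum f J) = \<phi> (f k) \<oplus>\<^bsub>V\<^esub> \<phi> (sum f J)"
    using insert by (intro coordinates_add[OF \<phi>] coords_sum) auto
  moreover have "sum f (insert k J) = f k + sum f J"
    using insert by (intro sum.insert)
  moreover have "(\<Oplus>\<^bsub>V\<^esub>j\<in>insert k J. \<phi> (f j)) = \<phi> (f k) \<oplus>\<^bsub>V\<^esub> (\<Oplus>\<^bsub>V\<^esub>j\<in>J. \<phi> (f j))"
    using insert coordinates_closed[OF \<phi>] by (intro finsum_insert) auto
  moreover have "\<phi> (sum f J) = (\<Oplus>\<^bsub>V\<^esub>j\<in>J. \<phi> (f j))"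
    using insert by blast
  ultimately show ?case
    by (simp only:)
qed

lemma coordinates_lincomb:
  assumes \<phi>: "coordinates n V \<phi>" and J: "J \<subseteq> {..<n}"
    and supp: "\<And>j. j \<notin> J \<Longrightarrow> x j = 0"
    and a: "\<And>j. j \<in> J \<Longrightarrow> a (\<phi> (e_vec j)) = x j"
  shows "lincomb a ((\<lambda>j. \<phi> (e_vec j)) ` J) = \<phi> x"
proof -
  have f: "finite J"
    using J finite_subset by blast
  have inj: "inj_on (\<lambda>j. \<phi> (e_vec j)) J"
  proof (rule inj_onI)
    fix i j assume "i \<in> J" "j \<in> J" "\<phi> (e_vec i) = \<phi> (e_vec j)"
    then have "e_vec i = e_vec j"
      using J coordinates_eq_iff[OF \<phi>] by (metis coords_e_vec lessThan_iff subsetD)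
    then show "i = j"
      by (metis e_vec_def zero_neq_one)
  qed
  have u: "j < n" if "j \<in> J" for j using that J by auto
  have cl: "\<phi> (e_vec j) \<in> carrier V" if "j \<in> J" for j
    using u[OF that] by (simp add: coordinates_closed[OF \<phi>])
  have "lincomb a ((\<lambda>j. \<phi> (e_vec j)) ` J) = (\<Oplus>\<^bsub>V\<^esub>j\<in>J. x j \<odot>\<^bsub>V\<^esub> \<phi> (e_vec j))"
    unfolding lincomb_def
    by (subst finsum_reindex[OF _ inj]) (auto intro!: finsum_cong' simp: a cl)
  also have "\<dots> = (\<Oplus>\<^bsub>V\<^esub>j\<in>J. \<phi> (\<lambda>i. x j * e_vec j i))"
    by (rule finsum_cong') (auto simp: coordinates_scale[OF \<phi>] u cl coordinates_closed[OF \<phi>])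
  also have "\<dots> = \<phi> (\<Sum>j\<in>J. (\<lambda>i. x j * e_vec j i))"
    by (rule coordinates_sum[OF \<phi> f, symmetric]) (simp add: u)
  also have "\<dots> = \<phi> x"
    by (rule arg_cong[of _ _ \<phi>], rule coords_expansion_support[OF J supp, symmetric])
  finally show ?thesis .
qed

lemma coordinates_inj_unit:
  assumes \<phi>: "coordinates n V \<phi>"
  shows "inj_on (\<lambda>j. \<phi> (e_vec j)) {..<n}"
proof (rule inj_onI)
  fix i j assume "i \<in> {..<n}" "j \<in> {..<n}" "\<phi> (e_vec i) = \<phi> (e_vec j)"
  then have "e_vec i = e_vec j"
    using coordinates_eq_iff[OF \<phi>] by (metis coords_e_vec lessThan_iff)
  then show "i = j"
    by (metis e_vec_def zero_neq_one)
qed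

lemma span_units:
  assumes \<phi>: "coordinates n V \<phi>" and J: "J \<subseteq> {..<n}"
  shows "span ((\<lambda>j. \<phi> (e_vec j)) ` J) = \<phi> ` {x. \<forall>j. j \<notin> J \<longrightarrow> x j = 0}"
proof -
  let ?w = "\<lambda>j. \<phi> (e_vec j)"
  have f: "finite J"
    using J finite_subset by blast
  have inj: "inj_on ?w J"
    using coordinates_inj_unit[OF \<phi>] J inj_on_subset by blast
  have sp: "span (?w ` J) = {lincomb a (?w ` J) |a. a \<in> ?w ` J \<rightarrow> carrier class_ring}"
    using J f by (intro finite_span) (auto simp: coordinates_closed[OF \<phi>])
  show ?thesis
  proof (intro equalityI subsetI)
    fix v assume "v \<in> span (?w ` J)"
    then obtain a where v: "v = lincomb a (?w ` J)" using sp by auto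
    have "v = \<phi> (\<lambda>j. if j \<in> J then a (?w j) else 0)"
      unfolding v by (rule coordinates_lincomb[OF \<phi> J]) auto
    then show "v \<in> \<phi> ` {x. \<forall>j. j \<notin> J \<longrightarrow> x j = 0}" by auto
  next
    fix v assume "v \<in> \<phi> ` {x. \<forall>j. j \<notin> J \<longrightarrow> x j = 0}"
    then obtain x where x: "\<And>j. j \<notin> J \<Longrightarrow> x j = 0" and v: "v = \<phi> x" by auto
    have "v = lincomb (\<lambda>u. x (inv_into J ?w u)) (?w ` J)"
      unfolding v by (rule coordinates_lincomb[OF \<phi> J x, symmetric])
        (simp_all add: inv_into_f_f[OF inj])
    then show "v \<in> span (?w ` J)" using sp by auto
  qed
qed

lemma units_basis:
  assumes \<phi>: "coordinates n V \<phi>"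
  shows "basis ((\<lambda>j. \<phi> (e_vec j)) ` {..<n})"
proof -
  let ?w = "\<lambda>j. \<phi> (e_vec j)"
  have sub: "?w ` {..<n} \<subseteq> carrier V"
    by (auto simp: coordinates_closed[OF \<phi>])
  note inj = coordinates_inj_unit[OF \<phi>]
  have lc: "lincomb a (?w ` {..<n}) = \<phi> (\<lambda>j. if j < n then a (?w j) else 0)" for a
    by (rule coordinates_lincomb[OF \<phi>]) auto
  show ?thesis
    unfolding basis_criterion[OF finite_imageI[OF finite_lessThan] sub]
  proof (intro allI impI)
    fix v assume "v \<in> carrier V"
    then obtain x where x: "x \<in> coords n" "v = \<phi> x"
      using coordinates_surj[OF \<phi>] by blast
    show "\<exists>!a. a \<in> ?w ` {..<n} \<rightarrow>\<^sub>E carrier class_ring \<and> lincomb a (?w ` {..<n}) = v"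
    proof (rule ex1I)
      let ?a = "restrict (\<lambda>u. x (inv_into {..<n} ?w u)) (?w ` {..<n})"
      have "(\<lambda>j. if j < n then ?a (?w j) else 0) = x"
        using x(1) inv_into_f_f[OF inj] by (auto simp: coords_def)
      then show "?a \<in> ?w ` {..<n} \<rightarrow>\<^sub>E carrier class_ring \<and> lincomb ?a (?w ` {..<n}) = v"
        using x by (simp add: lc)
    next
      fix b assume b: "b \<in> ?w ` {..<n} \<rightarrow>\<^sub>E carrier class_ring \<and> lincomb b (?w ` {..<n}) = v"
      then have "\<phi> (\<lambda>j. if j < n then b (?w j) else 0) = \<phi> x"
        by (simp add: lc x)
      then have bx: "(\<lambda>j. if j < n then b (?w j) else 0) = x"
        using coordinates_eq_iff[OF \<phi>, of "\<lambda>j. if j < n then b (?w j) else 0" x] x(1)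
        by (simp add: coords_def)
      show "b = restrict (\<lambda>u. x (inv_into {..<n} ?w u)) (?w ` {..<n})"
      proof
        fix u
        show "b u = restrict (\<lambda>u. x (inv_into {..<n} ?w u)) (?w ` {..<n}) u"
        proof (cases "u \<in> ?w ` {..<n}")
          case True
          then obtain j where j: "j < n" "u = ?w j" by auto
          then show ?thesis
            using inv_into_f_f[OF inj, of j] fun_cong[OF bx, of j] by auto
        next
          case False
          then show ?thesis using b by (auto simp: PiE_def extensional_def)
        qed
      qed
    qed
  qed
qed

lemma coordinates_dim:
  assumes \<phi>: "coordinates n V \<phi>"
  shows "fin_dim" and "dim = n"
proof -
  let ?B = "(\<lambda>j. \<phi> (e_vec j)) ` {..<n}"
  have "finite ?B" "card ?B = n"
    using coordinates_inj_unit[OF \<phi>] by (auto simp: card_image)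
  with units_basis[OF \<phi>] show "fin_dim" "dim = n"
    using dim_basis[of ?B] by (auto simp: basis_def fin_dim_def)
qed

lemma basis_coordinates:
  assumes inj: "inj_on w {..<n}" and b: "basis (w ` {..<n})"
  shows "\<exists>\<phi>. coordinates n V \<phi> \<and> (\<forall>j<n. \<phi> (e_vec j) = w j)"
proof -
  define \<phi> where "\<phi> x = (\<Oplus>\<^bsub>V\<^esub>j\<in>{..<n}. x j \<odot>\<^bsub>V\<^esub> w j)" for x
  have cl: "w j \<in> carrier V" if "j < n" for j
    using b that by (auto simp: basis_def)
  have lc: "lincomb a (w ` {..<n}) = \<phi> (\<lambda>j. a (w j))" for a
    unfolding lincomb_def \<phi>_def
    by (subst finsum_reindex[OF _ inj]) (auto simp: cl)
  have \<phi>_cong: "\<phi> x = \<phi> y" if "\<And>j. j < n \<Longrightarrow> x j = y j" for x y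
    unfolding \<phi>_def by (rule finsum_cong') (auto simp: that cl)
  have ex1: "\<exists>!a. a \<in> w ` {..<n} \<rightarrow>\<^sub>E carrier class_ring \<and> lincomb a (w ` {..<n}) = v"
    if "v \<in> carrier V" for v
  proof -
    have "w ` {..<n} \<subseteq> carrier V"
      using cl by auto
    then show ?thesis
      using b that basis_criterion[of "w ` {..<n}"] by (metis finite_imageI finite_lessThan)
  qed
  have rep: "restrict (\<lambda>u. x (inv_into {..<n} w u)) (w ` {..<n}) \<in> w ` {..<n} \<rightarrow>\<^sub>E carrier class_ring \<and>
      lincomb (restrict (\<lambda>u. x (inv_into {..<n} w u)) (w ` {..<n})) (w ` {..<n}) = \<phi> x" for x
    by (auto simp: lc inj intro!: \<phi>_cong)
  have pcl: "\<phi> x \<in> carrier V" for x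
    unfolding \<phi>_def by (auto simp: cl)
  have "bij_betw \<phi> (coords n) (carrier V)"
  proof (rule bij_betwI')
    fix x y assume x: "x \<in> coords n" and y: "y \<in> coords n"
    show "\<phi> x = \<phi> y \<longleftrightarrow> x = y"
    proof
      assume "\<phi> x = \<phi> y"
      then have eq: "restrict (\<lambda>u. x (inv_into {..<n} w u)) (w ` {..<n}) =
        restrict (\<lambda>u. y (inv_into {..<n} w u)) (w ` {..<n})"
        using ex1[OF pcl[of x]] rep[of x] rep[of y] by auto
      show "x = y"
      proof
        fix j
        show "x j = y j"
          using fun_cong[OF eq, of "w j"] inj x y by (cases "j < n") (auto simp: coords_def)
      qed
    qed simp
  next
    fix v assume "v \<in> carrier V"
    then obtain a where "lincomb a (w ` {..<n}) = v"
      using ex1 by blast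
    then have "v = \<phi> (\<lambda>j. if j < n then a (w j) else 0)"
      unfolding lc by (auto intro: \<phi>_cong)
    then show "\<exists>x\<in>coords n. v = \<phi> x"
      by (intro bexI) (auto simp: coords_def)
  qed (rule pcl)
  moreover have "\<phi> (x + y) = \<phi> x \<oplus>\<^bsub>V\<^esub> \<phi> y" for x y
  proof -
    have "\<phi> (x + y) = (\<Oplus>\<^bsub>V\<^esub>j\<in>{..<n}. x j \<odot>\<^bsub>V\<^esub> w j \<oplus>\<^bsub>V\<^esub> y j \<odot>\<^bsub>V\<^esub> w j)"
      unfolding \<phi>_def using smult_l_distr by (intro finsum_cong') (auto simp: cl)
    then show ?thesis
      unfolding \<phi>_def by (simp add: finsum_addf Pi_def cl)
  qed
  moreover have "\<phi> (\<lambda>j. c * x j) = c \<odot>\<^bsub>V\<^esub> \<phi> x" for c x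
  proof -
    have "\<phi> (\<lambda>j. c * x j) = (\<Oplus>\<^bsub>V\<^esub>j\<in>{..<n}. c \<odot>\<^bsub>V\<^esub> (x j \<odot>\<^bsub>V\<^esub> w j))"
      unfolding \<phi>_def using smult_assoc1 by (intro finsum_cong') (auto simp: cl)
    then show ?thesis
      unfolding \<phi>_def using finsum_smult[of c "\<lambda>j. x j \<odot>\<^bsub>V\<^esub> w j"] by (simp add: Pi_def cl)
  qed
  moreover have "\<phi> (e_vec k) = w k" if "k < n" for k
  proof -
    have "\<phi> (e_vec k) = (\<Oplus>\<^bsub>V\<^esub>j\<in>{..<n}. if k = j then w j else \<zero>\<^bsub>V\<^esub>)"
      unfolding \<phi>_def e_vec_def using that lmult_0 smult_one
      by (intro finsum_cong') (auto simp: cl)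
    also have "\<dots> = w k"
      using that by (intro add.finprod_singleton) (auto simp: cl)
    finally show ?thesis .
  qed
  ultimately show ?thesis
    unfolding coordinates_def by blast
qed

text \<open>Multiplicity-freeness enters through this lemma: it forces two basis vectors of the same
  joint weight to be proportional.\<close>

lemma dim_one_collinear:
  assumes "fin_dim" and "dim = 1" and u: "u \<in> carrier V" and v: "v \<in> carrier V" "v \<noteq> \<zero>\<^bsub>V\<^esub>"
  shows "\<exists>c. u = c \<odot>\<^bsub>V\<^esub> v"
proof -
  obtain B where B: "finite B" "basis B"
    using finite_basis_exists[OF assms(1)] by blast
  then have "card B = 1"
    using dim_basis assms(2) by simp
  then obtain w where w: "B = {w}"
    by (auto simp: card_1_singleton_iff)
  have "inj_on (\<lambda>_. w) {..<1::nat}" "basis ((\<lambda>_. w) ` {..<1::nat})"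
    using B w by (auto simp: inj_on_def lessThan_Suc)
  then obtain \<phi> where \<phi>: "coordinates 1 V \<phi>"
    using basis_coordinates by blast
  obtain x y where x: "x \<in> coords 1" "u = \<phi> x" and y: "y \<in> coords 1" "v = \<phi> y"
    using coordinates_surj[OF \<phi>] u v by metis
  have "y 0 \<noteq> 0"
  proof
    assume "y 0 = 0"
    then have "y = 0"
      using y(1) by (auto simp: coords_def fun_eq_iff) (metis One_nat_def Suc_leI gr0I)
    then show False
      using v y coordinates_zero[OF \<phi>] by simp
  qed
  have xy: "x = (\<lambda>j. (x 0 / y 0) * y j)"
  proof
    fix j show "x j = (x 0 / y 0) * y j"
      using x(1) y(1) \<open>y 0 \<noteq> 0\<close> by (cases j) (auto simp: coords_def)
  qed
  have "u = (x 0 / y 0) \<odot>\<^bsub>V\<^esub> v"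
    unfolding x(2) y(2) coordinates_scale[OF \<phi> y(1), symmetric] by (rule arg_cong[OF xy])
  then show ?thesis ..
qed

end

section \<open>Modules over the nil-DAHA through their generators\<close>

lemma free_alg_single_induct [case_names single add]:
  fixes x :: free_alg
  assumes "\<And>w c. P (Poly_Mapping.single w c)" and "\<And>x y. P x \<Longrightarrow> P y \<Longrightarrow> P (x + y)"
  shows "P x"
proof (induction x rule: update_induct)
  case const
  show ?case using assms(1)[of 0 0] by simp
next
  case (update f a b)
  have "Poly_Mapping.update a b f = Poly_Mapping.single a b + f"
    using update(1) by (intro poly_mapping_eqI) (auto simp: lookup_update lookup_add lookup_single when_def in_keys_iff)
  then show ?case using assms update by simp
qed

text \<open>The free algebra is generated by the scalars and the four generators, so anything compatible
  with sums and products need only be checked on those.\<close>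

lemma free_alg_induct [case_names scal gen add mult]:
  fixes x :: free_alg
  assumes scal: "\<And>c. P (scal c)" and gen: "\<And>g. P (gen g)"
    and add: "\<And>x y. P x \<Longrightarrow> P y \<Longrightarrow> P (x + y)" and mult: "\<And>x y. P x \<Longrightarrow> P y \<Longrightarrow> P (x * y)"
  shows "P x"
proof (induction x rule: free_alg_single_induct)
  case (single w c)
  have "P (Poly_Mapping.single (Word l) c)" for l
  proof (induction l)
    case Nil
    show ?case using scal[of c] by (simp add: scal_def zero_word_def)
  next
    case (Cons g l)
    have "Poly_Mapping.single (Word (g # l)) c = gen g * Poly_Mapping.single (Word l) c"
      by (simp add: gen_def mult_single plus_word_def)
    then show ?case using gen mult Cons by simp
  qed
  then show ?case by (cases w) auto
qed (rule add)

lemma quot_map_carrier [simp]: "quot_map r0 r1 x \<in> carrier (nil_daha r0 r1)"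
  using ring_hom_closed[OF quot_map_ring_hom] by simp

lemma quot_map_surj:
  assumes "X \<in> carrier (nil_daha r0 r1)"
  obtains x where "X = quot_map r0 r1 x"
  using assms unfolding nil_daha_def FactRing_def A_RCOSETS_def' quot_map_def by auto

lemma quot_map_add: "quot_map r0 r1 (x + y) = quot_map r0 r1 x \<oplus>\<^bsub>nil_daha r0 r1\<^esub> quot_map r0 r1 y"
  using ring_hom_add[OF quot_map_ring_hom, of x y] by simp

lemma quot_map_mult: "quot_map r0 r1 (x * y) = quot_map r0 r1 x \<otimes>\<^bsub>nil_daha r0 r1\<^esub> quot_map r0 r1 y"
  using ring_hom_mult[OF quot_map_ring_hom, of x y] by simp

lemma quot_map_one: "quot_map r0 r1 1 = \<one>\<^bsub>nil_daha r0 r1\<^esub>"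
  using ring_hom_one[OF quot_map_ring_hom] by simp

lemma quot_map_relator:
  assumes "x \<in> relators r0 r1"
  shows "quot_map r0 r1 x = \<zero>\<^bsub>nil_daha r0 r1\<^esub>"
proof -
  interpret I: ideal "relation_ideal r0 r1" class_ring
    by (rule relation_ideal_ideal)
  have "x \<in> relation_ideal r0 r1"
    unfolding relation_ideal_def using ring.genideal_self[OF class_ring.ring_axioms, of "relators r0 r1"] assms by auto
  then show ?thesis
    unfolding quot_map_def nil_daha_def by (simp add: FactRing_def I.a_rcos_const)
qed

lemma scal_one: "scal 1 = 1"
  by (simp add: scal_def)

text \<open>In a module over the quotient algebra the elements of the free algebra act directly, through
  their classes; this removes the classes from all later computations.\<close>

locale daha_module = left_module "nil_daha r0 r1" M
  for r0 r1 :: complex and M :: "'v daha_module"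
begin

abbreviation act :: "free_alg \<Rightarrow> 'v \<Rightarrow> 'v" where
  "act x v \<equiv> quot_map r0 r1 x \<odot>\<^bsub>M\<^esub> v"

sublocale V: complex_space "cspace r0 r1 M"
  by (intro complex_space.intro cspace_vectorspace left_module_axioms)

lemma cspace_simps [simp]:
  "carrier (cspace r0 r1 M) = carrier M" "zero (cspace r0 r1 M) = zero M"
  "add (cspace r0 r1 M) = add M" "c \<odot>\<^bsub>cspace r0 r1 M\<^esub> v = act (scal c) v"
  by (simp_all add: cspace_def)

lemma act_add: "v \<in> carrier M \<Longrightarrow> act (x + y) v = act x v \<oplus>\<^bsub>M\<^esub> act y v"
  by (simp add: quot_map_add smult_l_distr)

lemma act_mult: "v \<in> carrier M \<Longrightarrow> act (x * y) v = act x (act y v)"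
  by (simp add: quot_map_mult smult_assoc)

lemma act_one: "v \<in> carrier M \<Longrightarrow> act (scal 1) v = v"
  by (simp add: scal_one quot_map_one)

lemma act_relator:
  assumes x: "x \<in> relators r0 r1" and v: "v \<in> carrier M"
  shows "act x v = \<zero>\<^bsub>M\<^esub>"
proof -
  have "act x v \<oplus>\<^bsub>M\<^esub> act x v = act x v"
    using quot_map_relator[OF x] smult_l_distr[of "\<zero>\<^bsub>nil_daha r0 r1\<^esub>" "\<zero>\<^bsub>nil_daha r0 r1\<^esub>" v] v
    by simp
  then show ?thesis
    using v by (metis M.add.l_cancel_one' quot_map_carrier smult_closed)
qed

text \<open>The operators mapping \<open>W\<close> into itself form a subalgebra, which is everything as soon as it
  contains the scalars and the generators.\<close>

lemma left_submodule_iff: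
  "left_submodule (nil_daha r0 r1) W M \<longleftrightarrow>
    W \<subseteq> carrier M \<and> \<zero>\<^bsub>M\<^esub> \<in> W \<and> (\<forall>v\<in>W. \<forall>w\<in>W. v \<oplus>\<^bsub>M\<^esub> w \<in> W) \<and>
    (\<forall>c. \<forall>v\<in>W. act (scal c) v \<in> W) \<and> (\<forall>g. \<forall>v\<in>W. act (gen g) v \<in> W)"
  (is "?L \<longleftrightarrow> ?R")
proof
  assume L: ?L
  then interpret additive_subgroup W M by (simp add: left_submodule_def)
  from L show ?R using a_subset by (simp add: left_submodule_def)
next
  assume R: ?R
  have inv: "\<ominus>\<^bsub>M\<^esub> v \<in> W" if "v \<in> W" for v
  proof -
    have v: "v \<in> carrier M" using R that by auto
    have "act (scal (-1)) v \<oplus>\<^bsub>M\<^esub> v = act (scal (-1) + scal 1) v"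
      using v by (simp add: act_add act_one)
    also have "scal (-1) + scal 1 = scal 0"
      unfolding scal_def single_add[symmetric] by simp
    also have "act (scal 0) v = \<zero>\<^bsub>M\<^esub>"
      using V.lmult_0[of v] v by simp
    finally have "\<ominus>\<^bsub>M\<^esub> v = act (scal (-1)) v"
      using v by (intro M.minus_equality) auto
    then show ?thesis using R that by simp
  qed
  have "act x v \<in> W" if "v \<in> W" for x v
    using that
  proof (induction x arbitrary: v rule: free_alg_induct)
    case (add x y)
    moreover have "v \<in> carrier M" using R add.prems by auto
    ultimately show ?case using R by (simp add: act_add)
  next
    case (mult x y)
    moreover have "v \<in> carrier M" using R mult.prems by auto
    ultimately show ?case by (simp add: act_mult)
  qed (use R in auto)
  then have "\<forall>X\<in>carrier (nil_daha r0 r1). \<forall>v\<in>W. X \<odot>\<^bsub>M\<^esub> v \<in> W"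
    by (metis quot_map_surj)
  moreover have "additive_subgroup W M"
    using R inv by (intro additive_subgroup.intro M.add.subgroupI) (auto simp: a_inv_def)
  ultimately show ?L by (simp add: left_submodule_def)
qed

end

text \<open>As for submodules: the algebra elements that commute with \<open>f\<close> form a subalgebra.\<close>

lemma module_homI_generators:
  assumes M: "daha_module r0 r1 M" and N: "daha_module r0 r1 N"
    and closed: "\<And>v. v \<in> carrier M \<Longrightarrow> f v \<in> carrier N"
    and add: "\<And>v w. v \<in> carrier M \<Longrightarrow> w \<in> carrier M \<Longrightarrow> f (v \<oplus>\<^bsub>M\<^esub> w) = f v \<oplus>\<^bsub>N\<^esub> f w"
    and scal: "\<And>c v. v \<in> carrier M \<Longrightarrow>
      f (quot_map r0 r1 (scal c) \<odot>\<^bsub>M\<^esub> v) = quot_map r0 r1 (scal c) \<odot>\<^bsub>N\<^esub> f v"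
    and gen: "\<And>g v. v \<in> carrier M \<Longrightarrow>
      f (quot_map r0 r1 (gen g) \<odot>\<^bsub>M\<^esub> v) = quot_map r0 r1 (gen g) \<odot>\<^bsub>N\<^esub> f v"
  shows "f \<in> LinearCombinations.module_hom (nil_daha r0 r1) M N"
proof -
  interpret M: daha_module r0 r1 M by (rule M)
  interpret N: daha_module r0 r1 N by (rule N)
  have "f (M.act x v) = N.act x (f v)" if "v \<in> carrier M" for x v
    using that
    by (induction x arbitrary: v rule: free_alg_induct)
      (auto simp: scal gen M.act_add N.act_add M.act_mult N.act_mult add closed)
  then have "f (X \<odot>\<^bsub>M\<^esub> v) = X \<odot>\<^bsub>N\<^esub> f v"
    if "X \<in> carrier (nil_daha r0 r1)" "v \<in> carrier M" for X v
    using that by (metis quot_map_surj)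
  then show ?thesis
    by (auto simp: LinearCombinations.module_hom_def closed add)
qed

text \<open>\<open>\<phi>\<close> identifies the coordinate space with \<open>M\<close> and turns the operators \<open>\<tau> g\<close> into the action of
  the generators.  Two modules are isomorphic exactly when they admit such identifications for the
  same \<open>\<tau>\<close>, which is the content of the next two lemmas; a module is therefore classified once a
  normal form for \<open>\<tau>\<close> is found.\<close>

definition intertwining :: "nat \<Rightarrow> complex \<Rightarrow> complex \<Rightarrow> 'v daha_module \<Rightarrow>
    (generator \<Rightarrow> seq \<Rightarrow> seq) \<Rightarrow> (seq \<Rightarrow> 'v) \<Rightarrow> bool" where
  "intertwining n r0 r1 M \<tau> \<phi> \<longleftrightarrow> coordinates n (cspace r0 r1 M) \<phi> \<and>
    (\<forall>g. \<forall>x\<in>coords n. \<tau> g x \<in> coords n \<and> quot_map r0 r1 (gen g) \<odot>\<^bsub>M\<^esub> \<phi> x = \<phi> (\<tau> g x))"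

lemma intertwining_isomorphic:
  assumes M: "daha_module r0 r1 M" and N: "daha_module r0 r1 N"
    and \<phi>: "intertwining n r0 r1 M \<tau> \<phi>" and \<psi>: "intertwining n r0 r1 N \<tau> \<psi>"
  shows "isomorphic_modules (nil_daha r0 r1) M N"
proof -
  interpret M: daha_module r0 r1 M by (rule M)
  interpret N: daha_module r0 r1 N by (rule N)
  have c\<phi>: "coordinates n (cspace r0 r1 M) \<phi>" and c\<psi>: "coordinates n (cspace r0 r1 N) \<psi>"
    using \<phi> \<psi> by (auto simp: intertwining_def)
  have b\<phi>: "bij_betw \<phi> (coords n) (carrier M)" and b\<psi>: "bij_betw \<psi> (coords n) (carrier N)"
    using c\<phi> c\<psi> by (auto simp: coordinates_def)
  define f where "f = \<psi> \<circ> inv_into (coords n) \<phi>"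
  have f\<phi>: "f (\<phi> x) = \<psi> x" if "x \<in> coords n" for x
    using b\<phi> that by (simp add: f_def bij_betw_def)
  have bij: "bij_betw f (carrier M) (carrier N)"
    unfolding f_def by (rule bij_betw_trans[OF bij_betw_inv_into[OF b\<phi>] b\<psi>])
  have ex: "\<exists>x\<in>coords n. v = \<phi> x" if "v \<in> carrier M" for v
    using coordinates_surj[OF c\<phi>] that by simp
  have "f \<in> LinearCombinations.module_hom (nil_daha r0 r1) M N"
  proof (rule module_homI_generators[OF M N])
    fix v assume v: "v \<in> carrier M"
    then show "f v \<in> carrier N"
      using bij by (auto simp: bij_betw_def)
    from ex[OF v] obtain x where x: "x \<in> coords n" "v = \<phi> x" by blast
    fix w assume "w \<in> carrier M"
    from ex[OF this] obtain y where y: "y \<in> coords n" "w = \<phi> y" by blast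
    show "f (v \<oplus>\<^bsub>M\<^esub> w) = f v \<oplus>\<^bsub>N\<^esub> f w"
      using f\<phi>[of "x + y"] coordinates_add[OF c\<phi> x(1) y(1)] coordinates_add[OF c\<psi> x(1) y(1)]
        x y by (simp add: f\<phi>)
  next
    fix c v assume v: "v \<in> carrier M"
    from ex[OF v] obtain x where x: "x \<in> coords n" "v = \<phi> x" by blast
    show "f (M.act (scal c) v) = N.act (scal c) (f v)"
      using f\<phi>[of "\<lambda>j. c * x j"] coordinates_scale[OF c\<phi> x(1), of c]
        coordinates_scale[OF c\<psi> x(1), of c] x by (simp add: f\<phi>)
  next
    fix g v assume v: "v \<in> carrier M"
    from ex[OF v] obtain x where x: "x \<in> coords n" "v = \<phi> x" by blast
    show "f (M.act (gen g) v) = N.act (gen g) (f v)"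
      using x \<phi> \<psi> by (simp add: intertwining_def f\<phi>)
  qed
  with bij show ?thesis
    by (auto simp: isomorphic_modules_def)
qed

lemma isomorphic_intertwining:
  assumes M: "daha_module r0 r1 M" and N: "daha_module r0 r1 N"
    and iso: "isomorphic_modules (nil_daha r0 r1) M N"
    and \<phi>: "intertwining n r0 r1 M \<tau> \<phi>"
  shows "\<exists>\<psi>. intertwining n r0 r1 N \<tau> \<psi>"
proof -
  interpret M: daha_module r0 r1 M by (rule M)
  interpret N: daha_module r0 r1 N by (rule N)
  obtain f where f: "f \<in> LinearCombinations.module_hom (nil_daha r0 r1) M N"
    and bij: "bij_betw f (carrier M) (carrier N)"
    using iso by (auto simp: isomorphic_modules_def)
  have c\<phi>: "coordinates n (cspace r0 r1 M) \<phi>"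
    using \<phi> by (auto simp: intertwining_def)
  then have b: "bij_betw (f \<circ> \<phi>) (coords n) (carrier N)"
    using bij by (auto simp: coordinates_def intro: bij_betw_trans)
  have cl: "\<phi> x \<in> carrier M" if "x \<in> coords n" for x
    using coordinates_closed[OF c\<phi> that] by simp
  have gen: "N.act (gen g) (f (\<phi> x)) = f (\<phi> (\<tau> g x))" if "x \<in> coords n" for g x
  proof -
    have "N.act (gen g) (f (\<phi> x)) = f (M.act (gen g) (\<phi> x))"
      using f cl[OF that] by (simp add: LinearCombinations.module_hom_def)
    then show ?thesis
      using \<phi> that by (simp add: intertwining_def)
  qed
  have "intertwining n r0 r1 N \<tau> (f \<circ> \<phi>)"
    using gen \<phi> b f cl by (auto simp: intertwining_def coordinates_def LinearCombinations.module_hom_def)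
  then show ?thesis
    by blast
qed

section \<open>The normal form\<close>

text \<open>The normal form of the action, in the basis of an adapted block basis read from its right
  end and suitably rescaled: the even unit vectors are \<open>a\<^sub>D, a\<^bsub>D-1\<^esub>, \<dots>\<close>, the odd ones are
  \<open>b\<^bsub>D-1\<^esub>, b\<^bsub>D-2\<^esub>, \<dots>\<close>, and \<open>\<nu> j\<close> is the nonzero weight of the \<open>j\<close>-th of them.  Read from this end
  both parities of the dimension \<open>n\<close> start with the same vector \<open>a\<^sub>D\<close>, on which \<open>t\<^sub>0\<close> acts by its
  weight \<open>\<nu> 0\<close>; they differ only at the far end, where \<open>\<kappa>\<close> is the eigenvalue of \<open>t\<^sub>0\<close> (\<open>n\<close> even)
  or \<open>t\<^sub>1\<close> (\<open>n\<close> odd).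

  The scaling is fixed by letting \<open>t\<^sub>1\<close> map \<open>a\<close> to the next vector \<open>b\<close>, and \<open>t\<^sub>0\<close> map \<open>b\<close> to the
  next \<open>a\<close> plus a multiple of \<open>b\<close>.  The other entries are then forced.  On a block \<open>(a, b)\<close> of
  \<open>t\<^sub>1\<close>, the trace is \<open>r\<^sub>1 + r\<^sub>1\<inverse>\<close> and the determinant 1.  On a block \<open>(b, a)\<close> of \<open>t\<^sub>0\<close> with \<open>\<nu>\<close>
  the weight of \<open>a\<close>, the diagonal entry at \<open>b\<close> must be \<open>\<nu>\<inverse>\<close> for \<open>u\<^sub>0t\<^sub>0a = \<nu>a\<close>, and again the trace
  \<open>r\<^sub>0 + r\<^sub>0\<inverse>\<close> and the determinant 1 give the rest.\<close>

fun std :: "complex \<Rightarrow> complex \<Rightarrow> nat \<Rightarrow> complex \<Rightarrow> seq \<Rightarrow> generator \<Rightarrow>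
    seq \<Rightarrow> seq" where
  "std r0 r1 n \<kappa> \<nu> T0 x j =
    (if n \<le> j then 0
     else if even j then
       (if j = 0 then \<nu> 0 * x 0 else (r0 + inverse r0 - inverse (\<nu> j)) * x j + x (j - 1))
     else if Suc j < n then
       inverse (\<nu> (Suc j)) * x j +
       ((r0 + inverse r0 - inverse (\<nu> (Suc j))) * inverse (\<nu> (Suc j)) - 1) * x (Suc j)
     else \<kappa> * x j)"
| "std r0 r1 n \<kappa> \<nu> U0 x j =
    (if n \<le> j \<or> odd j then 0 else if j = 0 then x 0 else x j - \<nu> j * x (j - 1))"
| "std r0 r1 n \<kappa> \<nu> T1 x j =
    (if n \<le> j then 0
     else if even j then (if Suc j < n then - x (Suc j) else \<kappa> * x j)
     else (r1 + inverse r1) * x j + x (j - 1))"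
| "std r0 r1 n \<kappa> \<nu> U1 x j = (if even j \<and> Suc j < n then \<nu> (Suc j) * x (Suc j) else 0)"

text \<open>The conditions on \<open>\<E>\<^sub>D\<close> and \<open>\<O>\<^sub>D\<close> in terms of the weights along the chain.  As \<open>\<nu> 0\<close> lies in
  \<open>{r\<^sub>0, r\<^sub>0\<inverse>}\<close> and no other even weight does, distinctness of the even weights including \<open>\<nu> 0\<close> amounts
  to distinctness of the listed \<open>\<lambda>\<^sub>i\<close>.\<close>

definition admissible ::
  "complex \<Rightarrow> complex \<Rightarrow> nat \<Rightarrow> complex \<Rightarrow> seq \<Rightarrow> bool" where
  "admissible r0 r1 n \<kappa> \<nu> \<longleftrightarrow>
    \<nu> 0 \<in> {r0, inverse r0} \<and>
    \<kappa> \<in> (if even n then {r0, inverse r0} else {r1, inverse r1}) \<and>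
    (\<forall>j<n. \<nu> j \<noteq> 0) \<and>
    (\<forall>j<n. even j \<and> 0 < j \<longrightarrow> \<nu> j \<notin> {r0, inverse r0}) \<and>
    (\<forall>i<n. \<forall>j<n. even i = even j \<and> i \<noteq> j \<longrightarrow> \<nu> i \<noteq> \<nu> j)"

lemma std_closed: "std r0 r1 n \<kappa> \<nu> g x \<in> coords n"
  by (cases g) (auto simp: coords_def)

lemma std_add: "std r0 r1 n \<kappa> \<nu> g (x + y) = std r0 r1 n \<kappa> \<nu> g x + std r0 r1 n \<kappa> \<nu> g y"
  by (cases g) (auto simp: fun_eq_iff algebra_simps)

lemma std_scale: "std r0 r1 n \<kappa> \<nu> g (\<lambda>j. c * x j) = (\<lambda>j. c * std r0 r1 n \<kappa> \<nu> g x j)"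
  by (cases g) (auto simp: fun_eq_iff algebra_simps)

lemma std_T1_even: "even k \<Longrightarrow> Suc k < n \<Longrightarrow> std r0 r1 n \<kappa> \<nu> T1 (e_vec k) = e_vec (Suc k)"
  by (auto simp: fun_eq_iff e_vec_def)

lemma std_T1_odd:
  "odd k \<Longrightarrow> k < n \<Longrightarrow> std r0 r1 n \<kappa> \<nu> T1 (e_vec k) = (\<lambda>i. (r1 + inverse r1) * e_vec k i + (-1) * e_vec (k - 1) i)"
proof
  fix i
  assume "odd k" "k < n"
  then obtain m where "k = Suc m" "even m"
    by (cases k) auto
  then show "std r0 r1 n \<kappa> \<nu> T1 (e_vec k) i = (r1 + inverse r1) * e_vec k i + (-1) * e_vec (k - 1) i"
    using \<open>k < n\<close> by (cases i) (auto simp: e_vec_def)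
qed

lemma std_T0_odd:
  "odd k \<Longrightarrow> Suc k < n \<Longrightarrow>
    std r0 r1 n \<kappa> \<nu> T0 (e_vec k) = (\<lambda>i. inverse (\<nu> (Suc k)) * e_vec k i + 1 * e_vec (Suc k) i)"
  by (auto simp: fun_eq_iff e_vec_def)

lemma std_T0_even:
  "odd k \<Longrightarrow> Suc k < n \<Longrightarrow>
    std r0 r1 n \<kappa> \<nu> T0 (e_vec (Suc k)) = (\<lambda>i. (r0 + inverse r0 - inverse (\<nu> (Suc k))) * e_vec (Suc k) i +
      ((r0 + inverse r0 - inverse (\<nu> (Suc k))) * inverse (\<nu> (Suc k)) - 1) * e_vec k i)"
proof
  fix i
  assume "odd k" "Suc k < n"
  then show "std r0 r1 n \<kappa> \<nu> T0 (e_vec (Suc k)) i = (r0 + inverse r0 - inverse (\<nu> (Suc k))) * e_vec (Suc k) i +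
      ((r0 + inverse r0 - inverse (\<nu> (Suc k))) * inverse (\<nu> (Suc k)) - 1) * e_vec k i"
    by (cases i) (auto simp: e_vec_def)
qed

lemma std_end:
  assumes "0 < n"
  shows "std r0 r1 n \<kappa> \<nu> (if even n then T0 else T1) (e_vec (n - 1)) = (\<lambda>i. \<kappa> * e_vec (n - 1) i)"
proof -
  obtain m where m: "n = Suc m"
    using assms by (cases n) auto
  show ?thesis
  proof
    fix i
    consider "n \<le> i" | "i = m" | "i < m" using m by linarith
    then show "std r0 r1 n \<kappa> \<nu> (if even n then T0 else T1) (e_vec (n - 1)) i = \<kappa> * e_vec (n - 1) i"
      by cases (use m in \<open>auto simp: e_vec_def\<close>)
  qed
qed

lemma std_T0_first: "0 < n \<Longrightarrow> std r0 r1 n \<kappa> \<nu> T0 (e_vec 0) = (\<lambda>i. \<nu> 0 * e_vec 0 i)"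
proof
  fix i assume "0 < n"
  then show "std r0 r1 n \<kappa> \<nu> T0 (e_vec 0) i = \<nu> 0 * e_vec 0 i"
    by (cases "i = Suc 0") (auto simp: e_vec_def)
qed

lemma std_U0_even: "even k \<Longrightarrow> k < n \<Longrightarrow> std r0 r1 n \<kappa> \<nu> U0 (e_vec k) = e_vec k"
proof
  fix i assume "even k" "k < n"
  then show "std r0 r1 n \<kappa> \<nu> U0 (e_vec k) i = e_vec k i"
    by (cases i; cases k) (auto simp: e_vec_def)
qed

lemma std_U0_odd:
  "odd k \<Longrightarrow> k < n \<Longrightarrow> std r0 r1 n \<kappa> \<nu> U0 (e_vec k) =
    (\<lambda>i. (if Suc k < n then - \<nu> (Suc k) else 0) * e_vec (Suc k) i)"
proof
  fix i assume "odd k" "k < n"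
  then show "std r0 r1 n \<kappa> \<nu> U0 (e_vec k) i =
      (if Suc k < n then - \<nu> (Suc k) else 0) * e_vec (Suc k) i"
    by (cases i; cases k) (auto simp: e_vec_def)
qed

lemma std_U1_even: "even k \<Longrightarrow> std r0 r1 n \<kappa> \<nu> U1 (e_vec k) = (\<lambda>i. 0)"
  by (auto simp: e_vec_def fun_eq_iff)

lemma std_U1_odd:
  "even k \<Longrightarrow> Suc k < n \<Longrightarrow>
    std r0 r1 n \<kappa> \<nu> U1 (e_vec (Suc k)) = (\<lambda>i. \<nu> (Suc k) * e_vec k i)"
  by (auto simp: e_vec_def fun_eq_iff)

text \<open>\<open>r\<close> and its inverse are the roots of \<open>X\<^sup>2 - (r + r\<inverse>)X + 1\<close>; in this form the quadratic
  relations survive the degenerate case \<open>r = r\<inverse>\<close>.\<close>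

lemma quadratic_iff:
  fixes r k :: complex
  assumes "r \<noteq> 0"
  shows "k \<in> {r, inverse r} \<longleftrightarrow> k * k = (r + inverse r) * k - 1"
proof -
  have "k * k - ((r + inverse r) * k - 1) = (k - r) * (k - inverse r)"
    using assms by (simp add: field_simps)
  then show ?thesis
    by (metis diff_eq_diff_eq diff_self insert_iff mult_eq_0_iff right_minus_eq singleton_iff)
qed

locale std_rep =
  fixes r0 r1 :: complex and n :: nat and \<kappa> :: complex and \<nu> :: seq
  assumes r0: "r0 \<noteq> 0" and r1: "r1 \<noteq> 0" and adm: "admissible r0 r1 n \<kappa> \<nu>"
begin

abbreviation "S \<equiv> std r0 r1 n \<kappa> \<nu>"

lemma nz: "j < n \<Longrightarrow> \<nu> j \<noteq> 0"
  using adm by (auto simp: admissible_def)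

text \<open>\<open>A\<close> and \<open>B\<close> are diagonal in the normal form.  With them the relations \<open>AB = 0 = BA\<close> are immediate,
  and the joint weights \<open>(\<nu> j, 0)\<close>, \<open>(0, \<nu> j)\<close> of the unit vectors are pairwise distinct.\<close>

lemma std_A:
  assumes "x \<in> coords n"
  shows "S U0 (S T0 x) = (\<lambda>j. if even j then \<nu> j * x j else 0)"
proof
  fix j
  show "S U0 (S T0 x) j = (if even j then \<nu> j * x j else 0)"
  proof (cases "even j \<and> 0 < j \<and> j < n")
    case True
    then obtain m where m: "j = Suc m" "odd m"
      by (cases j) auto
    with True nz[of j] show ?thesis
      by (simp add: field_simps)
  qed (use assms in \<open>auto simp: coords_def\<close>)
qed

lemma std_B:
  assumes "x \<in> coords n"
  shows "S T1 (S U1 x) = (\<lambda>j. if odd j then \<nu> j * x j else 0)"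
proof
  fix j
  show "S T1 (S U1 x) j = (if odd j then \<nu> j * x j else 0)"
    using assms by (cases j) (auto simp: coords_def)
qed

lemma std_T0_quadratic:
  assumes "x \<in> coords n"
  shows "S T0 (S T0 x) j = (r0 + inverse r0) * S T0 x j - x j"
proof -
  consider "n \<le> j" | "j = 0" "0 < n" | "even j" "0 < j" "j < n" | "odd j" "Suc j < n" | "odd j" "n = Suc j"
    by (metis Suc_leI gr0I le_neq_implies_less not_less)
  then show ?thesis
  proof cases
    case 1
    then show ?thesis using assms by (simp add: coords_def)
  next
    case 2
    have "\<nu> 0 * \<nu> 0 = (r0 + inverse r0) * \<nu> 0 - 1"
      using adm quadratic_iff[OF r0, of "\<nu> 0"] by (simp add: admissible_def)
    with 2 show ?thesis
      by (simp del: mult.assoc add: mult.assoc[symmetric] left_diff_distrib)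
  next
    case 3
    then obtain m where m: "j = Suc m" "odd m"
      by (cases j) auto
    define q where "q = inverse (\<nu> j)"
    show ?thesis
      using 3 m unfolding q_def[symmetric] by (simp add: q_def[symmetric] algebra_simps)
  next
    case 4
    define q where "q = inverse (\<nu> (Suc j))"
    show ?thesis
      using 4 by (simp add: q_def[symmetric] algebra_simps)
  next
    case 5
    have "\<kappa> * \<kappa> = (r0 + inverse r0) * \<kappa> - 1"
      using adm quadratic_iff[OF r0, of \<kappa>] 5 by (simp add: admissible_def)
    with 5 show ?thesis
      by (simp del: mult.assoc add: mult.assoc[symmetric] left_diff_distrib)
  qed
qed

lemma std_T1_quadratic:
  assumes "x \<in> coords n"
  shows "S T1 (S T1 x) j = (r1 + inverse r1) * S T1 x j - x j"
proof -
  consider "n \<le> j" | "odd j" "j < n" | "even j" "Suc j < n" | "even j" "n = Suc j"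
    by (metis Suc_leI le_neq_implies_less not_less)
  then show ?thesis
  proof cases
    case 1
    then show ?thesis using assms by (simp add: coords_def)
  next
    case 2
    then obtain m where m: "j = Suc m" "even m"
      by (cases j) auto
    with 2 show ?thesis by (simp add: algebra_simps)
  next
    case 3
    then show ?thesis by (simp add: algebra_simps)
  next
    case 4
    have "\<kappa> * \<kappa> = (r1 + inverse r1) * \<kappa> - 1"
      using adm quadratic_iff[OF r1, of \<kappa>] 4 by (simp add: admissible_def)
    with 4 show ?thesis
      by (simp del: mult.assoc add: mult.assoc[symmetric] left_diff_distrib)
  qed
qed

lemma std_U0_idem: "S U0 (S U0 x) = S U0 x"
proof
  fix j show "S U0 (S U0 x) j = S U0 x j" by (cases j) auto
qed

lemma std_U1_nil: "S U1 (S U1 x) = 0"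
  by (auto simp: fun_eq_iff)

lemma std_AB: "x \<in> coords n \<Longrightarrow> S U0 (S T0 (S T1 (S U1 x))) = 0"
  unfolding std_A[OF std_closed] by (auto simp: std_B fun_eq_iff simp del: std.simps)

lemma std_BA: "x \<in> coords n \<Longrightarrow> S T1 (S U1 (S U0 (S T0 x))) = 0"
  unfolding std_B[OF std_closed] by (auto simp: std_A fun_eq_iff simp del: std.simps)

text \<open>The entry of \<open>t\<^sub>0\<close> leading from \<open>a\<close> back to the previous \<open>b\<close> vanishes only if \<open>\<nu>\<inverse>\<close>, hence
  \<open>\<nu>\<close>, is one of \<open>r\<^sub>0, r\<^sub>0\<inverse>\<close>.\<close>

lemma lower_coefficient_nonzero:
  assumes "odd k" and "Suc k < n"
  shows "(r0 + inverse r0 - inverse (\<nu> (Suc k))) * inverse (\<nu> (Suc k)) - 1 \<noteq> 0"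
proof
  let ?q = "inverse (\<nu> (Suc k))"
  assume "(r0 + inverse r0 - ?q) * ?q - 1 = 0"
  then have "?q * ?q = (r0 + inverse r0) * ?q - 1"
    by (simp add: algebra_simps)
  then have "?q \<in> {r0, inverse r0}"
    using quadratic_iff[OF r0] by blast
  then have "\<nu> (Suc k) \<in> {r0, inverse r0}"
    by (metis insert_iff inverse_inverse_eq singleton_iff)
  then show False
    using adm assms by (auto simp: admissible_def)
qed

end

definition irreducible_coords :: "nat \<Rightarrow> (generator \<Rightarrow> seq \<Rightarrow> seq) \<Rightarrow> bool"
  where "irreducible_coords n \<tau> \<longleftrightarrow>
    (\<forall>W. W \<subseteq> coords n \<and> 0 \<in> W \<and> (\<forall>x\<in>W. \<forall>y\<in>W. x + y \<in> W) \<and>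
      (\<forall>c. \<forall>x\<in>W. (\<lambda>j. c * x j) \<in> W) \<and> (\<forall>g. \<forall>x\<in>W. \<tau> g x \<in> W) \<longrightarrow> W = {0} \<or> W = coords n)"

context std_rep
begin

text \<open>Since the joint weights are distinct, a nonzero invariant subspace contains a unit vector: in
  a nonzero element of minimal support, a second coordinate could be removed by subtracting a multiple
  of the element from its image under \<open>A\<close> or \<open>B\<close>.  Neighbouring unit vectors are linked in both
  directions by \<open>t\<^sub>0\<close> and \<open>t\<^sub>1\<close>, so all of them follow.\<close>

lemma std_irreducible: "irreducible_coords n S"
  unfolding irreducible_coords_def
proof (intro allI impI, elim conjE)
  fix W assume W: "W \<subseteq> coords n" and zero: "0 \<in> W" and add: "\<forall>x\<in>W. \<forall>y\<in>W. x + y \<in> W"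
    and scale: "\<forall>c. \<forall>x\<in>W. (\<lambda>j. c * x j) \<in> W" and inv: "\<forall>g. \<forall>x\<in>W. S g x \<in> W"
  have comb: "(\<lambda>i. c * x i + d * y i) \<in> W" if "x \<in> W" "y \<in> W" for c d x y
  proof -
    have "(\<lambda>i. c * x i) + (\<lambda>i. d * y i) \<in> W"
      using add scale that by blast
    then show ?thesis by (simp add: plus_fun_def)
  qed
  have cancel: "y \<in> W" if "(\<lambda>i. c * x i + d * y i) \<in> W" "x \<in> W" "d \<noteq> 0" for c d x y
  proof -
    have "(\<lambda>i. inverse d * (c * x i + d * y i) + (- inverse d * c) * x i) \<in> W"
      by (rule comb[OF that(1,2)])
    moreover have "(\<lambda>i. inverse d * (c * x i + d * y i) + (- inverse d * c) * x i) = y"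
      using that(3) by (auto simp: field_simps)
    ultimately show ?thesis by simp
  qed
  show "W = {0} \<or> W = coords n"
  proof (cases "W = {0}")
    case False
    define supp :: "seq \<Rightarrow> nat set" where "supp x = {i. x i \<noteq> 0}" for x
    have fin: "finite (supp x)" if "x \<in> W" for x
    proof -
      have "supp x \<subseteq> {..<n}"
        using W that by (auto simp: supp_def coords_def not_less[symmetric])
      then show ?thesis using finite_subset by blast
    qed
    obtain x0 where "x0 \<in> W" "x0 \<noteq> 0"
      using False zero by blast
    then obtain x where x: "x \<in> W" "x \<noteq> 0"
      and min: "\<And>y. y \<in> W \<Longrightarrow> y \<noteq> 0 \<Longrightarrow> card (supp x) \<le> card (supp y)"
      using ex_has_least_nat[of "\<lambda>x. x \<in> W \<and> x \<noteq> 0" x0 "\<lambda>x. card (supp x)"] by blast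
    obtain k where k: "x k \<noteq> 0"
      using x(2) by (auto simp: fun_eq_iff)
    have kn: "k < n"
      using k x(1) W by (auto simp: coords_def not_less[symmetric])
    have single: "x i = 0" if "i \<noteq> k" for i
    proof (rule ccontr)
      assume i: "x i \<noteq> 0"
      then have i_n: "i < n"
        using x(1) W by (auto simp: coords_def not_less[symmetric])
      \<comment> \<open>\<open>D\<close> multiplies coordinate \<open>i\<close> by \<open>\<nu> i\<close> and coordinate \<open>k\<close> by a different scalar.\<close>
      define D where "D = (if even i then S U0 (S T0 x) else S T1 (S U1 x))"
      have D: "D j = (if even i = even j then \<nu> j * x j else 0)" for j
        using x(1) W by (auto simp: D_def std_A std_B subset_iff)
      define y where "y = (\<lambda>j. 1 * D j + (- \<nu> i) * x j)"
      have "y \<in> W"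
        unfolding y_def D_def using inv x(1) by (intro comb) auto
      moreover have "y k \<noteq> 0"
        using nz[OF i_n] k adm i_n kn \<open>i \<noteq> k\<close> by (auto simp: y_def D admissible_def)
      moreover have "supp y \<subset> supp x"
      proof
        show "supp y \<subseteq> supp x"
          by (auto simp: supp_def y_def D)
        have "y i = 0"
          by (simp add: y_def D)
        then show "supp y \<noteq> supp x"
          using i by (auto simp: supp_def)
      qed
      then have "card (supp y) < card (supp x)"
        using fin[OF x(1)] by (rule psubset_card_mono[rotated])
      moreover have "y \<noteq> 0" using \<open>y k \<noteq> 0\<close> by auto
      ultimately show False
        using min[of y] by simp
    qed
    have "(\<lambda>j. inverse (x k) * x j) = e_vec k"
      using k single by (auto simp: e_vec_def)
    then have ek: "e_vec k \<in> W"
      using scale x(1) by metis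
    have up: "e_vec (Suc j) \<in> W" if "e_vec j \<in> W" "Suc j < n" for j
    proof (cases "even j")
      case True
      have "S T1 (e_vec j) \<in> W" using inv that by blast
      then show ?thesis
        unfolding std_T1_even[OF True that(2)] .
    next
      case False
      have "S T0 (e_vec j) \<in> W" using inv that by blast
      from cancel[OF this[unfolded std_T0_odd[OF False that(2)]] that(1)] show ?thesis by simp
    qed
    have down: "e_vec j \<in> W" if "e_vec (Suc j) \<in> W" "Suc j < n" for j
    proof (cases "even j")
      case True
      then have "odd (Suc j)" by simp
      have "S T1 (e_vec (Suc j)) \<in> W" using inv that by blast
      from cancel[OF this[unfolded std_T1_odd[OF \<open>odd (Suc j)\<close> that(2)]] that(1)]
      show ?thesis by simp
    next
      case False
      have "S T0 (e_vec (Suc j)) \<in> W" using inv that by blast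
      from cancel[OF this[unfolded std_T0_even[OF False that(2)]] that(1)
          lower_coefficient_nonzero[OF False that(2)]]
      show ?thesis .
    qed
    have all: "e_vec j \<in> W" if "j < n" for j
    proof (cases "k \<le> j")
      case True
      then show ?thesis using that
        by (induction j rule: dec_induct) (use ek up in auto)
    next
      case False
      then have "j \<le> k" by simp
      then show ?thesis
        by (induction j rule: inc_induct) (use ek down kn in auto)
    qed
    have "coords n \<subseteq> W"
    proof
      fix z assume z: "z \<in> coords n"
      have "(\<Sum>j\<in>I. (\<lambda>i. z j * e_vec j i)) \<in> W" if "finite I" "I \<subseteq> {..<n}" for I
        using that
      proof (induction I)
        case (insert i I)
        then have "(\<lambda>t. z i * e_vec i t) + (\<Sum>j\<in>I. (\<lambda>t. z j * e_vec j t)) \<in> W"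
          using add scale all by blast
        then show ?case
          by (simp only: sum.insert[OF insert(1,2)])
      qed (simp add: zero)
      from this[of "{..<n}"] show "z \<in> W"
        unfolding coords_expansion[OF z, symmetric] by simp
    qed
    then show ?thesis using W by blast
  qed simp
qed

end

text \<open>An isomorphism \<open>\<theta>\<close> between two normal forms is a scalar.  It carries \<open>e_vec 0\<close> to an \<open>A\<close>-eigenvector
  with eigenvalue in \<open>{r\<^sub>0, r\<^sub>0\<inverse>}\<close>, and \<open>e_vec 0\<close> is the only such vector up to scaling.  From there
  \<open>t\<^sub>1\<close> and \<open>t\<^sub>0\<close> produce the later unit vectors one by one on both sides, and comparing weights at each
  step gives the equality of the parameters.\<close>

lemma std_parameters_unique:
  assumes p: "std_rep r0 r1 n \<kappa> \<nu>" and p': "std_rep r0 r1 n \<kappa>' \<nu>'" and "0 < n"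
    and bij: "bij_betw \<theta> (coords n) (coords n)"
    and add: "\<And>x y. x \<in> coords n \<Longrightarrow> y \<in> coords n \<Longrightarrow> \<theta> (x + y) = \<theta> x + \<theta> y"
    and scale: "\<And>c x. x \<in> coords n \<Longrightarrow> \<theta> (\<lambda>j. c * x j) = (\<lambda>j. c * \<theta> x j)"
    and comm: "\<And>g x. x \<in> coords n \<Longrightarrow> \<theta> (std r0 r1 n \<kappa> \<nu> g x) = std r0 r1 n \<kappa>' \<nu>' g (\<theta> x)"
  shows "\<kappa> = \<kappa>'" and "\<forall>j<n. \<nu> j = \<nu>' j"
proof -
  interpret p: std_rep r0 r1 n \<kappa> \<nu> by (rule p)
  interpret p': std_rep r0 r1 n \<kappa>' \<nu>' by (rule p')
  have cl: "\<theta> x \<in> coords n" if "x \<in> coords n" for x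
    using bij that by (auto simp: bij_betw_def)
  have lin: "\<theta> (\<lambda>i. c * x i + d * y i) = (\<lambda>i. c * \<theta> x i + d * \<theta> y i)"
    if "x \<in> coords n" "y \<in> coords n" for c d x y
    using add[of "\<lambda>i. c * x i" "\<lambda>i. d * y i"] scale[OF that(1), of c] scale[OF that(2), of d] that
    by (simp add: plus_fun_def)
  have wA: "(if even j then \<nu>' j * \<theta> x j else 0) = \<theta> (\<lambda>j. if even j then \<nu> j * x j else 0) j"
    if "x \<in> coords n" for x j
    using comm[OF that, of T0] comm[OF std_closed[of r0 r1 n \<kappa> \<nu> T0 x], of U0]
      p.std_A[OF that] p'.std_A[OF cl[OF that]] by (simp del: std.simps)
  have wB: "(if odd j then \<nu>' j * \<theta> x j else 0) = \<theta> (\<lambda>j. if odd j then \<nu> j * x j else 0) j"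
    if "x \<in> coords n" for x j
    using comm[OF that, of U1] comm[OF std_closed[of r0 r1 n \<kappa> \<nu> U1 x], of T1]
      p.std_B[OF that] p'.std_B[OF cl[OF that]] by (simp del: std.simps)
  have e_even: "(\<lambda>j. if even j then \<nu> j * e_vec k j else 0) = (\<lambda>j. \<nu> k * e_vec k j)" if "even k" for k
    using that by (auto simp: e_vec_def)
  have e_odd: "(\<lambda>j. if odd j then \<nu> j * e_vec k j else 0) = (\<lambda>j. \<nu> k * e_vec k j)" if "odd k" for k
    using that by (auto simp: e_vec_def)
  have wt: "(if even j = even k then \<nu>' j * \<theta> (e_vec k) j else 0) = \<nu> k * \<theta> (e_vec k) j" if "k < n" for j k
    using wA[of "e_vec k" j] wB[of "e_vec k" j] that scale[of "e_vec k" "\<nu> k"]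
    by (cases "even k") (auto simp: e_even e_odd)
  define c where "c = \<theta> (e_vec 0) 0"
  have \<theta>0: "\<theta> (e_vec 0) = (\<lambda>j. c * e_vec 0 j)"
  proof
    fix j
    have "\<theta> (e_vec 0) j = 0" if "j \<noteq> 0"
    proof (rule ccontr)
      assume nz: "\<theta> (e_vec 0) j \<noteq> 0"
      then have "j < n"
        using cl[OF coords_e_vec[OF \<open>0 < n\<close>]] by (auto simp: coords_def not_less[symmetric])
      moreover have "even j \<and> \<nu>' j = \<nu> 0"
        using wt[of 0 j] nz p.nz[OF \<open>0 < n\<close>] \<open>0 < n\<close> by (auto split: if_splits)
      ultimately show False
        using p.adm p'.adm that by (auto simp: admissible_def)
    qed
    then show "\<theta> (e_vec 0) j = c * e_vec 0 j"
      by (auto simp: c_def e_vec_def)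
  qed
  have c: "c \<noteq> 0"
  proof
    assume "c = 0"
    then have "\<theta> (e_vec 0) = \<theta> (\<lambda>j. 0 * e_vec 0 j)"
      using \<theta>0 scale[of "e_vec 0" 0] \<open>0 < n\<close> by simp
    then have "e_vec 0 = (\<lambda>j. 0 * e_vec 0 j)"
      using bij \<open>0 < n\<close> inj_onD[of \<theta> "coords n" "e_vec 0"] coords_scale[of "e_vec 0" n 0]
      by (metis bij_betw_def coords_e_vec)
    from fun_cong[OF this, of 0] show False by (simp add: e_vec_def)
  qed
  have main: "\<theta> (e_vec k) = (\<lambda>j. c * e_vec k j) \<and> \<nu> k = \<nu>' k" if "k < n" for k
    using that
  proof (induction k)
    case 0
    have "\<nu> 0 = \<nu>' 0"
      using wt[of 0 0] \<theta>0 c \<open>0 < n\<close> by (simp add: e_vec_def)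
    with \<theta>0 show ?case by simp
  next
    case (Suc k)
    then have IH: "\<theta> (e_vec k) = (\<lambda>j. c * e_vec k j)" and k: "k < n" by auto
    show ?case
    proof (cases "even k")
      case True
      have "\<theta> (e_vec (Suc k)) = std r0 r1 n \<kappa>' \<nu>' T1 (\<lambda>j. c * e_vec k j)"
        using comm[of "e_vec k" T1] std_T1_even[of k] True Suc.prems k by (simp add: IH del: std.simps)
      also have "\<dots> = (\<lambda>j. c * e_vec (Suc k) j)"
        using True Suc.prems by (simp only: std_scale std_T1_even)
      finally have *: "\<theta> (e_vec (Suc k)) = (\<lambda>j. c * e_vec (Suc k) j)" .
      moreover have "\<nu> (Suc k) = \<nu>' (Suc k)"
        using wt[of "Suc k" "Suc k"] * c Suc.prems by (simp add: e_vec_def)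
      ultimately show ?thesis by simp
    next
      case False
      \<comment> \<open>Here \<open>e_vec (Suc k)\<close> is \<open>t\<^sub>0 e_vec k\<close> minus a multiple of \<open>e_vec k\<close> that depends on \<open>\<nu>\<close>; a mismatch
        would leave an odd coordinate in an \<open>A\<close>-eigenvector of nonzero weight.\<close>
      have "\<theta> (\<lambda>i. inverse (\<nu> (Suc k)) * e_vec k i + 1 * e_vec (Suc k) i) =
          std r0 r1 n \<kappa>' \<nu>' T0 (\<lambda>j. c * e_vec k j)"
        using comm[of "e_vec k" T0] std_T0_odd[of k] False Suc.prems k by (simp add: IH del: std.simps)
      also have "\<dots> = (\<lambda>i. c * (inverse (\<nu>' (Suc k)) * e_vec k i + 1 * e_vec (Suc k) i))"
        unfolding std_scale std_T0_odd[OF False Suc.prems] ..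
      finally have "(\<lambda>i. inverse (\<nu> (Suc k)) * \<theta> (e_vec k) i + 1 * \<theta> (e_vec (Suc k)) i) = \<dots>"
        unfolding lin[OF coords_e_vec[OF k] coords_e_vec[OF Suc.prems]] .
      then have *: "\<theta> (e_vec (Suc k)) i =
          c * e_vec (Suc k) i + c * (inverse (\<nu>' (Suc k)) - inverse (\<nu> (Suc k))) * e_vec k i" for i
        by (auto simp: IH fun_eq_iff algebra_simps)
      have "\<theta> (e_vec (Suc k)) (Suc k) = c"
        unfolding * by (simp add: e_vec_def)
      with wt[of "Suc k" "Suc k"] c Suc.prems have "\<nu> (Suc k) = \<nu>' (Suc k)" by simp
      with * show ?thesis by auto
    qed
  qed
  then show "\<forall>j<n. \<nu> j = \<nu>' j" by blast
  let ?g = "if even n then T0 else T1"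
  have "\<theta> (std r0 r1 n \<kappa> \<nu> ?g (e_vec (n - 1))) = std r0 r1 n \<kappa>' \<nu>' ?g (\<lambda>j. c * e_vec (n - 1) j)"
    using comm[of "e_vec (n - 1)" ?g] main[of "n - 1"] \<open>0 < n\<close> by (simp del: std.simps)
  also have "\<dots> = (\<lambda>i. c * (\<kappa>' * e_vec (n - 1) i))"
    by (simp only: std_scale std_end[OF \<open>0 < n\<close>])
  finally have "(\<lambda>i. \<kappa> * \<theta> (e_vec (n - 1)) i) = \<dots>"
    using scale[of "e_vec (n - 1)" \<kappa>] \<open>0 < n\<close> by (simp only: std_end) simp
  from fun_cong[OF this, of "n - 1"] show "\<kappa> = \<kappa>'"
    using main[of "n - 1"] c \<open>0 < n\<close> by (simp add: e_vec_def)
qed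

section \<open>From an adapted chain to the normal form\<close>

locale quadratic_operators =
  fixes r0 r1 :: complex and n :: nat and \<tau> :: "generator \<Rightarrow> seq \<Rightarrow> seq"
  assumes r0: "r0 \<noteq> 0" and r1: "r1 \<noteq> 0"
    and closed: "\<And>g x. x \<in> coords n \<Longrightarrow> \<tau> g x \<in> coords n"
    and op_add: "\<And>g x y. x \<in> coords n \<Longrightarrow> y \<in> coords n \<Longrightarrow> \<tau> g (x + y) = \<tau> g x + \<tau> g y"
    and scale: "\<And>g c x. x \<in> coords n \<Longrightarrow> \<tau> g (\<lambda>j. c * x j) = (\<lambda>j. c * \<tau> g x j)"
    and quad0: "\<And>x j. x \<in> coords n \<Longrightarrow> \<tau> T0 (\<tau> T0 x) j = (r0 + inverse r0) * \<tau> T0 x j - x j"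
    and quad1: "\<And>x j. x \<in> coords n \<Longrightarrow> \<tau> T1 (\<tau> T1 x) j = (r1 + inverse r1) * \<tau> T1 x j - x j"
    and idem: "\<And>x j. x \<in> coords n \<Longrightarrow> \<tau> U0 (\<tau> U0 x) j = \<tau> U0 x j"
    and nil: "\<And>x j. x \<in> coords n \<Longrightarrow> \<tau> U1 (\<tau> U1 x) j = 0"

text \<open>The operators of a module in the coordinates of an adapted block basis, again read from its
  right end: unit vectors are weight vectors, and the generators \<open>t\<^sub>1\<close>, \<open>t\<^sub>0\<close> preserve the
  alternating pairs of neighbours.  The scaling of the basis is still arbitrary.\<close>

locale chain_rep = quadratic_operators +
  fixes \<nu> :: seq and \<kappa> :: complex
  assumes n: "0 < n"
    and irr: "irreducible_coords n \<tau>"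
    and wt_nz: "\<And>j. j < n \<Longrightarrow> \<nu> j \<noteq> 0"
    and wt_A: "\<And>j. j < n \<Longrightarrow> \<tau> U0 (\<tau> T0 (e_vec j)) = (\<lambda>i. (if even j then \<nu> j else 0) * e_vec j i)"
    and wt_B: "\<And>j. j < n \<Longrightarrow> \<tau> T1 (\<tau> U1 (e_vec j)) = (\<lambda>i. (if even j then 0 else \<nu> j) * e_vec j i)"
    and first: "\<And>i. i \<noteq> 0 \<Longrightarrow> \<tau> T0 (e_vec 0) i = 0"
    and last: "\<tau> (if even n then T0 else T1) (e_vec (n - 1)) = (\<lambda>i. \<kappa> * e_vec (n - 1) i)"
    and link: "\<And>j k i. Suc j < n \<Longrightarrow> k = j \<or> k = Suc j \<Longrightarrow> i \<noteq> j \<Longrightarrow> i \<noteq> Suc j \<Longrightarrow>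
      \<tau> (if even j then T1 else T0) (e_vec k) i = 0"
begin

lemma zero: "\<tau> g (\<lambda>i. 0) = (\<lambda>i. 0)"
  using linear_zero[OF scale] unfolding zero_fun_def .

lemma lin: "\<tau> g (\<lambda>i. c * x i + d * y i) = (\<lambda>i. c * \<tau> g x i + d * \<tau> g y i)"
  if "x \<in> coords n" "y \<in> coords n"
  using op_add[of "\<lambda>i. c * x i" "\<lambda>i. d * y i" g] scale[OF that(1), of g c] scale[OF that(2), of g d] that
  by (simp add: plus_fun_def)

lemma e_vec_at [simp]: "e_vec k k = 1" "i \<noteq> k \<Longrightarrow> e_vec k i = 0"
  by (auto simp: e_vec_def)

lemma invertible0: "x \<in> coords n \<Longrightarrow> \<tau> T0 x = (\<lambda>i. 0) \<Longrightarrow> x = (\<lambda>i. 0)"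
  using quad0[of x] by (auto simp: zero)

lemma invertible1: "x \<in> coords n \<Longrightarrow> \<tau> T1 x = (\<lambda>i. 0) \<Longrightarrow> x = (\<lambda>i. 0)"
  using quad1[of x] by (auto simp: zero)

lemma e_not_zero: "e_vec k \<noteq> (\<lambda>i. 0)"
  by (metis e_vec_at(1) zero_neq_one)

lemma link_expand:
  assumes "Suc j < n" and "k = j \<or> k = Suc j" and "g = (if even j then T1 else T0)"
  shows "\<tau> g (e_vec k) =
    (\<lambda>i. \<tau> g (e_vec k) j * e_vec j i + \<tau> g (e_vec k) (Suc j) * e_vec (Suc j) i)"
proof
  fix i
  show "\<tau> g (e_vec k) i = \<tau> g (e_vec k) j * e_vec j i + \<tau> g (e_vec k) (Suc j) * e_vec (Suc j) i"
    using link[OF assms(1,2), of i] assms(3) by (cases "i = j"; cases "i = Suc j") auto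
qed

text \<open>As \<open>u\<^sub>0\<close> is idempotent it fixes \<open>A e = u\<^sub>0t\<^sub>0e\<close>, which is a nonzero multiple of \<open>e\<close>.\<close>

lemma U0_even: "j < n \<Longrightarrow> even j \<Longrightarrow> \<tau> U0 (e_vec j) = e_vec j"
proof
  fix i assume j: "j < n" "even j"
  have "\<tau> U0 (\<tau> U0 (\<tau> T0 (e_vec j))) i = \<tau> U0 (\<tau> T0 (e_vec j)) i"
    using j by (intro idem closed) simp
  then have "\<nu> j * \<tau> U0 (e_vec j) i = \<nu> j * e_vec j i"
    using j by (simp add: wt_A scale)
  then show "\<tau> U0 (e_vec j) i = e_vec j i"
    using wt_nz j by simp
qed

lemma U1_even: "j < n \<Longrightarrow> even j \<Longrightarrow> \<tau> U1 (e_vec j) = (\<lambda>i. 0)"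
  using wt_B[of j] by (intro invertible1[OF closed[OF coords_e_vec]]) auto

text \<open>\<open>t\<^sub>0\<close> acts on \<open>a\<^sub>D\<close> by a scalar, and \<open>u\<^sub>0\<close> fixes \<open>a\<^sub>D\<close>, so this scalar is its weight.\<close>

lemma T0_first: "\<tau> T0 (e_vec 0) = (\<lambda>i. \<nu> 0 * e_vec 0 i)"
proof -
  define \<rho> where "\<rho> = \<tau> T0 (e_vec 0) 0"
  have *: "\<tau> T0 (e_vec 0) = (\<lambda>i. \<rho> * e_vec 0 i)"
    using first by (auto simp: \<rho>_def e_vec_def)
  have "\<tau> U0 (\<tau> T0 (e_vec 0)) = (\<lambda>i. \<rho> * e_vec 0 i)"
    using n by (simp add: * scale U0_even)
  then have "\<rho> = \<nu> 0"
    using wt_A[OF n] by (auto dest!: fun_cong[of _ _ 0])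
  with * show ?thesis by simp
qed

lemma eigen_quadratic:
  assumes k: "k < n" and e: "\<tau> g (e_vec k) = (\<lambda>i. c * e_vec k i)"
    and g: "g = T0 \<and> r = r0 \<or> g = T1 \<and> r = r1"
  shows "c \<in> {r, inverse r}"
proof -
  have "\<tau> g (\<tau> g (e_vec k)) k = (r + inverse r) * \<tau> g (e_vec k) k - e_vec k k"
    using g quad0[OF coords_e_vec[OF k]] quad1[OF coords_e_vec[OF k]] by auto
  then have "c * c = (r + inverse r) * c - 1"
    using k by (simp add: e scale)
  then show ?thesis
    using quadratic_iff[of r c] r0 r1 g by blast
qed

lemma kappa: "\<kappa> \<in> (if even n then {r0, inverse r0} else {r1, inverse r1})"
  using eigen_quadratic[of "n - 1" T0 \<kappa> r0] eigen_quadratic[of "n - 1" T1 \<kappa> r1] last n by auto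

lemma first_weight: "\<nu> 0 \<in> {r0, inverse r0}"
  using eigen_quadratic[of 0 T0 "\<nu> 0" r0] T0_first n by blast

text \<open>The matrix entries that the normal form makes equal to 1.\<close>

definition up_coeff :: seq where
  "up_coeff j = \<tau> (if even j then T1 else T0) (e_vec j) (Suc j)"

text \<open>For a block \<open>(a, b)\<close> of \<open>t\<^sub>1\<close>, invertibility of \<open>t\<^sub>1\<close> gives \<open>u\<^sub>1a = 0\<close> and \<open>u\<^sub>1b = \<mu> t\<^sub>1\<inverse>b\<close>.  Since
  \<open>u\<^sub>1\<^sup>2 = 0\<close>, the vector \<open>u\<^sub>1b\<close> is killed by \<open>u\<^sub>1\<close> and so is a nonzero multiple of \<open>a\<close>.  Thus \<open>t\<^sub>1\<close> maps
  the line of \<open>a\<close> to that of \<open>b\<close>, and the quadratic relation determines the block up to one nonzero scalar.\<close>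

lemma T1_block:
  assumes j: "even j" "Suc j < n"
  shows "up_coeff j \<noteq> 0"
    and "\<tau> T1 (e_vec j) = (\<lambda>i. up_coeff j * e_vec (Suc j) i)"
    and "\<tau> T1 (e_vec (Suc j)) = (\<lambda>i. (r1 + inverse r1) * e_vec (Suc j) i + (- inverse (up_coeff j)) * e_vec j i)"
    and "\<tau> U1 (e_vec (Suc j)) = (\<lambda>i. \<nu> (Suc j) * inverse (up_coeff j) * e_vec j i)"
proof -
  let ?a = "e_vec j" and ?b = "e_vec (Suc j)" and ?R = "r1 + inverse r1"
  have a: "?a \<in> coords n" and b: "?b \<in> coords n" using j by auto
  define p where "p = \<tau> T1 ?b j"
  define q where "q = \<tau> T1 ?b (Suc j)"
  have Tb: "\<tau> T1 ?b = (\<lambda>i. p * ?a i + q * ?b i)"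
    using link_expand[of j "Suc j" T1] j unfolding p_def q_def by simp
  have Ua: "\<tau> U1 ?a = (\<lambda>i. 0)"
    using U1_even j by simp
  have TU: "\<tau> T1 (\<tau> U1 ?b) = (\<lambda>i. \<nu> (Suc j) * ?b i)"
    using wt_B[of "Suc j"] j by simp
  \<comment> \<open>The quadratic relation makes \<open>r\<^sub>1 + r\<^sub>1\<inverse> - t\<^sub>1\<close> the inverse of \<open>t\<^sub>1\<close>.\<close>
  have Ub: "\<tau> U1 ?b i = \<nu> (Suc j) * ?R * ?b i - \<nu> (Suc j) * \<tau> T1 ?b i" for i
  proof -
    have "\<tau> T1 (\<tau> T1 (\<tau> U1 ?b)) i = ?R * \<tau> T1 (\<tau> U1 ?b) i - \<tau> U1 ?b i"
      by (rule quad1[OF closed[OF b]])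
    then show ?thesis
      by (simp add: TU scale[OF b] algebra_simps)
  qed
  have Ub': "\<tau> U1 ?b = (\<lambda>i. (\<nu> (Suc j) * (?R - q)) * ?b i + (- (\<nu> (Suc j) * p)) * ?a i)"
    by (auto simp: Ub Tb algebra_simps)
  have Ub_nz: "\<tau> U1 ?b \<noteq> (\<lambda>i. 0)"
  proof
    assume "\<tau> U1 ?b = (\<lambda>i. 0)"
    then have "(\<lambda>i. \<nu> (Suc j) * ?b i) = (\<lambda>i. 0)"
      using TU zero by simp
    from fun_cong[OF this, of "Suc j"] show False
      using wt_nz[of "Suc j"] j by simp
  qed
  then obtain i where i: "\<tau> U1 ?b i \<noteq> 0" by blast
  have "(\<nu> (Suc j) * (?R - q)) * \<tau> U1 ?b i = 0"
    using fun_cong[OF lin[OF b a, of U1 "\<nu> (Suc j) * (?R - q)" "- (\<nu> (Suc j) * p)"], of i, folded Ub']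
    unfolding nil[OF b] Ua by simp
  then have q: "q = ?R"
    using i wt_nz[of "Suc j"] j by simp
  have p: "p \<noteq> 0"
    using Ub_nz by (auto simp: Ub' q)
  have Ta: "\<tau> T1 ?a = (\<lambda>i. (- inverse p) * ?b i)"
  proof
    fix i
    have "\<tau> T1 (\<tau> T1 ?b) i = ?R * \<tau> T1 ?b i - ?b i"
      by (rule quad1[OF b])
    then have "p * \<tau> T1 ?a i + q * \<tau> T1 ?b i = ?R * \<tau> T1 ?b i - ?b i"
      unfolding Tb lin[OF a b] by (simp add: Tb)
    then have "p * \<tau> T1 ?a i = - ?b i"
      by (simp add: q)
    then show "\<tau> T1 ?a i = (- inverse p) * ?b i"
      using p by (simp add: field_simps)
  qed
  then have sj: "up_coeff j = - inverse p"
    using j by (simp add: up_coeff_def)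
  then show "up_coeff j \<noteq> 0" using p by simp
  show "\<tau> T1 ?a = (\<lambda>i. up_coeff j * ?b i)"
    using Ta sj by simp
  have ps: "p = - inverse (up_coeff j)"
    using sj by simp
  show "\<tau> T1 ?b = (\<lambda>i. ?R * ?b i + (- inverse (up_coeff j)) * ?a i)"
    by (simp add: Tb q ps add.commute)
  show "\<tau> U1 ?b = (\<lambda>i. \<nu> (Suc j) * inverse (up_coeff j) * ?a i)"
    by (simp add: Ub' q ps)
qed

text \<open>What a block \<open>(b, a)\<close> of \<open>t\<^sub>0\<close> looks like before irreducibility is used.  Here \<open>u\<^sub>0a = a\<close> and
  \<open>u\<^sub>0t\<^sub>0b = 0\<close>; the latter excludes \<open>q = 0\<close>, because \<open>t\<^sub>0b\<close> would then be a nonzero multiple of \<open>a\<close>.  The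
  last two equations are the two coefficients of the quadratic relation applied to \<open>b\<close>.\<close>

lemma T0_block_general:
  assumes j: "odd j" "Suc j < n"
  obtains q x y where "q \<noteq> 0"
    and "\<tau> T0 (e_vec j) = (\<lambda>i. up_coeff j * e_vec (Suc j) i + q * e_vec j i)"
    and "\<tau> T0 (e_vec (Suc j)) = (\<lambda>i. x * e_vec (Suc j) i + y * e_vec j i)"
    and "\<tau> U0 (e_vec j) = (\<lambda>i. - (up_coeff j * inverse q) * e_vec (Suc j) i)"
    and "\<nu> (Suc j) = x - y * up_coeff j * inverse q"
    and "up_coeff j * (x + q - (r0 + inverse r0)) = 0"
    and "up_coeff j * y = (r0 + inverse r0) * q - 1 - q * q"
proof -
  let ?a = "e_vec (Suc j)" and ?b = "e_vec j" and ?R = "r0 + inverse r0"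
  have a: "?a \<in> coords n" and b: "?b \<in> coords n" using j by auto
  define q where "q = \<tau> T0 ?b j"
  define x where "x = \<tau> T0 ?a (Suc j)"
  define y where "y = \<tau> T0 ?a j"
  have Tb: "\<tau> T0 ?b = (\<lambda>i. up_coeff j * ?a i + q * ?b i)"
    using link_expand[of j j T0] j unfolding up_coeff_def q_def by (simp add: add.commute)
  have Ta: "\<tau> T0 ?a = (\<lambda>i. x * ?a i + y * ?b i)"
    using link_expand[of j "Suc j" T0] j unfolding x_def y_def by (simp add: add.commute)
  have Ua: "\<tau> U0 ?a = ?a"
    using U0_even j by simp
  have UTb: "(\<lambda>i. up_coeff j * ?a i + q * \<tau> U0 ?b i) = (\<lambda>i. 0)"
    using wt_A[of j] j unfolding Tb lin[OF a b] Ua by simp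
  have q: "q \<noteq> 0"
  proof
    assume "q = 0"
    with fun_cong[OF UTb, of "Suc j"] have "up_coeff j = 0" by simp
    with \<open>q = 0\<close> have "\<tau> T0 ?b = (\<lambda>i. 0)" by (simp add: Tb)
    with invertible0[OF b] e_not_zero show False by blast
  qed
  have Ub: "\<tau> U0 ?b = (\<lambda>i. - (up_coeff j * inverse q) * ?a i)"
  proof
    fix i
    have "q * \<tau> U0 ?b i = - up_coeff j * ?a i"
      using fun_cong[OF UTb, of i] by (simp add: eq_neg_iff_add_eq_0 add.commute)
    then show "\<tau> U0 ?b i = - (up_coeff j * inverse q) * ?a i"
      using q by (simp add: field_simps)
  qed
  have "\<tau> U0 (\<tau> T0 ?a) (Suc j) = \<nu> (Suc j)"
    using wt_A[of "Suc j"] j by simp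
  then have nu: "\<nu> (Suc j) = x - y * up_coeff j * inverse q"
    unfolding Ta lin[OF a b] Ua Ub by (simp add: mult.assoc)
  have TTb: "up_coeff j * \<tau> T0 ?a i + q * \<tau> T0 ?b i = ?R * \<tau> T0 ?b i - ?b i" for i
    using quad0[OF b, of i] unfolding Tb lin[OF a b] by (simp add: Tb)
  from TTb[of "Suc j"] have 1: "up_coeff j * (x + q - ?R) = 0"
    by (simp add: Ta Tb algebra_simps)
  from TTb[of j] have 2: "up_coeff j * y = ?R * q - 1 - q * q"
    by (simp add: Ta Tb algebra_simps)
  show thesis
    by (rule that[OF q Tb Ta Ub nu 1 2])
qed

text \<open>The form in which irreducibility is used: no proper nonempty set of unit vectors spans an
  invariant subspace.\<close>

lemma invariant_support:
  assumes "\<And>g k i. k < n \<Longrightarrow> k \<in> I \<Longrightarrow> i \<notin> I \<Longrightarrow> \<tau> g (e_vec k) i = 0"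
  shows "I \<inter> {..<n} = {} \<or> {..<n} \<subseteq> I"
proof -
  define W where "W = {x \<in> coords n. \<forall>i. i \<notin> I \<longrightarrow> x i = 0}"
  have inv: "\<tau> g x \<in> W" if "x \<in> W" for g x
  proof -
    have x: "x \<in> coords n" using that by (simp add: W_def)
    have "\<tau> g x i = 0" if "i \<notin> I" for i
    proof -
      have "\<tau> g x i = (\<Sum>k<n. x k * \<tau> g (e_vec k) i)"
        using linear_on_units[of n "\<tau> g" x i] op_add scale x by blast
      also have "\<dots> = 0"
      proof (rule sum.neutral, intro ballI)
        fix k assume "k \<in> {..<n}"
        then show "x k * \<tau> g (e_vec k) i = 0"
          using assms[of k i g] \<open>x \<in> W\<close> \<open>i \<notin> I\<close> by (cases "k \<in> I") (auto simp: W_def)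
      qed
      finally show ?thesis .
    qed
    then show ?thesis using closed[OF x] by (simp add: W_def)
  qed
  have "W \<subseteq> coords n \<and> 0 \<in> W \<and> (\<forall>x\<in>W. \<forall>y\<in>W. x + y \<in> W) \<and>
      (\<forall>c. \<forall>x\<in>W. (\<lambda>j. c * x j) \<in> W) \<and> (\<forall>g. \<forall>x\<in>W. \<tau> g x \<in> W)"
    using inv by (auto simp: W_def)
  then have "W = {0} \<or> W = coords n"
    using irr unfolding irreducible_coords_def by blast
  then show ?thesis
  proof
    assume W: "W = {0}"
    have "k \<notin> I" if "k < n" for k
    proof
      assume "k \<in> I"
      then have "e_vec k \<in> W"
        using that by (simp add: W_def) (metis e_vec_at(2))
      then show False using W e_not_zero[of k] by (simp add: zero_fun_def)
    qed
    then show ?thesis by auto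
  next
    assume W: "W = coords n"
    have "k \<in> I" if "k < n" for k
    proof (rule ccontr)
      assume "k \<notin> I"
      moreover have "e_vec k \<in> W" using that W by simp
      ultimately have "e_vec k k = 0" unfolding W_def by blast
      then show False by simp
    qed
    then show ?thesis by auto
  qed
qed

text \<open>The positions \<open>i\<close>, \<open>k\<close> with \<open>i div 2 = k div 2\<close> are those in one block of \<open>t\<^sub>1\<close>.\<close>

lemma T1_U1_local:
  assumes k: "k < n" and g: "g \<in> {T1, U1}" and ne: "\<tau> g (e_vec k) i \<noteq> 0"
  shows "i div 2 = k div 2"
proof (cases "even k")
  case True
  show ?thesis
  proof (cases "Suc k < n")
    case True
    then show ?thesis
      using g ne \<open>even k\<close> T1_block(2)[of k] U1_even[of k] k
      by (cases "i = Suc k") auto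
  next
    case False
    then have "n = Suc k" using k by simp
    then have "k = n - 1" "odd n" using \<open>even k\<close> by simp_all
    then show ?thesis
      using g ne last U1_even[of k] k \<open>even k\<close> by (cases "i = k") auto
  qed
next
  case False
  then obtain j where j: "k = Suc j" "even j" by (cases k) auto
  then show ?thesis
    using g ne T1_block(3,4)[of j] k by (cases "i = j"; cases "i = k") auto
qed

lemma U0_last:
  assumes e: "even n"
  shows "\<tau> U0 (e_vec (n - 1)) = (\<lambda>i. 0)"
proof
  fix i
  have k: "n - 1 < n" using n by simp
  have "\<kappa> \<noteq> 0"
    using kappa e r0 by auto
  have T: "\<tau> T0 (e_vec (n - 1)) = (\<lambda>i. \<kappa> * e_vec (n - 1) i)"
    using last e by simp
  have "(\<lambda>i. \<kappa> * \<tau> U0 (e_vec (n - 1)) i) = (\<lambda>i. 0)"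
    using wt_A[OF k] e n unfolding T scale[OF coords_e_vec[OF k]] by simp
  from fun_cong[OF this, of i] show "\<tau> U0 (e_vec (n - 1)) i = 0"
    using \<open>\<kappa> \<noteq> 0\<close> by simp
qed

text \<open>\<open>t\<^sub>0\<close> and \<open>u\<^sub>0\<close> can leave the line of a unit vector only inside a block of \<open>t\<^sub>0\<close>, upwards only
  where the coefficient of \<open>t\<^sub>0\<close> is nonzero, and downwards only through \<open>t\<^sub>0\<close> itself.\<close>

lemma T0_U0_local:
  assumes k: "k < n" and g: "g \<in> {T0, U0}" and ne: "\<tau> g (e_vec k) i \<noteq> 0"
  shows "i = k \<or> even k \<and> k = Suc i \<and> g = T0 \<and> \<tau> T0 (e_vec k) i \<noteq> 0 \<or> odd k \<and> i = Suc k \<and> Suc k < n \<and> up_coeff k \<noteq> 0"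
proof (cases "even k")
  case True
  show ?thesis
  proof (cases "k = 0")
    case True
    then show ?thesis
      using g ne T0_first U0_even[of k] k by (cases "i = k") auto
  next
    case False
    then obtain j where j: "k = Suc j" "odd j" using True by (cases k) auto
    then obtain x y where "\<tau> T0 (e_vec k) = (\<lambda>i. x * e_vec (Suc j) i + y * e_vec j i)"
      using T0_block_general[of j] k by metis
    then show ?thesis
      using g ne U0_even[of k] k j True by (cases "i = j"; cases "i = k") auto
  qed
next
  case odd: False
  show ?thesis
  proof (cases "Suc k < n")
    case True
    then obtain q where "\<tau> T0 (e_vec k) = (\<lambda>i. up_coeff k * e_vec (Suc k) i + q * e_vec k i)"
      and "\<tau> U0 (e_vec k) = (\<lambda>i. - (up_coeff k * inverse q) * e_vec (Suc k) i)"
      using T0_block_general[of k] odd by metis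
    then show ?thesis
      using g ne odd True by (cases "i = k"; cases "i = Suc k") auto
  next
    case False
    then have "n = Suc k" using k by simp
    then have e: "k = n - 1" "even n" using odd by simp_all
    then have T: "\<tau> T0 (e_vec k) = (\<lambda>i. \<kappa> * e_vec k i)"
      using last by simp
    have "\<tau> U0 (e_vec k) = (\<lambda>i. 0)"
      using U0_last e by simp
    then show ?thesis
      using g ne T by (cases "i = k") auto
  qed
qed

text \<open>Otherwise nothing leads from the first \<open>j + 1\<close> unit vectors to the later ones, and they
  span an invariant subspace.\<close>

lemma up_coeff_nonzero:
  assumes "Suc j < n"
  shows "up_coeff j \<noteq> 0"
proof (cases "even j")
  case True
  then show ?thesis using T1_block(1) assms by blast
next
  case False
  show ?thesis
  proof
    assume s: "up_coeff j = 0"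
    have "\<tau> g (e_vec k) i = 0" if k: "k < n" "k \<in> {..j}" "i \<notin> {..j}" for g k i
    proof (rule ccontr)
      assume ne: "\<tau> g (e_vec k) i \<noteq> 0"
      have b: "k \<le> j" "j < i" using k by auto
      show False
      proof (cases "g \<in> {T1, U1}")
        case True
        have "i div 2 = k div 2" by (rule T1_U1_local[OF k(1) True ne])
        then show False using b \<open>odd j\<close> by presburger
      next
        case g: False
        then have "g \<in> {T0, U0}" by (cases g) auto
        from T0_U0_local[OF k(1) this ne] show False
        proof (elim disjE conjE)
          assume "i = Suc k" "up_coeff k \<noteq> 0"
          then have "k = j" using b by simp
          then show False using s \<open>up_coeff k \<noteq> 0\<close> by simp
        qed (use b in auto)
      qed
    qed
    from invariant_support[of "{..j}", OF this] assms show False by auto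
  qed
qed

text \<open>Dually, otherwise the unit vectors after position \<open>j\<close> span an invariant subspace.\<close>

lemma lower_nonzero:
  assumes "odd j" "Suc j < n"
  shows "\<tau> T0 (e_vec (Suc j)) j \<noteq> 0"
proof
  assume y: "\<tau> T0 (e_vec (Suc j)) j = 0"
  have "\<tau> g (e_vec k) i = 0" if k: "k < n" "k \<in> {Suc j..}" "i \<notin> {Suc j..}" for g k i
  proof (rule ccontr)
    assume ne: "\<tau> g (e_vec k) i \<noteq> 0"
    have b: "i \<le> j" "j < k" using k by auto
    show False
    proof (cases "g \<in> {T1, U1}")
      case True
      have "i div 2 = k div 2" by (rule T1_U1_local[OF k(1) True ne])
      moreover have "i div 2 \<le> j div 2" "Suc j div 2 \<le> k div 2"
        using b by (intro div_le_mono; simp)+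
      ultimately show False using assms(1) by (elim oddE) simp
    next
      case g: False
      then have "g \<in> {T0, U0}" by (cases g) auto
      from T0_U0_local[OF k(1) this ne] show False
      proof (elim disjE conjE)
        assume "k = Suc i" "\<tau> T0 (e_vec k) i \<noteq> 0"
        moreover from this have "i = j" using b by simp
        ultimately show False using y by simp
      qed (use b in auto)
    qed
  qed
  moreover have "Suc j \<in> {Suc j..} \<inter> {..<n}" "0 \<in> {..<n}" "0 \<notin> {Suc j..}"
    using assms by auto
  ultimately show False
    using invariant_support[of "{Suc j..}"] by blast
qed

text \<open>With both off-diagonal entries nonzero, the general form of the block becomes the one of
  \<open>std\<close> up to scaling.  As the product \<open>(r\<^sub>0 + r\<^sub>0\<inverse>) q - 1 - q\<^sup>2\<close> of these entries is nonzero, \<open>q = \<nu>\<inverse>\<close> is not a root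
  of the quadratic, which is the exclusion of \<open>r\<^sub>0, r\<^sub>0\<inverse>\<close> among the \<open>\<lambda>\<^sub>i\<close>.\<close>

lemma T0_block:
  assumes j: "odd j" "Suc j < n"
  defines "q \<equiv> inverse (\<nu> (Suc j))" and "R \<equiv> r0 + inverse r0"
  shows "\<tau> T0 (e_vec j) = (\<lambda>i. up_coeff j * e_vec (Suc j) i + q * e_vec j i)"
    and "\<tau> T0 (e_vec (Suc j)) = (\<lambda>i. (R - q) * e_vec (Suc j) i + ((R - q) * q - 1) * inverse (up_coeff j) * e_vec j i)"
    and "\<tau> U0 (e_vec j) = (\<lambda>i. - (up_coeff j * \<nu> (Suc j)) * e_vec (Suc j) i)"
    and "\<nu> (Suc j) \<notin> {r0, inverse r0}"
proof -
  obtain q' x y where q': "q' \<noteq> 0"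
    and Tb: "\<tau> T0 (e_vec j) = (\<lambda>i. up_coeff j * e_vec (Suc j) i + q' * e_vec j i)"
    and Ta: "\<tau> T0 (e_vec (Suc j)) = (\<lambda>i. x * e_vec (Suc j) i + y * e_vec j i)"
    and Ub: "\<tau> U0 (e_vec j) = (\<lambda>i. - (up_coeff j * inverse q') * e_vec (Suc j) i)"
    and nu: "\<nu> (Suc j) = x - y * up_coeff j * inverse q'"
    and 1: "up_coeff j * (x + q' - R) = 0"
    and 2: "up_coeff j * y = R * q' - 1 - q' * q'"
    by (rule T0_block_general[OF j, folded R_def]) (rule that; assumption)
  have s: "up_coeff j \<noteq> 0" by (rule up_coeff_nonzero[OF j(2)])
  have y: "y \<noteq> 0" using lower_nonzero[OF j] by (simp add: Ta)
  have x: "x = R - q'" using 1 s by (simp add: eq_diff_eq)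
  have "\<nu> (Suc j) * q' = x * q' - up_coeff j * y"
    using q' by (simp add: nu field_simps)
  also have "\<dots> = 1"
    unfolding 2 x by (simp add: algebra_simps)
  finally have qq: "q = q'"
    unfolding q_def using q' by (metis inverse_unique mult.commute)
  have y': "y = ((R - q) * q - 1) * inverse (up_coeff j)"
    using 2 s by (simp add: qq field_simps)
  show "\<tau> T0 (e_vec j) = (\<lambda>i. up_coeff j * e_vec (Suc j) i + q * e_vec j i)"
    using Tb qq by simp
  show "\<tau> T0 (e_vec (Suc j)) = (\<lambda>i. (R - q) * e_vec (Suc j) i + ((R - q) * q - 1) * inverse (up_coeff j) * e_vec j i)"
    unfolding Ta y' x qq by simp
  show "\<tau> U0 (e_vec j) = (\<lambda>i. - (up_coeff j * \<nu> (Suc j)) * e_vec (Suc j) i)"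
  proof -
    have "\<nu> (Suc j) = inverse q'"
      using qq by (metis q_def inverse_inverse_eq)
    then show ?thesis by (simp only: Ub)
  qed
  show "\<nu> (Suc j) \<notin> {r0, inverse r0}"
  proof
    assume "\<nu> (Suc j) \<in> {r0, inverse r0}"
    then have "q' \<in> {r0, inverse r0}"
      unfolding qq[symmetric] q_def by auto
    then have "up_coeff j * y = 0"
      using quadratic_iff[OF r0, of q'] 2 by (simp add: R_def)
    then show False using s y by simp
  qed
qed

definition rescaling :: seq where
  "rescaling k = (\<Prod>j<k. up_coeff j)"

lemma rescaling_nonzero: "k < n \<Longrightarrow> rescaling k \<noteq> 0"
  unfolding rescaling_def using up_coeff_nonzero by (auto simp: Suc_lessI)

lemma rescaling_Suc: "rescaling (Suc k) = rescaling k * up_coeff k"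
  by (simp add: rescaling_def)

text \<open>The diagonal matrix with entries \<open>rescaling k\<close> makes every upward coefficient 1.\<close>

lemma conjugate_unit:
  assumes k: "k < n"
  shows "rescaling k * \<tau> g (e_vec k) i = rescaling i * std r0 r1 n \<kappa> \<nu> g (e_vec k) i"
proof -
  have even_end: "even n" if "odd k" "k = n - 1" using that n by (cases n) auto
  have odd_end: "odd n" if "even k" "k = n - 1" using that n by (cases n) auto
  show ?thesis
  proof (cases g)
    case T0
    consider "k = 0" | j where "k = Suc j" "odd j" | "odd k" "Suc k < n" | "odd k" "k = n - 1"
      using k by (cases k) fastforce+
    then show ?thesis
    proof cases
      case 1
      then show ?thesis
        unfolding T0 1 T0_first std_T0_first[OF n] by (cases "i = 0") auto
    next
      case (2 j)
      then have j: "odd j" "Suc j < n" and s: "up_coeff j \<noteq> 0" using up_coeff_nonzero k by auto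
      show ?thesis
        unfolding T0 2 T0_block(2)[OF j] std_T0_even[OF j]
        using s by (cases "i = j"; cases "i = Suc j") (auto simp: rescaling_Suc)
    next
      case 3
      show ?thesis
        unfolding T0 T0_block(1)[OF 3] std_T0_odd[OF 3]
        by (cases "i = k"; cases "i = Suc k") (auto simp: rescaling_Suc)
    next
      case 4
      have "\<tau> T0 (e_vec k) = (\<lambda>i. \<kappa> * e_vec k i)"
        and "std r0 r1 n \<kappa> \<nu> T0 (e_vec k) = (\<lambda>i. \<kappa> * e_vec k i)"
        using last std_end[OF n, of r0 r1 \<kappa> \<nu>] even_end[OF 4] 4(2) by (simp_all del: std.simps)
      then show ?thesis
        unfolding T0 by (cases "i = k") auto
    qed
  next
    case U0
    consider "even k" | "odd k" "Suc k < n" | "odd k" "k = n - 1"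
      using k by fastforce
    then show ?thesis
    proof cases
      case 1
      show ?thesis
        unfolding U0 U0_even[OF k 1] std_U0_even[OF 1 k] by (cases "i = k") auto
    next
      case 2
      show ?thesis
        unfolding U0 T0_block(3)[OF 2] std_U0_odd[OF 2(1) k]
        using 2 by (cases "i = Suc k") (auto simp: rescaling_Suc)
    next
      case 3
      have "\<tau> U0 (e_vec k) = (\<lambda>i. 0)"
        using U0_last even_end[OF 3] 3 by simp
      then show ?thesis
        unfolding U0 std_U0_odd[OF 3(1) k] using 3 by auto
    qed
  next
    case T1
    consider "even k" "Suc k < n" | "even k" "k = n - 1" | j where "k = Suc j" "even j"
      using k by (cases k) fastforce+
    then show ?thesis
    proof cases
      case 1
      show ?thesis
        unfolding T1 T1_block(2)[OF 1] std_T1_even[OF 1] by (cases "i = Suc k") (auto simp: rescaling_Suc)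
    next
      case 2
      have "\<tau> T1 (e_vec k) = (\<lambda>i. \<kappa> * e_vec k i)"
        and "std r0 r1 n \<kappa> \<nu> T1 (e_vec k) = (\<lambda>i. \<kappa> * e_vec k i)"
        using last std_end[OF n, of r0 r1 \<kappa> \<nu>] odd_end[OF 2] 2(2) by (simp_all del: std.simps)
      then show ?thesis
        unfolding T1 by (cases "i = k") auto
    next
      case (3 j)
      then have j: "even j" "Suc j < n" "odd (Suc j)" and s: "up_coeff j \<noteq> 0" using up_coeff_nonzero k by auto
      show ?thesis
        unfolding T1 3 T1_block(3)[OF j(1,2)] std_T1_odd[OF j(3,2)]
        using s by (cases "i = j"; cases "i = Suc j") (auto simp: rescaling_Suc)
    qed
  next
    case U1
    consider "even k" | j where "k = Suc j" "even j"
      by (cases k) auto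
    then show ?thesis
    proof cases
      case 1
      show ?thesis
        unfolding U1 U1_even[OF k 1] std_U1_even[OF 1] by simp
    next
      case (2 j)
      then have j: "even j" "Suc j < n" and s: "up_coeff j \<noteq> 0" using up_coeff_nonzero k by auto
      show ?thesis
        unfolding U1 2 T1_block(4)[OF j] std_U1_odd[OF j]
        using s by (cases "i = j") (auto simp: rescaling_Suc)
    qed
  qed
qed

lemma conjugate:
  assumes x: "x \<in> coords n"
  shows "\<tau> g (\<lambda>j. rescaling j * x j) = (\<lambda>j. rescaling j * std r0 r1 n \<kappa> \<nu> g x j)"
proof
  fix i
  have dx: "(\<lambda>j. rescaling j * x j) \<in> coords n"
    using x by (simp add: coords_def)
  have "\<tau> g (\<lambda>j. rescaling j * x j) i = (\<Sum>k<n. rescaling k * x k * \<tau> g (e_vec k) i)"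
    using linear_on_units[of n "\<tau> g" "\<lambda>j. rescaling j * x j" i] op_add scale dx by blast
  also have "\<dots> = (\<Sum>k<n. rescaling i * (x k * std r0 r1 n \<kappa> \<nu> g (e_vec k) i))"
  proof (rule sum.cong)
    fix k assume "k \<in> {..<n}"
    then have "rescaling k * \<tau> g (e_vec k) i = rescaling i * std r0 r1 n \<kappa> \<nu> g (e_vec k) i"
      using conjugate_unit by blast
    then show "rescaling k * x k * \<tau> g (e_vec k) i = rescaling i * (x k * std r0 r1 n \<kappa> \<nu> g (e_vec k) i)"
      by (metis mult.assoc mult.commute)
  qed simp
  also have "\<dots> = rescaling i * std r0 r1 n \<kappa> \<nu> g x i"
    using linear_on_units[of n "std r0 r1 n \<kappa> \<nu> g" x i, OF std_add std_scale x]
    by (simp only: sum_distrib_left)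
  finally show "\<tau> g (\<lambda>j. rescaling j * x j) i = rescaling i * std r0 r1 n \<kappa> \<nu> g x i" .
qed

lemma admissible:
  assumes "\<And>i j. i < n \<Longrightarrow> j < n \<Longrightarrow> even i = even j \<Longrightarrow> i \<noteq> j \<Longrightarrow> \<nu> i \<noteq> \<nu> j"
  shows "admissible r0 r1 n \<kappa> \<nu>"
proof -
  have "\<nu> j \<notin> {r0, inverse r0}" if "j < n" "even j" "0 < j" for j
    using T0_block(4)[of "j - 1"] that by auto
  then show ?thesis
    unfolding admissible_def using first_weight kappa wt_nz assms by blast
qed

end

section \<open>Modules in coordinates\<close>

lemma elt_gen:
  "elt_t0 r0 r1 = quot_map r0 r1 (gen T0)" "elt_t1 r0 r1 = quot_map r0 r1 (gen T1)"
  by (simp_all add: elt_t0_def elt_t1_def)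

lemma elt_A_eq: "elt_A r0 r1 = quot_map r0 r1 (gen U0 * gen T0)"
  by (simp add: elt_A_def elt_u0_def elt_t0_def quot_map_mult)

lemma elt_B_eq: "elt_B r0 r1 = quot_map r0 r1 (gen T1 * gen U1)"
  by (simp add: elt_B_def elt_u1_def elt_t1_def quot_map_mult)

text \<open>A dimension is only meaningful for spaces known to be finite-dimensional, so the assumption
  that a weight space has dimension 1 becomes usable through this lemma.\<close>

lemma (in complex_space) fin_dim_subspace:
  assumes fd: "fin_dim" and W: "subspace class_ring W V"
  shows "vectorspace.fin_dim class_ring (V\<lparr>carrier := W\<rparr>)"
proof -
  interpret W: vectorspace "class_ring :: complex ring" "V\<lparr>carrier := W\<rparr>"
    by (rule subspace_is_vs[OF W])
  have sm: "submodule class_ring W V" and sub: "W \<subseteq> carrier V"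
    using W by (auto simp: subspace_def submodule_def)
  have "\<exists>A. finite A \<and> maximal A (\<lambda>S. S \<subseteq> carrier (V\<lparr>carrier := W\<rparr>) \<and> W.lin_indpt S)"
  proof (rule maximal_exists)
    fix A assume A: "A \<subseteq> carrier (V\<lparr>carrier := W\<rparr>) \<and> W.lin_indpt A"
    then have "lin_indpt A" "A \<subseteq> carrier V"
      using span_li_not_depend(2)[OF _ sm, of A] sub by auto
    then show "finite A \<and> card A \<le> dim"
      using li_le_dim[OF fd] by blast
  next
    show "{} \<subseteq> carrier (V\<lparr>carrier := W\<rparr>) \<and> W.lin_indpt {}"
      by (auto simp: W.lin_dep_def)
  qed
  then obtain A where "finite A" "W.basis A"
    using W.max_li_is_basis by blast
  then show ?thesis
    unfolding W.fin_dim_def W.basis_def by blast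
qed

locale coordinatized = daha_module r0 r1 M for r0 r1 and M :: "'v daha_module" +
  fixes n :: nat and \<phi> :: "seq \<Rightarrow> 'v"
  assumes \<phi>: "coordinates n (cspace r0 r1 M) \<phi>"
begin

definition ev :: "free_alg \<Rightarrow> seq \<Rightarrow> seq" where
  "ev a x = inv_into (coords n) \<phi> (act a (\<phi> x))"

lemma bij: "bij_betw \<phi> (coords n) (carrier M)"
  using \<phi> by (simp add: coordinates_def)

lemma \<phi>_closed [simp]: "x \<in> coords n \<Longrightarrow> \<phi> x \<in> carrier M"
  using bij by (auto simp: bij_betw_def)

lemma \<phi>_eq [simp]: "x \<in> coords n \<Longrightarrow> y \<in> coords n \<Longrightarrow> \<phi> x = \<phi> y \<longleftrightarrow> x = y"
  using coordinates_eq_iff[OF \<phi>] by blast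

lemma \<phi>_add: "x \<in> coords n \<Longrightarrow> y \<in> coords n \<Longrightarrow> \<phi> (x + y) = \<phi> x \<oplus>\<^bsub>M\<^esub> \<phi> y"
  using coordinates_add[OF \<phi>] by simp

lemma \<phi>_scale: "x \<in> coords n \<Longrightarrow> \<phi> (\<lambda>j. c * x j) = act (scal c) (\<phi> x)"
  using coordinates_scale[OF \<phi>] by simp

lemma \<phi>_zero: "\<phi> 0 = \<zero>\<^bsub>M\<^esub>"
  using V.coordinates_zero[OF \<phi>] by simp

lemma \<phi>_surj: "v \<in> carrier M \<Longrightarrow> \<exists>x\<in>coords n. v = \<phi> x"
  using coordinates_surj[OF \<phi>] by simp

lemma ev_closed: "x \<in> coords n \<Longrightarrow> ev a x \<in> coords n"
  unfolding ev_def using bij by (metis \<phi>_closed bij_betw_def inv_into_into quot_map_carrier smult_closed)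

lemma \<phi>_ev: "x \<in> coords n \<Longrightarrow> \<phi> (ev a x) = act a (\<phi> x)"
  unfolding ev_def using bij by (metis \<phi>_closed bij_betw_def f_inv_into_f quot_map_carrier smult_closed)

lemma ev_eqI: "x \<in> coords n \<Longrightarrow> y \<in> coords n \<Longrightarrow> act a (\<phi> x) = \<phi> y \<Longrightarrow> ev a x = y"
  using \<phi>_ev[of x a] \<phi>_eq[OF ev_closed[of x a], of y] by simp

lemma ev_add: "x \<in> coords n \<Longrightarrow> ev (a + b) x = ev a x + ev b x"
  by (rule ev_eqI) (simp_all add: ev_closed act_add \<phi>_add \<phi>_ev)

lemma ev_mult: "x \<in> coords n \<Longrightarrow> ev (a * b) x = ev a (ev b x)"
  by (rule ev_eqI) (simp_all add: ev_closed act_mult \<phi>_ev)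

lemma ev_scal: "x \<in> coords n \<Longrightarrow> ev (scal c) x = (\<lambda>j. c * x j)"
  by (rule ev_eqI) (simp_all add: \<phi>_scale)

lemma ev_diff: "x \<in> coords n \<Longrightarrow> ev (a - b) x j = ev a x j - ev b x j"
  using fun_cong[OF ev_add[of x "a - b" b], of j] by (simp add: algebra_simps)

lemma ev_plus: "x \<in> coords n \<Longrightarrow> y \<in> coords n \<Longrightarrow> ev a (x + y) = ev a x + ev a y"
  by (rule ev_eqI) (simp_all add: ev_closed \<phi>_add \<phi>_ev smult_r_distr)

lemma scal_commute: "scal c * a = a * scal c"
proof (induction a rule: free_alg_single_induct)
  case (single w d)
  then show ?case by (simp add: scal_def mult_single mult.commute)
qed (simp add: algebra_simps)

lemma ev_scale: "x \<in> coords n \<Longrightarrow> ev a (\<lambda>j. c * x j) = (\<lambda>j. c * ev a x j)"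
  by (simp only: ev_scal[symmetric] ev_closed ev_mult[symmetric] scal_commute)

lemma ev_zero: "ev a 0 = 0"
  by (rule linear_zero[OF ev_scale])

lemma ev_relator: "a \<in> relators r0 r1 \<Longrightarrow> x \<in> coords n \<Longrightarrow> ev a x = 0"
  by (rule ev_eqI) (simp_all add: act_relator \<phi>_zero)

text \<open>Multiplying out \<open>(t - r)(t - r\<inverse>) = 0\<close>.\<close>

lemma ev_quadratic:
  assumes "(gen g - scal r) * (gen g - scal (inverse r)) \<in> relators r0 r1" and "r \<noteq> 0"
    and x: "x \<in> coords n"
  shows "ev (gen g) (ev (gen g) x) j = (r + inverse r) * ev (gen g) x j - x j"
proof -
  define y where "y = ev (gen g - scal (inverse r)) x"
  have y: "y = (\<lambda>j. ev (gen g) x j - inverse r * x j)"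
    unfolding y_def using x by (auto simp: ev_diff ev_scal)
  have yc: "y \<in> coords n" unfolding y_def by (rule ev_closed[OF x])
  have "0 = ev (gen g - scal r) y j"
    using ev_relator[OF assms(1) x] by (simp add: ev_mult[OF x] y_def)
  also have "\<dots> = ev (gen g) y j - r * y j"
    using yc by (simp add: ev_diff ev_scal)
  also have "ev (gen g) y = ev (gen g) (ev (gen g) x + (\<lambda>j. (- inverse r) * x j))"
    by (simp add: y plus_fun_def)
  also have "\<dots> = ev (gen g) (ev (gen g) x) + (\<lambda>j. (- inverse r) * ev (gen g) x j)"
    using x ev_closed[OF x] by (simp only: ev_plus ev_scale coords_scale)
  finally show ?thesis
    using assms(2) by (simp add: y algebra_simps)
qed

lemma ev_idem: "x \<in> coords n \<Longrightarrow> ev (gen U0) (ev (gen U0) x) j = ev (gen U0) x j"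
  using fun_cong[OF ev_relator[of "gen U0 ^ 2 - gen U0" x], of j]
  by (simp add: relators_def power2_eq_square ev_diff ev_mult)

lemma ev_nil: "x \<in> coords n \<Longrightarrow> ev (gen U1) (ev (gen U1) x) j = 0"
  using fun_cong[OF ev_relator[of "gen U1 ^ 2" x], of j]
  by (simp add: relators_def power2_eq_square ev_mult)

lemma weight_space_iff:
  assumes x: "x \<in> coords n"
  shows "\<phi> x \<in> weight_space r0 r1 M \<alpha> \<beta> \<longleftrightarrow>
    ev (gen U0) (ev (gen T0) x) = (\<lambda>j. \<alpha> * x j) \<and> ev (gen T1) (ev (gen U1) x) = (\<lambda>j. \<beta> * x j)"
proof -
  have "act (gen a * gen b) (\<phi> x) = act (scal c) (\<phi> x) \<longleftrightarrow> ev (gen a) (ev (gen b) x) = (\<lambda>j. c * x j)"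
    for a b c
    using \<phi>_eq[OF ev_closed[OF ev_closed[OF x]] coords_scale[OF x, of c], of "gen a" "gen b"] x
    by (simp add: \<phi>_ev ev_closed act_mult \<phi>_scale)
  then show ?thesis
    using x by (simp add: weight_space_def elt_A_eq elt_B_eq)
qed

lemma weight_space_subspace:
  "subspace class_ring (weight_space r0 r1 M \<alpha> \<beta>) (cspace r0 r1 M)"
  (is "subspace _ ?W _")
proof (intro subspace.intro submodule.intro)
  show "vectorspace (class_ring :: complex ring) (cspace r0 r1 M)"
    by (rule V.vectorspace_axioms)
  show "module (class_ring :: complex ring) (cspace r0 r1 M)"
    by (rule V.module.module_axioms)
  show "?W \<subseteq> carrier (cspace r0 r1 M)" by (auto simp: weight_space_def)
  have W_iff: "\<phi> x \<in> ?W \<longleftrightarrow>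
    ev (gen U0 * gen T0) x = (\<lambda>j. \<alpha> * x j) \<and> ev (gen T1 * gen U1) x = (\<lambda>j. \<beta> * x j)"
    if "x \<in> coords n" for x
    using weight_space_iff[OF that] that by (simp add: ev_mult)
  have Wx: "\<exists>x\<in>coords n. v = \<phi> x" if "v \<in> ?W" for v
    using that \<phi>_surj by (auto simp: weight_space_def)
  show "v \<oplus>\<^bsub>cspace r0 r1 M\<^esub> u \<in> ?W" if vu: "v \<in> ?W" "u \<in> ?W" for v u
  proof -
    obtain x y where x: "x \<in> coords n" "v = \<phi> x" and y: "y \<in> coords n" "u = \<phi> y"
      using Wx vu by metis
    have "\<phi> (x + y) \<in> ?W"
      using vu W_iff[OF x(1)] W_iff[OF y(1)] x y
      by (subst W_iff) (auto simp: ev_plus fun_eq_iff algebra_simps)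
    then show ?thesis using x y by (simp add: \<phi>_add)
  qed
  have "\<phi> 0 \<in> ?W"
    unfolding W_iff[OF coords_zero] ev_zero by (auto simp: fun_eq_iff)
  then show "\<zero>\<^bsub>cspace r0 r1 M\<^esub> \<in> ?W"
    by (simp add: \<phi>_zero)
  show "c \<odot>\<^bsub>cspace r0 r1 M\<^esub> v \<in> ?W" if v: "v \<in> ?W" for c v
  proof -
    obtain x where x: "x \<in> coords n" "v = \<phi> x"
      using Wx v by metis
    have "\<phi> (\<lambda>j. c * x j) \<in> ?W"
      using v W_iff[OF x(1)] x
      by (subst W_iff) (auto simp: ev_scale)
    then show ?thesis using x by (simp add: \<phi>_scale)
  qed
qed

text \<open>Preserving the span of a set of basis vectors is a condition on the zero pattern of the
  matrix.\<close>

lemma preserves_iff: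
  assumes J: "J \<subseteq> {..<n}"
  shows "preserves r0 r1 M (quot_map r0 r1 a) ((\<lambda>j. \<phi> (e_vec j)) ` J) \<longleftrightarrow>
    (\<forall>k\<in>J. \<forall>i. i \<notin> J \<longrightarrow> ev a (e_vec k) i = 0)" (is "?L \<longleftrightarrow> ?R")
proof -
  let ?X = "{x. \<forall>j. j \<notin> J \<longrightarrow> x j = (0 :: complex)}"
  have X: "x \<in> coords n" if "x \<in> ?X" for x
    using that J by (auto simp: coords_def)
  have L: "?L \<longleftrightarrow> (\<forall>x\<in>?X. ev a x \<in> ?X)"
  proof -
    have "act a (\<phi> x) \<in> \<phi> ` ?X \<longleftrightarrow> ev a x \<in> ?X" if "x \<in> ?X" for x
    proof
      assume "act a (\<phi> x) \<in> \<phi> ` ?X"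
      then obtain y where y: "y \<in> ?X" "act a (\<phi> x) = \<phi> y" by blast
      then show "ev a x \<in> ?X" using ev_eqI[OF X[OF that] X[OF y(1)] y(2)] by simp
    next
      assume "ev a x \<in> ?X"
      then have "\<phi> (ev a x) \<in> \<phi> ` ?X" by (rule imageI)
      then show "act a (\<phi> x) \<in> \<phi> ` ?X" by (simp only: \<phi>_ev[OF X[OF that]])
    qed
    then show ?thesis
      unfolding preserves_def V.span_units[OF \<phi> J] by blast
  qed
  show ?thesis
  proof
    assume ?L
    moreover have "e_vec k \<in> ?X" if "k \<in> J" for k
      using that by (auto simp: e_vec_def)
    ultimately show ?R using L by blast
  next
    assume R: ?R
    have "ev a x i = 0" if "x \<in> ?X" "i \<notin> J" for x i
    proof -
      have "ev a x i = (\<Sum>k<n. x k * ev a (e_vec k) i)"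
        using linear_on_units[of n "ev a" x i] ev_plus ev_scale X[OF that(1)] by blast
      also have "\<dots> = 0"
      proof (rule sum.neutral, intro ballI)
        fix k show "x k * ev a (e_vec k) i = 0"
          using R that by (cases "k \<in> J") auto
      qed
      finally show ?thesis .
    qed
    then show ?L using L by blast
  qed
qed

lemma irreducible_iff:
  "irreducible_module (nil_daha r0 r1) M \<longleftrightarrow> irreducible_coords n (\<lambda>g. ev (gen g))"
proof
  assume irr: "irreducible_module (nil_daha r0 r1) M"
  show "irreducible_coords n (\<lambda>g. ev (gen g))"
    unfolding irreducible_coords_def
  proof (intro allI impI, elim conjE)
    fix W assume W: "W \<subseteq> coords n" "0 \<in> W" "\<forall>x\<in>W. \<forall>y\<in>W. x + y \<in> W"
      "\<forall>c. \<forall>x\<in>W. (\<lambda>j. c * x j) \<in> W" "\<forall>g. \<forall>x\<in>W. ev (gen g) x \<in> W"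
    have Wc: "x \<in> coords n" if "x \<in> W" for x using W that by blast
    have "left_submodule (nil_daha r0 r1) (\<phi> ` W) M"
      unfolding left_submodule_iff \<phi>_zero[symmetric] using W Wc
      by (auto simp: \<phi>_add[symmetric] \<phi>_ev[symmetric] ev_scal)
    then have "\<phi> ` W = {\<zero>\<^bsub>M\<^esub>} \<or> \<phi> ` W = carrier M"
      using irr unfolding irreducible_module_def by blast
    then show "W = {0} \<or> W = coords n"
    proof
      assume *: "\<phi> ` W = {\<zero>\<^bsub>M\<^esub>}"
      have "x = 0" if "x \<in> W" for x
      proof -
        have "\<phi> x = \<phi> 0" using * that \<phi>_zero by auto
        then show ?thesis using Wc[OF that] by simp
      qed
      then show ?thesis using W(2) by auto
    next
      assume *: "\<phi> ` W = carrier M"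
      have "x \<in> W" if x: "x \<in> coords n" for x
      proof -
        obtain y where "y \<in> W" "\<phi> x = \<phi> y" using * \<phi>_closed[OF x] by (metis imageE)
        then show ?thesis using x Wc by simp
      qed
      then show ?thesis using W(1) by blast
    qed
  qed
next
  assume irr: "irreducible_coords n (\<lambda>g. ev (gen g))"
  show "irreducible_module (nil_daha r0 r1) M"
    unfolding irreducible_module_def
  proof (intro notI, elim exE conjE)
    fix N assume N: "left_submodule (nil_daha r0 r1) N M" and ne: "N \<noteq> {\<zero>\<^bsub>M\<^esub>}" "N \<noteq> carrier M"
    note N' = N[unfolded left_submodule_iff]
    define W where "W = {x \<in> coords n. \<phi> x \<in> N}"
    have img: "\<phi> ` W = N"
      using N' \<phi>_surj unfolding W_def by blast
    have "W \<subseteq> coords n \<and> 0 \<in> W \<and> (\<forall>x\<in>W. \<forall>y\<in>W. x + y \<in> W) \<and>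
      (\<forall>c. \<forall>x\<in>W. (\<lambda>j. c * x j) \<in> W) \<and> (\<forall>g. \<forall>x\<in>W. ev (gen g) x \<in> W)"
      using N' by (auto simp: W_def \<phi>_add \<phi>_scale \<phi>_zero \<phi>_ev ev_closed)
    then have "W = {0} \<or> W = coords n"
      using irr unfolding irreducible_coords_def by blast
    then show False
    proof
      assume "W = {0}"
      then show False using img ne(1) \<phi>_zero by auto
    next
      assume "W = coords n"
      then show False using img ne(2) bij by (auto simp: bij_betw_def)
    qed
  qed
qed

end

lemma intertwining_coordinatized:
  assumes "daha_module r0 r1 M" and "intertwining n r0 r1 M \<tau> \<phi>"
  shows "coordinatized r0 r1 M n \<phi>"
  using assms by (simp add: coordinatized_def coordinatized_axioms_def intertwining_def)

lemma intertwining_ev: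
  assumes "daha_module r0 r1 M" and i: "intertwining n r0 r1 M \<tau> \<phi>" and x: "x \<in> coords n"
  shows "coordinatized.ev r0 r1 M n \<phi> (gen g) x = \<tau> g x"
proof -
  interpret coordinatized r0 r1 M n \<phi>
    by (rule intertwining_coordinatized[OF assms(1,2)])
  show ?thesis
    using i x by (intro ev_eqI) (auto simp: intertwining_def)
qed

text \<open>An adapted block basis of either parity, read from its right end, see \<open>std\<close>.  The relation to
  the two original notions is \<open>even_adapted_iff\<close> and \<open>odd_adapted_iff\<close>.\<close>

definition adapted_chain ::
  "complex \<Rightarrow> complex \<Rightarrow> nat \<Rightarrow> 'v daha_module \<Rightarrow> (nat \<Rightarrow> 'v) \<Rightarrow> seq \<Rightarrow> bool" where
  "adapted_chain r0 r1 n M w \<nu> \<longleftrightarrow>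
    inj_on w {..<n} \<and> vectorspace.basis class_ring (cspace r0 r1 M) (w ` {..<n}) \<and>
    (\<forall>j<n. \<nu> j \<noteq> 0 \<and>
      w j \<in> weight_space r0 r1 M (if even j then \<nu> j else 0) (if even j then 0 else \<nu> j)) \<and>
    preserves r0 r1 M (elt_t0 r0 r1) {w 0} \<and>
    preserves r0 r1 M (if even n then elt_t0 r0 r1 else elt_t1 r0 r1) {w (n - 1)} \<and>
    (\<forall>j. Suc j < n \<longrightarrow>
      preserves r0 r1 M (if even j then elt_t1 r0 r1 else elt_t0 r0 r1) {w j, w (Suc j)})"

definition std_module ::
  "complex \<Rightarrow> complex \<Rightarrow> nat \<Rightarrow> 'v daha_module \<Rightarrow> complex \<Rightarrow> seq \<Rightarrow> bool" where
  "std_module r0 r1 n M \<kappa> \<nu> \<longleftrightarrow> (\<exists>\<phi>. intertwining n r0 r1 M (std r0 r1 n \<kappa> \<nu>) \<phi>)"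

text \<open>In a multiplicity-free irreducible module an adapted chain is, after rescaling, a normal form
  basis with admissible parameters.  Irreducibility gives the shape of the blocks; multiplicity-freeness
  gives the distinctness of the weights, because two basis vectors of equal weight would be proportional.\<close>

lemma adapted_chain_std:
  fixes M :: "'v daha_module"
  assumes r: "r0 \<noteq> 0" "r1 \<noteq> 0" and n: "0 < n"
    and M: "mf_irreducible r0 r1 n M" and w: "adapted_chain r0 r1 n M w \<nu>"
  shows "\<exists>\<kappa>. (if even n then elt_t0 r0 r1 else elt_t1 r0 r1) \<odot>\<^bsub>M\<^esub> w (n - 1) =
      \<kappa> \<odot>\<^bsub>cspace r0 r1 M\<^esub> w (n - 1)"
    and "elt_t0 r0 r1 \<odot>\<^bsub>M\<^esub> w 0 = c \<odot>\<^bsub>cspace r0 r1 M\<^esub> w 0 \<longleftrightarrow> c = \<nu> 0"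
    and "(if even n then elt_t0 r0 r1 else elt_t1 r0 r1) \<odot>\<^bsub>M\<^esub> w (n - 1) =
      \<kappa> \<odot>\<^bsub>cspace r0 r1 M\<^esub> w (n - 1) \<Longrightarrow>
      std_rep r0 r1 n \<kappa> \<nu> \<and> std_module r0 r1 n M \<kappa> \<nu>"
proof -
  have dm: "daha_module r0 r1 M"
    using M by (simp add: mf_irreducible_def daha_module_def)
  interpret daha_module r0 r1 M by (rule dm)
  obtain \<phi> where \<phi>: "coordinates n (cspace r0 r1 M) \<phi>" and \<phi>w: "\<And>j. j < n \<Longrightarrow> \<phi> (e_vec j) = w j"
    using V.basis_coordinates[of w n] w by (auto simp: adapted_chain_def)
  interpret coordinatized r0 r1 M n \<phi>
    using dm \<phi> by (simp add: coordinatized_def coordinatized_axioms_def)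
  have pres: "preserves r0 r1 M (quot_map r0 r1 a) (w ` J) \<longleftrightarrow>
    (\<forall>k\<in>J. \<forall>i. i \<notin> J \<longrightarrow> ev a (e_vec k) i = 0)" if "J \<subseteq> {..<n}" for a J
  proof -
    have "w ` J = (\<lambda>j. \<phi> (e_vec j)) ` J"
      using that by (intro image_cong) (auto simp: \<phi>w)
    then show ?thesis using preserves_iff[OF that, of a] by simp
  qed
  define g where "g = (if even n then T0 else T1)"
  have elt_g: "(if even n then elt_t0 r0 r1 else elt_t1 r0 r1) = quot_map r0 r1 (gen g)"
    by (simp add: g_def elt_gen)
  have eig: "act (gen h) (w k) = act (scal c) (w k) \<longleftrightarrow> ev (gen h) (e_vec k) = (\<lambda>i. c * e_vec k i)"
    if "k < n" for h k c
    using \<phi>_eq[OF ev_closed[OF coords_e_vec[OF that]] coords_scale[OF coords_e_vec[OF that], of c], of "gen h"] that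
    by (simp add: \<phi>_ev \<phi>_scale \<phi>w)
  have "\<exists>\<kappa>. ev (gen g) (e_vec (n - 1)) = (\<lambda>i. \<kappa> * e_vec (n - 1) i)"
  proof
    have "preserves r0 r1 M (quot_map r0 r1 (gen g)) (w ` {n - 1})"
      using w by (simp add: adapted_chain_def elt_g)
    then have *: "ev (gen g) (e_vec (n - 1)) i = 0" if "i \<noteq> n - 1" for i
      using pres[of "{n - 1}"] n that by simp
    show "ev (gen g) (e_vec (n - 1)) = (\<lambda>i. ev (gen g) (e_vec (n - 1)) (n - 1) * e_vec (n - 1) i)"
    proof
      fix i show "ev (gen g) (e_vec (n - 1)) i = ev (gen g) (e_vec (n - 1)) (n - 1) * e_vec (n - 1) i"
        using *[of i] by (cases "i = n - 1") (auto simp: e_vec_def)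
    qed
  qed
  then obtain \<kappa>' where "ev (gen g) (e_vec (n - 1)) = (\<lambda>i. \<kappa>' * e_vec (n - 1) i)" by blast
  then have "act (gen g) (w (n - 1)) = act (scal \<kappa>') (w (n - 1))"
    using eig[of "n - 1" g \<kappa>'] n by simp
  then show ex: "\<exists>\<kappa>. (if even n then elt_t0 r0 r1 else elt_t1 r0 r1) \<odot>\<^bsub>M\<^esub> w (n - 1) =
      \<kappa> \<odot>\<^bsub>cspace r0 r1 M\<^esub> w (n - 1)"
    unfolding elt_g by auto
  have wt: "\<nu> j \<noteq> 0" "ev (gen U0) (ev (gen T0) (e_vec j)) = (\<lambda>i. (if even j then \<nu> j else 0) * e_vec j i)"
    "ev (gen T1) (ev (gen U1) (e_vec j)) = (\<lambda>i. (if even j then 0 else \<nu> j) * e_vec j i)" if "j < n" for j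
    using w that weight_space_iff[of "e_vec j"] by (auto simp: adapted_chain_def \<phi>w)
  have first: "ev (gen T0) (e_vec 0) i = 0" if "i \<noteq> 0" for i
  proof -
    have "preserves r0 r1 M (quot_map r0 r1 (gen T0)) (w ` {0})"
      using w by (simp add: adapted_chain_def elt_gen)
    then show ?thesis using pres[of "{0}"] n that by simp
  qed
  have w_link: "preserves r0 r1 M (if even j then elt_t1 r0 r1 else elt_t0 r0 r1) {w j, w (Suc j)}"
    if "Suc j < n" for j
    using w that unfolding adapted_chain_def by blast
  have link: "ev (gen (if even j then T1 else T0)) (e_vec k) i = 0"
    if "Suc j < n" "k = j \<or> k = Suc j" "i \<noteq> j" "i \<noteq> Suc j" for j k i
  proof -
    have "preserves r0 r1 M (quot_map r0 r1 (gen (if even j then T1 else T0))) (w ` {j, Suc j})"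
      using w_link[OF that(1)] by (cases "even j") (simp_all add: elt_gen)
    then show ?thesis
      using pres[of "{j, Suc j}" "gen (if even j then T1 else T0)"] that by (auto split: if_splits)
  qed
  have chain: "chain_rep r0 r1 n (\<lambda>g. ev (gen g)) \<nu> \<kappa>"
    if "ev (gen g) (e_vec (n - 1)) = (\<lambda>i. \<kappa> * e_vec (n - 1) i)" for \<kappa>
  proof (intro chain_rep.intro quadratic_operators.intro chain_rep_axioms.intro r n wt first link)
    show "irreducible_coords n (\<lambda>g. ev (gen g))"
      using M irreducible_iff by (simp add: mf_irreducible_def)
    show "ev (gen (if even n then T0 else T1)) (e_vec (n - 1)) = (\<lambda>i. \<kappa> * e_vec (n - 1) i)"
      using that by (simp only: g_def)
  qed (auto intro: ev_closed ev_plus ev_scale ev_idem ev_nil ev_quadratic[OF _ r(1)] ev_quadratic[OF _ r(2)]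
      simp: relators_def)
  show "elt_t0 r0 r1 \<odot>\<^bsub>M\<^esub> w 0 = c \<odot>\<^bsub>cspace r0 r1 M\<^esub> w 0 \<longleftrightarrow> c = \<nu> 0"
  proof -
    obtain \<kappa> where "ev (gen g) (e_vec (n - 1)) = (\<lambda>i. \<kappa> * e_vec (n - 1) i)"
      using ex eig[of "n - 1" g] n by (auto simp: elt_g)
    note T0 = chain_rep.T0_first[OF chain[OF this]]
    have "(\<lambda>i. \<nu> 0 * e_vec 0 i) = (\<lambda>i. c * e_vec 0 i) \<longleftrightarrow> c = \<nu> 0"
      by (auto simp: fun_eq_iff e_vec_def)
    then show ?thesis
      unfolding elt_gen cspace_simps eig[OF n] T0 .
  qed
  assume k: "(if even n then elt_t0 r0 r1 else elt_t1 r0 r1) \<odot>\<^bsub>M\<^esub> w (n - 1) =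
      \<kappa> \<odot>\<^bsub>cspace r0 r1 M\<^esub> w (n - 1)"
  have "n - 1 < n" using n by simp
  from k have "ev (gen g) (e_vec (n - 1)) = (\<lambda>i. \<kappa> * e_vec (n - 1) i)"
    unfolding elt_g cspace_simps eig[OF \<open>n - 1 < n\<close>] .
  from chain[OF this] interpret C: chain_rep r0 r1 n "\<lambda>g. ev (gen g)" \<nu> \<kappa> .
  have "\<nu> i \<noteq> \<nu> j" if ij: "i < n" "j < n" "even i = even j" "i \<noteq> j" for i j
  proof
    assume eq: "\<nu> i = \<nu> j"
    define \<alpha> where "\<alpha> = (if even i then \<nu> i else 0)"
    define \<beta> where "\<beta> = (if even i then 0 else \<nu> i)"
    let ?W = "weight_space r0 r1 M \<alpha> \<beta>"
    have "w i \<in> ?W"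
      using w ij(1) by (simp add: adapted_chain_def \<alpha>_def \<beta>_def)
    moreover have "w j \<in> weight_space r0 r1 M (if even j then \<nu> j else 0) (if even j then 0 else \<nu> j)"
      using w ij(2) by (simp add: adapted_chain_def)
    then have "w j \<in> ?W"
      unfolding \<alpha>_def \<beta>_def ij(3) eq .
    moreover have wi: "w i \<noteq> \<zero>\<^bsub>M\<^esub>"
    proof
      assume "w i = \<zero>\<^bsub>M\<^esub>"
      then have "\<phi> (e_vec i) = \<phi> 0" using \<phi>w ij(1) \<phi>_zero by simp
      then have "e_vec i = 0" using ij(1) by simp
      from fun_cong[OF this, of i] show False by simp
    qed
    ultimately have W: "w i \<in> ?W" "w j \<in> ?W" "?W \<noteq> {\<zero>\<^bsub>M\<^esub>}" by auto
    note sub = weight_space_subspace[of \<alpha> \<beta>]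
    interpret W: complex_space "cspace r0 r1 M\<lparr>carrier := ?W\<rparr>"
      by (intro complex_space.intro V.subspace_is_vs sub)
    have fd: "W.fin_dim"
      using V.fin_dim_subspace[OF _ sub] M by (simp add: mf_irreducible_def)
    have "W.dim = 1"
      using M W(3) by (simp add: mf_irreducible_def multiplicity_free_def)
    then obtain c where "w j = act (scal c) (w i)"
      using W.dim_one_collinear[OF fd, of "w j" "w i"] W wi by auto
    then have "\<phi> (e_vec j) = \<phi> (\<lambda>t. c * e_vec i t)"
      using \<phi>w ij by (simp add: \<phi>_scale)
    then have "e_vec j = (\<lambda>t. c * e_vec i t)"
      using ij by simp
    from fun_cong[OF this, of j] show False
      using ij(4) by (simp add: e_vec_def)
  qed
  then have adm: "admissible r0 r1 n \<kappa> \<nu>"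
    by (rule C.admissible)
  \<comment> \<open>Composing \<open>\<phi>\<close> with the diagonal rescaling gives the coordinates of the normal form.\<close>
  define D where "D x = (\<lambda>j. C.rescaling j * x j)" for x :: seq
  have Dc: "D x \<in> coords n" if "x \<in> coords n" for x
    using that by (simp add: D_def coords_def)
  have "bij_betw D (coords n) (coords n)"
  proof (rule bij_betwI[where g = "\<lambda>x j. inverse (C.rescaling j) * x j"])
    show "D \<in> coords n \<rightarrow> coords n" using Dc by blast
    show "(\<lambda>x j. inverse (C.rescaling j) * x j) \<in> coords n \<rightarrow> coords n" by (auto simp: coords_def)
    show "(\<lambda>j. inverse (C.rescaling j) * D x j) = x" if "x \<in> coords n" for x
    proof
      fix j show "inverse (C.rescaling j) * D x j = x j"
        using that C.rescaling_nonzero[of j] by (cases "j < n") (auto simp: D_def coords_def)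
    qed
    show "D (\<lambda>j. inverse (C.rescaling j) * y j) = y" if "y \<in> coords n" for y
    proof
      fix j show "D (\<lambda>j. inverse (C.rescaling j) * y j) j = y j"
        using that C.rescaling_nonzero[of j] by (cases "j < n") (auto simp: D_def coords_def)
    qed
  qed
  then have "bij_betw (\<lambda>x. \<phi> (D x)) (coords n) (carrier M)"
    using bij_betw_trans[OF _ bij, of D] by (simp add: comp_def)
  moreover have "\<phi> (D (x + y)) = \<phi> (D x) \<oplus>\<^bsub>M\<^esub> \<phi> (D y)" if "x \<in> coords n" "y \<in> coords n" for x y
  proof -
    have "D (x + y) = D x + D y" by (auto simp: D_def fun_eq_iff algebra_simps)
    then show ?thesis using \<phi>_add[OF Dc Dc] that by simp
  qed
  moreover have "\<phi> (D (\<lambda>j. c * x j)) = act (scal c) (\<phi> (D x))" if "x \<in> coords n" for c x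
  proof -
    have "D (\<lambda>j. c * x j) = (\<lambda>j. c * D x j)" by (auto simp: D_def fun_eq_iff algebra_simps)
    then show ?thesis using \<phi>_scale[OF Dc] that by simp
  qed
  moreover have "act (gen g) (\<phi> (D x)) = \<phi> (D (std r0 r1 n \<kappa> \<nu> g x))" if x: "x \<in> coords n" for g x
  proof -
    have "ev (gen g) (D x) = D (std r0 r1 n \<kappa> \<nu> g x)"
      unfolding D_def by (rule C.conjugate[OF x])
    then show ?thesis using \<phi>_ev[OF Dc[OF x], of "gen g"] by simp
  qed
  ultimately have "intertwining n r0 r1 M (std r0 r1 n \<kappa> \<nu>) (\<lambda>x. \<phi> (D x))"
    by (simp add: intertwining_def coordinates_def std_closed del: std.simps)
  then show "std_rep r0 r1 n \<kappa> \<nu> \<and> std_module r0 r1 n M \<kappa> \<nu>"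
    unfolding std_module_def using adm r by (auto simp: std_rep_def simp del: std.simps)
qed

section \<open>Modules in normal form\<close>

lemma irreducible_coords_cong:
  assumes irr: "irreducible_coords n \<sigma>" and eq: "\<And>g x. x \<in> coords n \<Longrightarrow> \<tau> g x = \<sigma> g x"
  shows "irreducible_coords n \<tau>"
  unfolding irreducible_coords_def
proof (intro allI impI, elim conjE)
  fix W assume W: "W \<subseteq> coords n" "0 \<in> W" "\<forall>x\<in>W. \<forall>y\<in>W. x + y \<in> W"
    "\<forall>c. \<forall>x\<in>W. (\<lambda>j. c * x j) \<in> W" and inv: "\<forall>g. \<forall>x\<in>W. \<tau> g x \<in> W"
  have "\<sigma> g x \<in> W" if "x \<in> W" for g x
  proof -
    have "\<tau> g x \<in> W" using inv that by blast
    then show ?thesis using eq[of x g] W(1) that by auto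
  qed
  then have inv': "\<forall>g. \<forall>x\<in>W. \<sigma> g x \<in> W" by simp
  show "W = {0} \<or> W = coords n"
    by (rule irr[unfolded irreducible_coords_def, rule_format, OF conjI[OF W(1) conjI[OF W(2)
      conjI[OF W(3) conjI[OF W(4) inv']]]]])
qed

text \<open>Conversely, a module in normal form has all the properties demanded, and its normal form
  basis is an adapted chain.  The joint weights of the basis are distinct, which makes all weight spaces
  at most one-dimensional.\<close>

lemma std_module_mf_irreducible:
  fixes M :: "'v daha_module"
  assumes p: "std_rep r0 r1 n \<kappa> \<nu>" and n: "0 < n"
    and dm: "daha_module r0 r1 M" and std: "std_module r0 r1 n M \<kappa> \<nu>"
  shows "mf_irreducible r0 r1 n M"
    and "\<exists>w. adapted_chain r0 r1 n M w \<nu> \<and>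
      elt_t0 r0 r1 \<odot>\<^bsub>M\<^esub> w 0 = \<nu> 0 \<odot>\<^bsub>cspace r0 r1 M\<^esub> w 0 \<and>
      (if even n then elt_t0 r0 r1 else elt_t1 r0 r1) \<odot>\<^bsub>M\<^esub> w (n - 1) =
        \<kappa> \<odot>\<^bsub>cspace r0 r1 M\<^esub> w (n - 1)"
proof -
  obtain \<phi> where i: "intertwining n r0 r1 M (std r0 r1 n \<kappa> \<nu>) \<phi>"
    using std by (auto simp: std_module_def)
  interpret std_rep r0 r1 n \<kappa> \<nu> by (rule p)
  interpret coordinatized r0 r1 M n \<phi> by (rule intertwining_coordinatized[OF dm i])
  note ev = intertwining_ev[OF dm i]
  have A: "ev (gen U0) (ev (gen T0) x) = (\<lambda>j. if even j then \<nu> j * x j else 0)" if "x \<in> coords n" for x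
    unfolding ev[OF that] ev[OF std_closed] by (rule std_A[OF that])
  have B: "ev (gen T1) (ev (gen U1) x) = (\<lambda>j. if odd j then \<nu> j * x j else 0)" if "x \<in> coords n" for x
    unfolding ev[OF that] ev[OF std_closed] by (rule std_B[OF that])
  have wt: "\<phi> (e_vec j) \<in> weight_space r0 r1 M (if even j then \<nu> j else 0) (if even j then 0 else \<nu> j)"
    if "j < n" for j
    unfolding weight_space_iff[OF coords_e_vec[OF that]] A[OF coords_e_vec[OF that]] B[OF coords_e_vec[OF that]]
    by (auto simp: e_vec_def)
  let ?at = "\<lambda>\<alpha> \<beta> j. \<alpha> = (if even j then \<nu> j else 0) \<and> \<beta> = (if even j then 0 else \<nu> j)"
  have W: "weight_space r0 r1 M \<alpha> \<beta> = \<phi> ` {x \<in> coords n. \<forall>j. x j \<noteq> 0 \<longrightarrow> ?at \<alpha> \<beta> j}" for \<alpha> \<beta>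
  proof (intro equalityI subsetI)
    fix v assume v: "v \<in> weight_space r0 r1 M \<alpha> \<beta>"
    then obtain x where x: "x \<in> coords n" "v = \<phi> x"
      using \<phi>_surj by (auto simp: weight_space_def)
    then have "(if even j then \<nu> j * x j else 0) = \<alpha> * x j" "(if odd j then \<nu> j * x j else 0) = \<beta> * x j" for j
      using v weight_space_iff[OF x(1)] A[OF x(1)] B[OF x(1)] by (auto simp: fun_eq_iff)
    then have "?at \<alpha> \<beta> j" if "x j \<noteq> 0" for j
      using that by (metis mult_cancel_right mult_zero_left)
    then show "v \<in> \<phi> ` {x \<in> coords n. \<forall>j. x j \<noteq> 0 \<longrightarrow> ?at \<alpha> \<beta> j}"
      using x by blast
  next
    fix v assume "v \<in> \<phi> ` {x \<in> coords n. \<forall>j. x j \<noteq> 0 \<longrightarrow> ?at \<alpha> \<beta> j}"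
    then obtain x where x: "x \<in> coords n" "v = \<phi> x"
      and s: "\<And>j. x j \<noteq> 0 \<Longrightarrow> ?at \<alpha> \<beta> j"
      by auto
    have "(if even j then \<nu> j * x j else 0) = \<alpha> * x j" "(if odd j then \<nu> j * x j else 0) = \<beta> * x j" for j
      using s[of j] by (cases "x j = 0"; auto)+
    then show "v \<in> weight_space r0 r1 M \<alpha> \<beta>"
      unfolding x(2) weight_space_iff[OF x(1)] A[OF x(1)] B[OF x(1)] by auto
  qed
  have basis: "V.basis ((\<lambda>j. \<phi> (e_vec j)) ` {..<n})"
    by (rule V.units_basis[OF \<phi>])
  have "multiplicity_free r0 r1 M"
    unfolding multiplicity_free_def
  proof (intro conjI allI impI)
    show "acts_diagonalizably r0 r1 M (elt_A r0 r1)"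
      unfolding acts_diagonalizably_def using wt
      by (intro exI[of _ "(\<lambda>j. \<phi> (e_vec j)) ` {..<n}"] conjI basis) (auto simp: weight_space_def)
    show "acts_diagonalizably r0 r1 M (elt_B r0 r1)"
      unfolding acts_diagonalizably_def using wt
      by (intro exI[of _ "(\<lambda>j. \<phi> (e_vec j)) ` {..<n}"] conjI basis) (auto simp: weight_space_def)
    fix \<alpha> \<beta> assume ne: "weight_space r0 r1 M \<alpha> \<beta> \<noteq> {\<zero>\<^bsub>M\<^esub>}"
    let ?W = "weight_space r0 r1 M \<alpha> \<beta>"
    have "\<zero>\<^bsub>M\<^esub> \<in> ?W"
      using submodule.zero_closed[OF V.is_module[OF weight_space_subspace]] by simp
    then obtain v where "v \<in> ?W" "v \<noteq> \<zero>\<^bsub>M\<^esub>"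
      using ne by blast
    then obtain x where x: "x \<in> coords n" "\<phi> x \<noteq> \<zero>\<^bsub>M\<^esub>"
      "\<And>j. x j \<noteq> 0 \<Longrightarrow> ?at \<alpha> \<beta> j"
      unfolding W by blast
    have "x \<noteq> 0" using x(2) \<phi>_zero by auto
    then obtain k where "x k \<noteq> 0" by (auto simp: fun_eq_iff)
    with x(1,3) have k: "k < n" "\<alpha> = (if even k then \<nu> k else 0)" "\<beta> = (if even k then 0 else \<nu> k)"
      by (auto simp: coords_def not_less[symmetric])
    \<comment> \<open>The joint weight determines the position, so the weight space is the line of one unit vector.\<close>
    have only: "j = k" if "j < n" "\<alpha> = (if even j then \<nu> j else 0)" "\<beta> = (if even j then 0 else \<nu> j)" for j
      using that k nz[of j] nz[of k] adm unfolding admissible_def by (metis (no_types, lifting))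
    have \<phi>k: "\<phi> (\<lambda>j. y 0 * e_vec k j) \<in> ?W" for y
      unfolding W using k by (intro imageI) (auto simp: coords_def e_vec_def)
    have "coordinates 1 (cspace r0 r1 M\<lparr>carrier := ?W\<rparr>) (\<lambda>y. \<phi> (\<lambda>j. y 0 * e_vec k j))"
      unfolding coordinates_def
    proof (intro conjI ballI allI)
      show "bij_betw (\<lambda>y. \<phi> (\<lambda>j. y 0 * e_vec k j)) (coords 1)
          (carrier (cspace r0 r1 M\<lparr>carrier := ?W\<rparr>))"
      proof (rule bij_betwI')
        fix y z :: seq assume y: "y \<in> coords 1" and z: "z \<in> coords 1"
        have "\<phi> (\<lambda>j. y 0 * e_vec k j) = \<phi> (\<lambda>j. z 0 * e_vec k j) \<longleftrightarrow>
            (\<lambda>j. y 0 * e_vec k j) = (\<lambda>j. z 0 * e_vec k j)"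
          using k(1) by (intro \<phi>_eq) simp_all
        also have "\<dots> \<longleftrightarrow> y 0 = z 0"
          by (auto simp: fun_eq_iff e_vec_def)
        also have "\<dots> \<longleftrightarrow> y = z"
        proof
          assume "y 0 = z 0"
          show "y = z"
          proof
            fix j show "y j = z j"
              using y z \<open>y 0 = z 0\<close> by (cases j) (auto simp: coords_def)
          qed
        qed simp
        finally show "\<phi> (\<lambda>j. y 0 * e_vec k j) = \<phi> (\<lambda>j. z 0 * e_vec k j) \<longleftrightarrow> y = z" .
      next
        fix y :: seq
        show "\<phi> (\<lambda>j. y 0 * e_vec k j) \<in> carrier (cspace r0 r1 M\<lparr>carrier := ?W\<rparr>)"
          using \<phi>k by simp
      next
        fix v assume "v \<in> carrier (cspace r0 r1 M\<lparr>carrier := ?W\<rparr>)"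
        then obtain z where z: "z \<in> coords n" "v = \<phi> z"
          "\<And>j. z j \<noteq> 0 \<Longrightarrow> ?at \<alpha> \<beta> j"
          unfolding W by auto
        have "z j = 0" if "j \<noteq> k" for j
          using only[of j] z that by (auto simp: coords_def not_less[symmetric])
        then have "z = (\<lambda>j. z k * e_vec k j)"
          by (auto simp: e_vec_def)
        then have "v = \<phi> (\<lambda>j. (\<lambda>i. if i = 0 then z k else 0) 0 * e_vec k j)"
          using z(2) by simp
        then show "\<exists>y\<in>coords 1. v = \<phi> (\<lambda>j. y 0 * e_vec k j)"
          by (intro bexI[of _ "\<lambda>i. if i = 0 then z k else 0"]) (simp_all add: coords_def)
      qed
      fix x y :: seq
      show "\<phi> (\<lambda>j. (x + y) 0 * e_vec k j) =
          \<phi> (\<lambda>j. x 0 * e_vec k j) \<oplus>\<^bsub>cspace r0 r1 M\<lparr>carrier := ?W\<rparr>\<^esub> \<phi> (\<lambda>j. y 0 * e_vec k j)"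
        using \<phi>_add[of "\<lambda>j. x 0 * e_vec k j" "\<lambda>j. y 0 * e_vec k j"] k(1)
        by (simp add: plus_fun_def distrib_right)
      fix c
      show "\<phi> (\<lambda>j. c * x 0 * e_vec k j) =
          c \<odot>\<^bsub>cspace r0 r1 M\<lparr>carrier := ?W\<rparr>\<^esub> \<phi> (\<lambda>j. x 0 * e_vec k j)"
        using \<phi>_scale[of "\<lambda>j. x 0 * e_vec k j" c] k(1) by (simp add: mult.assoc)
    qed
    moreover have "complex_space (cspace r0 r1 M\<lparr>carrier := ?W\<rparr>)"
      by (intro complex_space.intro V.subspace_is_vs weight_space_subspace)
    ultimately show "vectorspace.dim class_ring (cspace r0 r1 M\<lparr>carrier := ?W\<rparr>) = 1"
      using complex_space.coordinates_dim(2) by blast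
  qed
  moreover have "irreducible_module (nil_daha r0 r1) M"
    unfolding irreducible_iff by (rule irreducible_coords_cong[OF std_irreducible ev])
  ultimately show "mf_irreducible r0 r1 n M"
    using V.coordinates_dim[OF \<phi>] left_module_axioms by (simp add: mf_irreducible_def)
  let ?w = "\<lambda>j. \<phi> (e_vec j)"
  have T0: "act (gen T0) (?w 0) = act (scal (\<nu> 0)) (?w 0)"
    using \<phi>_ev[OF coords_e_vec[OF n], of "gen T0"] ev[OF coords_e_vec[OF n], of T0] n
    by (simp add: std_T0_first \<phi>_scale del: std.simps)
  have n1: "n - 1 < n" using n by simp
  have endw: "act (gen (if even n then T0 else T1)) (?w (n - 1)) = act (scal \<kappa>) (?w (n - 1))"
    unfolding \<phi>_ev[OF coords_e_vec[OF n1], symmetric] ev[OF coords_e_vec[OF n1]] std_end[OF n]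
    by (simp only: ev_scal[OF coords_e_vec[OF n1]])
  have pres: "preserves r0 r1 M (quot_map r0 r1 (gen g)) (?w ` J) \<longleftrightarrow>
      (\<forall>k\<in>J. \<forall>i. i \<notin> J \<longrightarrow> S g (e_vec k) i = 0)" if "J \<subseteq> {..<n}" for g J
    using preserves_iff[OF that, of "gen g"] ev coords_e_vec that by (auto simp del: std.simps simp: subset_iff)
  have "adapted_chain r0 r1 n M ?w \<nu>"
    unfolding adapted_chain_def
  proof (intro conjI allI impI)
    show "inj_on ?w {..<n}" by (rule V.coordinates_inj_unit[OF \<phi>])
    show "V.basis (?w ` {..<n})" by (rule basis)
    show "\<nu> j \<noteq> 0" if "j < n" for j using nz that .
    show "?w j \<in> weight_space r0 r1 M (if even j then \<nu> j else 0) (if even j then 0 else \<nu> j)" if "j < n" for j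
      using wt[OF that] .
    show "preserves r0 r1 M (elt_t0 r0 r1) {?w 0}"
      using pres[of "{0}" T0] n by (simp add: elt_gen std_T0_first e_vec_other del: std.simps)
    define h where "h = (if even n then T0 else T1)"
    have "S h (e_vec (n - 1)) = (\<lambda>i. \<kappa> * e_vec (n - 1) i)"
      unfolding h_def by (rule std_end[OF n])
    then have "preserves r0 r1 M (quot_map r0 r1 (gen h)) {?w (n - 1)}"
      using pres[of "{n - 1}" h] n1 by (simp del: std.simps One_nat_def add: e_vec_other)
    then show "preserves r0 r1 M (if even n then elt_t0 r0 r1 else elt_t1 r0 r1) {?w (n - 1)}"
      by (cases "even n") (simp_all add: elt_gen h_def)
    fix j assume j: "Suc j < n"
    show "preserves r0 r1 M (if even j then elt_t1 r0 r1 else elt_t0 r0 r1) {?w j, ?w (Suc j)}"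
    proof (cases "even j")
      case True
      then have "odd (Suc j)" by simp
      show ?thesis
        using pres[of "{j, Suc j}" T1] True j std_T1_even[OF True j] std_T1_odd[OF \<open>odd (Suc j)\<close> j]
        by (simp add: elt_gen e_vec_other del: std.simps)
    next
      case False
      show ?thesis
        using pres[of "{j, Suc j}" T0] False j std_T0_even[OF False j] std_T0_odd[OF False j]
        by (simp add: elt_gen e_vec_other del: std.simps)
    qed
  qed
  then show "\<exists>w. adapted_chain r0 r1 n M w \<nu> \<and>
      elt_t0 r0 r1 \<odot>\<^bsub>M\<^esub> w 0 = \<nu> 0 \<odot>\<^bsub>cspace r0 r1 M\<^esub> w 0 \<and>
      (if even n then elt_t0 r0 r1 else elt_t1 r0 r1) \<odot>\<^bsub>M\<^esub> w (n - 1) =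
        \<kappa> \<odot>\<^bsub>cspace r0 r1 M\<^esub> w (n - 1)"
    using T0 endw by (intro exI[of _ ?w]) (auto simp: elt_gen)
qed

lemma std_module_unique:
  fixes M :: "'v daha_module"
  assumes p: "std_rep r0 r1 n \<kappa> \<nu>" and p': "std_rep r0 r1 n \<kappa>' \<nu>'" and n: "0 < n"
    and dm: "daha_module r0 r1 M"
    and std: "std_module r0 r1 n M \<kappa> \<nu>" and std': "std_module r0 r1 n M \<kappa>' \<nu>'"
  shows "\<kappa> = \<kappa>' \<and> (\<forall>j<n. \<nu> j = \<nu>' j)"
proof -
  obtain \<phi> \<psi> where i: "intertwining n r0 r1 M (std r0 r1 n \<kappa> \<nu>) \<phi>"
    and i': "intertwining n r0 r1 M (std r0 r1 n \<kappa>' \<nu>') \<psi>"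
    using std std' by (auto simp: std_module_def)
  interpret P: coordinatized r0 r1 M n \<phi> by (rule intertwining_coordinatized[OF dm i])
  interpret Q: coordinatized r0 r1 M n \<psi> by (rule intertwining_coordinatized[OF dm i'])
  define \<theta> where "\<theta> x = inv_into (coords n) \<psi> (\<phi> x)" for x
  have bij: "bij_betw \<theta> (coords n) (coords n)"
    using bij_betw_trans[OF P.bij bij_betw_inv_into[OF Q.bij]] by (simp add: \<theta>_def[abs_def] comp_def)
  have cl: "\<theta> x \<in> coords n" if "x \<in> coords n" for x
    using bij that by (auto simp: bij_betw_def)
  have \<psi>\<theta>: "\<psi> (\<theta> x) = \<phi> x" if "x \<in> coords n" for x
    unfolding \<theta>_def using Q.bij P.\<phi>_closed[OF that] by (metis bij_betw_def f_inv_into_f)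
  have eqI: "\<theta> x = y" if "x \<in> coords n" "y \<in> coords n" "\<phi> x = \<psi> y" for x y
    using \<psi>\<theta>[OF that(1)] that(3) Q.\<phi>_eq[OF cl[OF that(1)] that(2)] by simp
  have 1: "\<theta> (x + y) = \<theta> x + \<theta> y" if "x \<in> coords n" "y \<in> coords n" for x y
    using that by (intro eqI) (simp_all add: cl P.\<phi>_add Q.\<phi>_add \<psi>\<theta>)
  have 2: "\<theta> (\<lambda>j. c * x j) = (\<lambda>j. c * \<theta> x j)" if "x \<in> coords n" for c x
    using that by (intro eqI) (simp_all add: cl P.\<phi>_scale Q.\<phi>_scale \<psi>\<theta>)
  have 3: "\<theta> (std r0 r1 n \<kappa> \<nu> g x) = std r0 r1 n \<kappa>' \<nu>' g (\<theta> x)" if x: "x \<in> coords n" for g x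
  proof (rule eqI[OF std_closed std_closed])
    show "\<phi> (std r0 r1 n \<kappa> \<nu> g x) = \<psi> (std r0 r1 n \<kappa>' \<nu>' g (\<theta> x))"
      using i i' x cl[OF x] \<psi>\<theta>[OF x] by (simp add: intertwining_def del: std.simps) metis
  qed
  show ?thesis
    using std_parameters_unique[OF p p' n bij 1 2 3] by blast
qed

section \<open>Existence of the modules\<close>

text \<open>An injective pairing on \<open>'a\<close> injects the lists of each fixed length into \<open>'a\<close>, since there is no
  need to recover the length.  For \<open>'a\<close> the complex numbers this embeds each coordinate space into the
  complex numbers, and so into \<open>'v\<close>.\<close>

fun encode_list :: "('a \<times> 'a \<Rightarrow> 'a) \<Rightarrow> 'a \<Rightarrow> 'a list \<Rightarrow> 'a" where
  "encode_list p z [] = z"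
| "encode_list p z (x # xs) = p (x, encode_list p z xs)"

lemma encode_list_inject:
  assumes "inj p" and "length xs = length ys" and "encode_list p z xs = encode_list p z ys"
  shows "xs = ys"
  using assms(2,3) by (induction xs ys rule: list_induct2) (auto dest: injD[OF assms(1)])

lemma ex_coords_embedding:
  assumes "\<exists>emb :: complex \<Rightarrow> 'v. inj emb"
  shows "\<exists>e :: seq \<Rightarrow> 'v. inj_on e (coords n)"
proof -
  obtain emb :: "complex \<Rightarrow> 'v" where emb: "inj emb"
    using assms by blast
  have "infinite (UNIV :: complex set)"
    by (rule infinite_UNIV_char_0)
  from card_of_Times_same_infinite[OF this]
  obtain p :: "complex \<times> complex \<Rightarrow> complex" where "bij_betw p (UNIV \<times> UNIV) UNIV"
    unfolding card_of_ordIso[symmetric] by blast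
  then have p: "inj p" by (simp add: bij_betw_def)
  have "inj_on (\<lambda>x. emb (encode_list p 0 (map x [0..<n]))) (coords n)"
  proof (rule inj_onI)
    fix x y assume x: "x \<in> coords n" and y: "y \<in> coords n"
      and "emb (encode_list p 0 (map x [0..<n])) = emb (encode_list p 0 (map y [0..<n]))"
    then have "map x [0..<n] = map y [0..<n]"
      using emb by (intro encode_list_inject[OF p]) (auto dest: injD)
    then have "x j = y j" if "j < n" for j
      using that by simp
    then show "x = y"
      using x y by (auto simp: coords_def fun_eq_iff not_le[symmetric]) (metis not_le)
  qed
  then show ?thesis by blast
qed

text \<open>The relations \<open>AB = 0 = BA\<close> complete the list of defining relations, so the operators extend to an
  action of the free algebra, which annihilates the ideal of relations.\<close>

locale operator_rep = quadratic_operators +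
  assumes AB: "\<And>x. x \<in> coords n \<Longrightarrow> \<tau> U0 (\<tau> T0 (\<tau> T1 (\<tau> U1 x))) = 0"
    and BA: "\<And>x. x \<in> coords n \<Longrightarrow> \<tau> T1 (\<tau> U1 (\<tau> U0 (\<tau> T0 x))) = 0"
begin

definition alg_act :: "free_alg \<Rightarrow> seq \<Rightarrow> seq" where
  "alg_act a x = (\<lambda>i. \<Sum>w\<in>Poly_Mapping.keys a. Poly_Mapping.lookup a w * foldr \<tau> (letters w) x i)"

lemma word_closed: "x \<in> coords n \<Longrightarrow> foldr \<tau> l x \<in> coords n"
  by (induction l) (auto intro: closed)

lemma word_add: "x \<in> coords n \<Longrightarrow> y \<in> coords n \<Longrightarrow> foldr \<tau> l (x + y) = foldr \<tau> l x + foldr \<tau> l y"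
  by (induction l) (simp_all only: foldr.simps o_apply id_apply op_add word_closed)

lemma word_scale: "x \<in> coords n \<Longrightarrow> foldr \<tau> l (\<lambda>j. c * x j) = (\<lambda>j. c * foldr \<tau> l x j)"
  by (induction l) (simp_all add: scale word_closed)

lemma alg_act_superset:
  assumes "finite K" and "Poly_Mapping.keys a \<subseteq> K"
  shows "alg_act a x i = (\<Sum>w\<in>K. Poly_Mapping.lookup a w * foldr \<tau> (letters w) x i)"
  unfolding alg_act_def by (rule sum.mono_neutral_left) (use assms in \<open>auto simp: in_keys_iff\<close>)

lemma alg_act_add: "alg_act (a + b) x = alg_act a x + alg_act b x"
proof
  fix i
  let ?K = "Poly_Mapping.keys a \<union> Poly_Mapping.keys b"
  have K: "finite ?K" "Poly_Mapping.keys (a + b) \<subseteq> ?K"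
    by (auto simp: keys_add)
  have "alg_act (a + b) x i = (\<Sum>w\<in>?K. Poly_Mapping.lookup (a + b) w * foldr \<tau> (letters w) x i)"
    by (rule alg_act_superset[OF K])
  also have "\<dots> = alg_act a x i + alg_act b x i"
    unfolding alg_act_superset[OF K(1) Un_upper1] alg_act_superset[OF K(1) Un_upper2]
    by (simp add: lookup_add distrib_right sum.distrib)
  finally show "alg_act (a + b) x i = (alg_act a x + alg_act b x) i" by simp
qed

lemma alg_act_single: "alg_act (Poly_Mapping.single w c) x = (\<lambda>i. c * foldr \<tau> (letters w) x i)"
  by (auto simp: alg_act_def fun_eq_iff)

lemma alg_act_closed: "x \<in> coords n \<Longrightarrow> alg_act a x \<in> coords n"
proof (induction a rule: free_alg_single_induct)
  case (single w c)
  then show ?case unfolding alg_act_single by (intro coords_scale word_closed)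
next
  case (add a b)
  then show ?case unfolding alg_act_add by (intro coords_add)
qed

lemma alg_act_plus:
  assumes "x \<in> coords n" "y \<in> coords n"
  shows "alg_act a (x + y) = alg_act a x + alg_act a y"
proof (induction a rule: free_alg_single_induct)
  case (single w c)
  show ?case
    unfolding alg_act_single word_add[OF assms] by (simp add: fun_eq_iff distrib_left)
qed (simp add: alg_act_add fun_eq_iff)

lemma alg_act_gen: "alg_act (gen g) x = \<tau> g x"
  by (simp add: gen_def alg_act_single)

lemma alg_act_scal: "alg_act (scal c) x = (\<lambda>i. c * x i)"
  by (simp add: scal_def alg_act_single zero_word_def)

lemma alg_act_scale: "x \<in> coords n \<Longrightarrow> alg_act a (\<lambda>j. c * x j) = (\<lambda>j. c * alg_act a x j)"
proof (induction a rule: free_alg_single_induct)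
  case (single w d)
  then show ?case unfolding alg_act_single by (simp add: word_scale mult.left_commute)
qed (simp add: alg_act_add fun_eq_iff distrib_left)

text \<open>The first factor is treated by induction over scalars, generators, sums and products; for a
  scalar or a generator the second factor may be taken to be a multiple of a single word.\<close>

lemma alg_act_mult: "x \<in> coords n \<Longrightarrow> alg_act (a * b) x = alg_act a (alg_act b x)"
proof (induction a arbitrary: b x rule: free_alg_induct)
  case (scal c)
  then show ?case
  proof (induction b rule: free_alg_single_induct)
    case (single w d)
    show ?case
      unfolding alg_act_scal by (simp add: scal_def mult_single alg_act_single mult.assoc)
  next
    case (add b b')
    then show ?case by (simp add: distrib_left alg_act_add alg_act_scal fun_eq_iff)
  qed
next
  case (gen g)
  then show ?case
  proof (induction b rule: free_alg_single_induct)
    case (single w d)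
    have "gen g * Poly_Mapping.single w d = Poly_Mapping.single (Word (g # letters w)) d"
      by (cases w) (simp add: gen_def mult_single plus_word_def)
    then show ?case
      unfolding alg_act_gen alg_act_single using single by (simp add: alg_act_single scale word_closed)
  next
    case (add b b')
    then show ?case
      by (simp only: distrib_left alg_act_add alg_act_gen op_add alg_act_closed)
  qed
next
  case (add a a')
  then show ?case by (simp add: distrib_right alg_act_add)
next
  case (mult a a')
  then show ?case by (simp add: mult.assoc alg_act_closed)
qed

lemma alg_act_zero: "alg_act 0 x = 0"
  by (simp add: alg_act_def fun_eq_iff)

lemma alg_act_minus: "alg_act (- a) x j = - alg_act a x j"
  using fun_cong[OF alg_act_add[of "- a" a x], of j]
  by (simp add: alg_act_zero eq_neg_iff_add_eq_0)

lemma alg_act_diff: "alg_act (a - b) x j = alg_act a x j - alg_act b x j"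
  using fun_cong[OF alg_act_add[of "a - b" b x], of j] by simp

definition annihilator :: "free_alg set" where
  "annihilator = {a. \<forall>x\<in>coords n. alg_act a x = 0}"

lemma alg_act_at_zero: "alg_act a 0 = 0"
  by (rule linear_zero[OF alg_act_scale])

lemma annihilator_ideal: "ideal annihilator class_ring"
proof (rule idealI)
  show "ring (class_ring :: free_alg ring)" by (rule class_ring.ring_axioms)
  have inv: "- a \<in> annihilator" if "a \<in> annihilator" for a
    using that by (auto simp: annihilator_def fun_eq_iff alg_act_minus)
  show "subgroup annihilator (add_monoid (class_ring :: free_alg ring))"
  proof (rule group.subgroupI)
    show "Group.group (add_monoid (class_ring :: free_alg ring))"
      using class_ring.ring_axioms ring_def abelian_group.a_group by blast
    show "annihilator \<noteq> {}"
      using alg_act_zero by (auto simp: annihilator_def)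
    show "inv\<^bsub>add_monoid class_ring\<^esub> a \<in> annihilator" if "a \<in> annihilator" for a
    proof -
      have "inv\<^bsub>add_monoid (class_ring :: free_alg ring)\<^esub> a = - a"
        unfolding a_inv_def[symmetric] by (simp only: class_ring_simps)
      then show ?thesis using inv[OF that] by simp
    qed
  qed (auto simp: annihilator_def alg_act_add)
qed (auto simp: annihilator_def alg_act_mult alg_act_closed alg_act_at_zero)

lemma quadratic_relator:
  assumes "\<And>x j. x \<in> coords n \<Longrightarrow> \<tau> g (\<tau> g x) j = (r + inverse r) * \<tau> g x j - x j" and "r \<noteq> 0"
  shows "(gen g - scal r) * (gen g - scal (inverse r)) \<in> annihilator"
  unfolding annihilator_def
proof (intro CollectI ballI ext)
  fix x j assume x: "x \<in> coords n"
  define y where "y = alg_act (gen g - scal (inverse r)) x"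
  have y: "y = \<tau> g x + (\<lambda>j. (- inverse r) * x j)"
    unfolding y_def by (auto simp: alg_act_diff alg_act_gen alg_act_scal)
  have "\<tau> g y = \<tau> g (\<tau> g x) + (\<lambda>j. (- inverse r) * \<tau> g x j)"
    unfolding y op_add[OF closed[OF x] coords_scale[OF x]] scale[OF x] ..
  then show "alg_act ((gen g - scal r) * (gen g - scal (inverse r))) x j = 0 j"
    using assms(2) x
    by (simp add: alg_act_mult y_def[symmetric] alg_act_diff alg_act_gen alg_act_scal)
      (simp add: y assms(1) algebra_simps)
qed

lemma relation_ideal_annihilates: "relation_ideal r0 r1 \<subseteq> annihilator"
proof -
  have "relators r0 r1 \<subseteq> annihilator"
    unfolding relators_def insert_subset
  proof (intro conjI empty_subsetI)
    show "gen U0 ^ 2 - gen U0 \<in> annihilator"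
      by (auto simp: annihilator_def power2_eq_square alg_act_diff alg_act_mult alg_act_gen idem fun_eq_iff)
    show "gen U1 ^ 2 \<in> annihilator"
      by (auto simp: annihilator_def power2_eq_square alg_act_mult alg_act_gen nil fun_eq_iff)
    show "gen U0 * gen T0 * gen T1 * gen U1 \<in> annihilator"
      by (auto simp: annihilator_def alg_act_mult alg_act_gen AB closed)
    show "gen T1 * gen U1 * gen U0 * gen T0 \<in> annihilator"
      by (auto simp: annihilator_def alg_act_mult alg_act_gen BA closed)
  qed (rule quadratic_relator quad0 quad1 r0 r1; assumption?)+
  then show ?thesis
    unfolding relation_ideal_def genideal_def using annihilator_ideal by blast
qed

text \<open>The chosen representative does not matter, by \<open>class_act_quot_map\<close>.\<close>

definition class_act :: "free_alg set \<Rightarrow> seq \<Rightarrow> seq" where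
  "class_act X = alg_act (SOME a. a \<in> X)"

lemma class_act_quot_map:
  assumes x: "x \<in> coords n"
  shows "class_act (quot_map r0 r1 a) x = alg_act a x"
proof -
  interpret I: ideal "relation_ideal r0 r1" class_ring
    by (rule relation_ideal_ideal)
  have q: "quot_map r0 r1 a = {i + a |i. i \<in> relation_ideal r0 r1}"
    unfolding quot_map_def a_r_coset_def' by (simp, blast)
  have "(SOME b. b \<in> quot_map r0 r1 a) \<in> quot_map r0 r1 a"
  proof (rule someI)
    have "0 \<in> relation_ideal r0 r1" using I.zero_closed by simp
    then show "0 + a \<in> quot_map r0 r1 a" unfolding q by blast
  qed
  then obtain i where i: "i \<in> relation_ideal r0 r1" "(SOME b. b \<in> quot_map r0 r1 a) = i + a"
    unfolding q by blast
  have "alg_act i x = 0"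
    using i(1) relation_ideal_annihilates x by (auto simp: annihilator_def)
  then show ?thesis
    unfolding class_act_def i(2) alg_act_add by simp
qed

text \<open>Transport of structure along \<open>e\<close> places the module on a subset of \<open>'v\<close>.\<close>

lemma realization:
  fixes e :: "seq \<Rightarrow> 'v"
  assumes inj: "inj_on e (coords n)"
  shows "\<exists>M :: 'v daha_module. daha_module r0 r1 M \<and> intertwining n r0 r1 M \<tau> e"
proof -
  define d where "d = inv_into (coords n) e"
  have de: "d (e x) = x" if "x \<in> coords n" for x
    unfolding d_def by (rule inv_into_f_f[OF inj that])
  define M :: "'v daha_module" where
    "M = \<lparr>carrier = e ` coords n, mult = (\<lambda>u v. e 0), one = e 0, zero = e 0,
      add = (\<lambda>u v. e (d u + d v)), smult = (\<lambda>X v. e (class_act X (d v)))\<rparr>"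
  have sm: "quot_map r0 r1 a \<odot>\<^bsub>M\<^esub> e x = e (alg_act a x)" if "x \<in> coords n" for a x
    by (simp add: M_def de[OF that] class_act_quot_map[OF that])
  have M_add: "e x \<oplus>\<^bsub>M\<^esub> e y = e (x + y)" if "x \<in> coords n" "y \<in> coords n" for x y
    by (simp add: M_def de that)
  have ring: "ring (nil_daha r0 r1)"
    unfolding nil_daha_def by (rule ideal.quotient_is_ring[OF relation_ideal_ideal])
  have ab: "abelian_group M"
  proof (rule abelian_groupI)
    fix u assume "u \<in> carrier M"
    then obtain x where x: "x \<in> coords n" "u = e x" by (auto simp: M_def)
    have "(\<lambda>j. (-1) * x j) + x = 0" by (simp add: fun_eq_iff)
    then have "e (\<lambda>j. (-1) * x j) \<oplus>\<^bsub>M\<^esub> u = \<zero>\<^bsub>M\<^esub>"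
      using M_add[OF coords_scale[OF x(1), of "-1"] x(1)] by (simp add: x(2) M_def)
    then show "\<exists>v\<in>carrier M. v \<oplus>\<^bsub>M\<^esub> u = \<zero>\<^bsub>M\<^esub>"
      using coords_scale[OF x(1), of "-1"] by (intro bexI) (auto simp: M_def)
  qed (auto simp: M_def de ac_simps)
  have "left_module (nil_daha r0 r1) M"
  proof (intro left_module.intro left_module_axioms.intro ring ab)
    fix X Y u v assume X: "X \<in> carrier (nil_daha r0 r1)" and u: "u \<in> carrier M"
    obtain a where a: "X = quot_map r0 r1 a" using X by (rule quot_map_surj)
    obtain x where x: "x \<in> coords n" "u = e x" using u by (auto simp: M_def)
    show "X \<odot>\<^bsub>M\<^esub> u \<in> carrier M"
      by (simp add: a x sm) (simp add: M_def alg_act_closed x(1))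
    {
      assume "Y \<in> carrier (nil_daha r0 r1)"
      then obtain b where b: "Y = quot_map r0 r1 b" by (rule quot_map_surj)
      show "(X \<oplus>\<^bsub>nil_daha r0 r1\<^esub> Y) \<odot>\<^bsub>M\<^esub> u = X \<odot>\<^bsub>M\<^esub> u \<oplus>\<^bsub>M\<^esub> Y \<odot>\<^bsub>M\<^esub> u"
        using x(1) by (simp add: a b x(2) quot_map_add[symmetric] sm M_add alg_act_closed alg_act_add)
      show "(X \<otimes>\<^bsub>nil_daha r0 r1\<^esub> Y) \<odot>\<^bsub>M\<^esub> u = X \<odot>\<^bsub>M\<^esub> (Y \<odot>\<^bsub>M\<^esub> u)"
        using x(1) by (simp add: a b x(2) quot_map_mult[symmetric] sm alg_act_closed alg_act_mult)
    }
    {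
      assume "v \<in> carrier M"
      then obtain y where y: "y \<in> coords n" "v = e y" by (auto simp: M_def)
      show "X \<odot>\<^bsub>M\<^esub> (u \<oplus>\<^bsub>M\<^esub> v) = X \<odot>\<^bsub>M\<^esub> u \<oplus>\<^bsub>M\<^esub> X \<odot>\<^bsub>M\<^esub> v"
        using x(1) y(1) by (simp add: a x(2) y(2) sm M_add alg_act_closed alg_act_plus)
    }
  next
    fix u assume u: "u \<in> carrier M"
    obtain x where x: "x \<in> coords n" "u = e x" using u by (auto simp: M_def)
    show "\<one>\<^bsub>nil_daha r0 r1\<^esub> \<odot>\<^bsub>M\<^esub> u = u"
      using x sm[OF x(1), of "scal 1"] by (simp add: quot_map_one[symmetric] scal_one[symmetric] alg_act_scal)
  qed
  then have dm: "daha_module r0 r1 M" by (simp add: daha_module_def)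
  interpret daha_module r0 r1 M by (rule dm)
  have "bij_betw e (coords n) (carrier M)"
    using inj by (simp add: bij_betw_def M_def)
  then have "intertwining n r0 r1 M \<tau> e"
    by (simp add: intertwining_def coordinates_def M_add sm alg_act_scal alg_act_gen closed)
  then show ?thesis using dm by blast
qed

end

lemma (in std_rep) ex_std_module:
  assumes "\<exists>emb :: complex \<Rightarrow> 'v. inj emb"
  shows "\<exists>M :: 'v daha_module. daha_module r0 r1 M \<and> std_module r0 r1 n M \<kappa> \<nu>"
proof -
  interpret operator_rep r0 r1 n S
    by unfold_locales
      (simp_all only: r0 r1 std_closed std_add std_scale std_T0_quadratic std_T1_quadratic
        std_U0_idem std_U1_nil std_AB std_BA zero_fun_apply not_False_eq_True)
  obtain e :: "seq \<Rightarrow> 'v" where "inj_on e (coords n)"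
    using ex_coords_embedding[OF assms] by blast
  from realization[OF this] show ?thesis
    unfolding std_module_def by blast
qed

section \<open>Classification\<close>

lemma std_cong:
  assumes "\<And>j. j < n \<Longrightarrow> \<nu> j = \<nu>' j"
  shows "std r0 r1 n \<kappa> \<nu> = std r0 r1 n \<kappa> \<nu>'"
proof (intro ext)
  fix g x j show "std r0 r1 n \<kappa> \<nu> g x j = std r0 r1 n \<kappa> \<nu>' g x j"
    using assms by (cases g) auto
qed

lemma std_module_cong:
  "(\<And>j. j < n \<Longrightarrow> \<nu> j = \<nu>' j) \<Longrightarrow> std_module r0 r1 n M \<kappa> \<nu> \<longleftrightarrow> std_module r0 r1 n M \<kappa> \<nu>'"
  unfolding std_module_def using std_cong[of n \<nu> \<nu>' r0 r1 \<kappa>] by simp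

text \<open>The class of \<open>p\<close> consists of the modules with normal form \<open>(K p, N p)\<close>.  It is nonempty by the
  existence of such modules, it is one isomorphism class because isomorphic modules are those with the same
  normal form, and it determines \<open>p\<close> because the normal form is unique.\<close>

lemma std_module_classification:
  fixes X :: "'v daha_module set" and H :: "'v daha_module \<Rightarrow> 'p \<Rightarrow> bool"
  assumes n: "0 < n" and emb: "\<exists>emb :: complex \<Rightarrow> 'v. inj emb"
    and X: "\<And>M. M \<in> X \<Longrightarrow> daha_module r0 r1 M"
    and rep: "\<And>p. p \<in> P \<Longrightarrow> std_rep r0 r1 n (K p) (N p)"
    and std_X: "\<And>p M. p \<in> P \<Longrightarrow> daha_module r0 r1 M \<Longrightarrow> std_module r0 r1 n M (K p) (N p) \<Longrightarrow>
      M \<in> X \<and> H M p"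
    and X_std: "\<And>p M. p \<in> P \<Longrightarrow> M \<in> X \<Longrightarrow> H M p \<Longrightarrow> std_module r0 r1 n M (K p) (N p)"
    and ex: "\<And>M. M \<in> X \<Longrightarrow> \<exists>p\<in>P. H M p"
    and inj: "\<And>p q. p \<in> P \<Longrightarrow> q \<in> P \<Longrightarrow> K p = K q \<Longrightarrow> (\<forall>j<n. N p j = N q j) \<Longrightarrow> p = q"
  shows "\<exists>F. bij_betw F P (iso_classes (nil_daha r0 r1) X) \<and> (\<forall>p\<in>P. F p = {M \<in> X. H M p})"
proof -
  define F where "F p = {M \<in> X. H M p}" for p
  have F: "M \<in> F p \<longleftrightarrow> daha_module r0 r1 M \<and> std_module r0 r1 n M (K p) (N p)" if "p \<in> P" for M p
    using that X std_X X_std unfolding F_def by blast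
  have ne: "\<exists>M. M \<in> F p" if "p \<in> P" for p
    using std_rep.ex_std_module[OF rep[OF that] emb] F[OF that] by blast
  let ?R = "{(M, N). M \<in> X \<and> N \<in> X \<and> isomorphic_modules (nil_daha r0 r1) M N}"
  have cls: "?R `` {M} = F p" if p: "p \<in> P" and M: "M \<in> F p" for M p
  proof (intro equalityI subsetI)
    fix N' assume "N' \<in> ?R `` {M}"
    then have N': "N' \<in> X" "isomorphic_modules (nil_daha r0 r1) M N'" by auto
    then have "std_module r0 r1 n N' (K p) (N p)"
      using M isomorphic_intertwining[OF _ X[OF N'(1)] N'(2)] unfolding F[OF p] std_module_def by blast
    then show "N' \<in> F p" using X[OF N'(1)] F[OF p] by blast
  next
    fix N' assume N': "N' \<in> F p"
    then have "isomorphic_modules (nil_daha r0 r1) M N'"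
      using M intertwining_isomorphic unfolding F[OF p] std_module_def by blast
    then show "N' \<in> ?R `` {M}" using M N' by (auto simp: F_def)
  qed
  have "bij_betw F P (iso_classes (nil_daha r0 r1) X)"
  proof (rule bij_betwI')
    fix p q assume p: "p \<in> P" and q: "q \<in> P"
    show "F p = F q \<longleftrightarrow> p = q"
    proof
      assume eq: "F p = F q"
      obtain M where "M \<in> F p" using ne[OF p] by blast
      then have M: "daha_module r0 r1 M" "std_module r0 r1 n M (K p) (N p)" "std_module r0 r1 n M (K q) (N q)"
        using F[OF p] F[OF q] eq by auto
      show "p = q"
        using std_module_unique[OF rep[OF p] rep[OF q] n M] inj[OF p q] by blast
    qed simp
  next
    fix p assume p: "p \<in> P"
    obtain M where M: "M \<in> F p" using ne[OF p] by blast
    then have "M \<in> X" by (simp add: F_def)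
    then have "?R `` {M} \<in> X // ?R" by (rule quotientI)
    then show "F p \<in> iso_classes (nil_daha r0 r1) X"
      unfolding iso_classes_def cls[OF p M] .
  next
    fix C assume "C \<in> iso_classes (nil_daha r0 r1) X"
    then obtain M where M: "M \<in> X" "C = ?R `` {M}"
      unfolding iso_classes_def by (rule quotientE)
    obtain p where p: "p \<in> P" "H M p" using ex[OF M(1)] by blast
    then have "M \<in> F p" using M by (simp add: F_def)
    then show "\<exists>p\<in>P. C = F p" using cls[OF p(1)] M(2) p(1) by blast
  qed
  then show ?thesis
    unfolding F_def by (intro exI[of _ "\<lambda>p. {M \<in> X. H M p}"]) simp
qed

section \<open>Reading block bases from the right\<close>

text \<open>The sequence \<open>f D, g (D-1), f (D-1), g (D-2), \<dots>\<close>.  With \<open>lo\<close> the first index of the \<open>a\<^sub>i\<close>,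
  that is 1 in even and 0 in odd dimension, the chain of \<open>a\<close> and \<open>b\<close> has length \<open>Suc (2 * D) - lo\<close>; this is how
  the two cases are treated together below.\<close>

definition interleave :: "nat \<Rightarrow> (nat \<Rightarrow> 'a) \<Rightarrow> (nat \<Rightarrow> 'a) \<Rightarrow> nat \<Rightarrow> 'a" where
  "interleave D f g j = (if even j then f (D - j div 2) else g (D - Suc (j div 2)))"

lemma interleave_even: "i \<le> D \<Longrightarrow> interleave D f g (2 * (D - i)) = f i"
  by (simp add: interleave_def)

lemma interleave_odd: "i < D \<Longrightarrow> interleave D f g (Suc (2 * (D - Suc i))) = g i"
  by (simp add: interleave_def)

text \<open>\<open>a\<^sub>i\<close> sits at position \<open>2(D - i)\<close> and \<open>b\<^sub>i\<close> at position \<open>2(D - 1 - i) + 1\<close>.\<close>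

lemma all_positions:
  assumes "lo \<le> 1" and "lo \<le> D"
  shows "(\<forall>j<Suc (2 * D) - lo. R j) \<longleftrightarrow>
    (\<forall>i\<in>{lo..D}. R (2 * (D - i))) \<and> (\<forall>i\<in>{0..<D}. R (Suc (2 * (D - Suc i))))"
proof (intro iffI conjI ballI allI impI)
  fix j assume R: "(\<forall>i\<in>{lo..D}. R (2 * (D - i))) \<and> (\<forall>i\<in>{0..<D}. R (Suc (2 * (D - Suc i))))"
    and j: "j < Suc (2 * D) - lo"
  show "R j"
  proof (cases "even j")
    case True
    then obtain k where k: "j = 2 * k" by blast
    then have "D - k \<in> {lo..D}" "j = 2 * (D - (D - k))"
      using j assms by auto
    then show ?thesis using R by metis
  next
    case False
    then obtain k where k: "j = Suc (2 * k)" by (auto elim: oddE)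
    then have "D - Suc k \<in> {0..<D}" "j = Suc (2 * (D - Suc (D - Suc k)))"
      using j assms by auto
    then show ?thesis using R by metis
  qed
next
  fix i assume R: "\<forall>j<Suc (2 * D) - lo. R j" and "i \<in> {lo..D}"
  then have "2 * (D - i) < Suc (2 * D) - lo" using assms by auto
  then show "R (2 * (D - i))" using R by blast
next
  fix i assume R: "\<forall>j<Suc (2 * D) - lo. R j" and "i \<in> {0..<D}"
  then have "Suc (2 * (D - Suc i)) < Suc (2 * D) - lo" using assms by auto
  then show "R (Suc (2 * (D - Suc i)))" using R by blast
qed

text \<open>The links starting at an even position join \<open>a\<^bsub>i+1\<^esub>\<close> and \<open>b\<^sub>i\<close>, those starting at an odd position
  join \<open>b\<^sub>i\<close> and \<open>a\<^sub>i\<close>.\<close>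

lemma all_links:
  assumes "lo \<le> 1" and "lo \<le> D"
  shows "(\<forall>j. Suc j < Suc (2 * D) - lo \<longrightarrow> R j) \<longleftrightarrow>
    (\<forall>i\<in>{0..<D}. R (2 * (D - Suc i))) \<and> (\<forall>i\<in>{lo..<D}. R (Suc (2 * (D - Suc i))))"
proof (intro iffI conjI ballI allI impI)
  fix j assume R: "(\<forall>i\<in>{0..<D}. R (2 * (D - Suc i))) \<and> (\<forall>i\<in>{lo..<D}. R (Suc (2 * (D - Suc i))))"
    and j: "Suc j < Suc (2 * D) - lo"
  show "R j"
  proof (cases "even j")
    case True
    then obtain k where k: "j = 2 * k" by blast
    then have "D - Suc k \<in> {0..<D}" "j = 2 * (D - Suc (D - Suc k))"
      using j assms by auto
    then show ?thesis using R by metis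
  next
    case False
    then obtain k where k: "j = Suc (2 * k)" by (auto elim: oddE)
    then have "D - Suc k \<in> {lo..<D}" "j = Suc (2 * (D - Suc (D - Suc k)))"
      using j assms by auto
    then show ?thesis using R by metis
  qed
next
  fix i assume R: "\<forall>j. Suc j < Suc (2 * D) - lo \<longrightarrow> R j" and "i \<in> {0..<D}"
  then have "Suc (2 * (D - Suc i)) < Suc (2 * D) - lo" using assms by auto
  then show "R (2 * (D - Suc i))" using R by blast
next
  fix i assume R: "\<forall>j. Suc j < Suc (2 * D) - lo \<longrightarrow> R j" and "i \<in> {lo..<D}"
  then have "Suc (Suc (2 * (D - Suc i))) < Suc (2 * D) - lo" using assms by auto
  then show "R (Suc (2 * (D - Suc i)))" using R by blast
qed

lemma interleave_collapse:
  assumes "lo \<le> 1" "lo \<le> D" and "j < Suc (2 * D) - lo"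
  shows "interleave D (\<lambda>i. w (2 * (D - i))) (\<lambda>i. w (Suc (2 * (D - Suc i)))) j = w j"
proof -
  have "\<forall>j<Suc (2 * D) - lo. interleave D (\<lambda>i. w (2 * (D - i))) (\<lambda>i. w (Suc (2 * (D - Suc i)))) j = w j"
    unfolding all_positions[OF assms(1,2)] by (auto simp: interleave_even interleave_odd)
  then show ?thesis using assms(3) by blast
qed

lemma interleave_eq_iff:
  assumes "lo \<le> 1" "lo \<le> D"
  shows "(\<forall>j<Suc (2 * D) - lo. interleave D f g j = interleave D f' g' j) \<longleftrightarrow>
    (\<forall>i\<in>{lo..D}. f i = f' i) \<and> (\<forall>i\<in>{0..<D}. g i = g' i)"
  unfolding all_positions[OF assms] by (auto simp: interleave_even interleave_odd)

lemma alternating_rev: "alternating D a b = rev (map (interleave D a b) [0..<2 * D])"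
proof -
  have "alternating D a b = map (\<lambda>k. if even k then b (k div 2) else a (Suc (k div 2))) [0..<2 * D]"
    by (induction D) (simp_all add: alternating_def)
  also have "\<dots> = rev (map (interleave D a b) [0..<2 * D])"
  proof (rule nth_equalityI)
    fix k assume "k < length (map (\<lambda>k. if even k then b (k div 2) else a (Suc (k div 2))) [0..<2 * D])"
    then have k: "k < 2 * D" by simp
    have "interleave D a b (2 * D - Suc k) = (if even k then b (k div 2) else a (Suc (k div 2)))"
    proof (cases "even k")
      case True
      then obtain m where m: "k = 2 * m" by blast
      then have "2 * D - Suc k = Suc (2 * (D - Suc m))" using k by auto
      then show ?thesis using m k by (simp add: interleave_odd)
    next
      case False
      then obtain m where m: "k = Suc (2 * m)" by (auto elim: oddE)
      then have "2 * D - Suc k = 2 * (D - Suc m)" using k by auto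
      then show ?thesis using m k by (simp add: interleave_even)
    qed
    then show "map (\<lambda>k. if even k then b (k div 2) else a (Suc (k div 2))) [0..<2 * D] ! k =
        rev (map (interleave D a b) [0..<2 * D]) ! k"
      using k by (simp add: rev_nth)
  qed simp
  finally show ?thesis .
qed

lemma odd_list_rev: "a 0 # alternating D a b = rev (map (interleave D a b) [0..<Suc (2 * D)])"
  by (simp add: alternating_rev interleave_def)

lemma ordered_basis_rev:
  "ordered_basis r0 r1 M (rev (map w [0..<n])) \<longleftrightarrow>
    inj_on w {..<n} \<and> vectorspace.basis class_ring (cspace r0 r1 M) (w ` {..<n})"
  by (auto simp: ordered_basis_def distinct_map atLeast0LessThan)

lemma interleave_first: "interleave D f g 0 = f D"
  by (simp add: interleave_def)

lemma interleave_last: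
  assumes "lo \<le> 1" "lo \<le> D"
  shows "interleave D f g (Suc (2 * D) - lo - 1) = (if lo = 1 then g 0 else f 0)"
proof -
  consider "lo = 0" | "lo = 1" "0 < D" using assms by linarith
  then show ?thesis
    using interleave_odd[of 0 D f g] interleave_even[of 0 D f g]
    by cases (auto simp: Suc_diff_Suc diff_mult_distrib2 numeral_2_eq_2)
qed

lemma even_chain_length: "lo \<le> 1 \<Longrightarrow> even (Suc (2 * D) - lo) \<longleftrightarrow> lo = 1"
  by (cases lo) auto

lemma adapted_chain_interleave:
  assumes lo: "lo \<le> 1" "lo \<le> D"
  shows "adapted_chain r0 r1 (Suc (2 * D) - lo) M (interleave D a b) (interleave D lam mu) \<longleftrightarrow>
    ordered_basis r0 r1 M (rev (map (interleave D a b) [0..<Suc (2 * D) - lo])) \<and>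
    (\<forall>i\<in>{lo..D}. lam i \<noteq> 0 \<and> a i \<in> weight_space r0 r1 M (lam i) 0) \<and>
    (\<forall>i\<in>{0..<D}. mu i \<noteq> 0 \<and> b i \<in> weight_space r0 r1 M 0 (mu i)) \<and>
    preserves r0 r1 M (elt_t0 r0 r1) {a D} \<and>
    preserves r0 r1 M (if lo = 1 then elt_t0 r0 r1 else elt_t1 r0 r1) {if lo = 1 then b 0 else a 0} \<and>
    (\<forall>i\<in>{lo..<D}. preserves r0 r1 M (elt_t0 r0 r1) {a i, b i}) \<and>
    (\<forall>i\<in>{0..<D}. preserves r0 r1 M (elt_t1 r0 r1) {b i, a (i + 1)})"
proof -
  have next_odd: "interleave D a b (Suc (Suc (2 * (D - Suc i)))) = a i" if "i < D" for i
  proof -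
    have "Suc (Suc (2 * (D - Suc i))) = 2 * (D - i)" using that by auto
    then show ?thesis using that by (simp only: interleave_even[OF less_imp_le])
  qed
  show ?thesis
    unfolding adapted_chain_def ordered_basis_rev all_positions[OF lo] all_links[OF lo]
      interleave_first interleave_last[OF lo] even_chain_length[OF lo(1)]
    by (auto simp: interleave_even interleave_odd next_odd insert_commute Suc_eq_plus1[symmetric]
        simp del: One_nat_def)
qed

lemma adapted_chain_cong:
  assumes n: "0 < n" and eq: "\<And>j. j < n \<Longrightarrow> w j = w' j" and w: "adapted_chain r0 r1 n M w \<nu>"
  shows "adapted_chain r0 r1 n M w' \<nu>"
proof -
  note W = w[unfolded adapted_chain_def]
  have inj: "inj_on w' {..<n} \<longleftrightarrow> inj_on w {..<n}"
    by (rule inj_on_cong) (simp add: eq)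
  have img: "w' ` {..<n} = w ` {..<n}"
    by (rule image_cong) (simp_all add: eq)
  show ?thesis
    unfolding adapted_chain_def inj img
  proof (intro conjI allI impI)
    show "w' j \<in> weight_space r0 r1 M (if even j then \<nu> j else 0) (if even j then 0 else \<nu> j)"
      if "j < n" for j
      using W eq[OF that] that by metis
    show "preserves r0 r1 M (if even j then elt_t1 r0 r1 else elt_t0 r0 r1) {w' j, w' (Suc j)}"
      if "Suc j < n" for j
    proof -
      have "w' j = w j" "w' (Suc j) = w (Suc j)"
        using eq[of j] eq[of "Suc j"] that by auto
      then show ?thesis
        using W that by presburger
    qed
    have e: "w' 0 = w 0" "w' (n - 1) = w (n - 1)"
      using eq n by auto
    show "preserves r0 r1 M (elt_t0 r0 r1) {w' 0}"
      "preserves r0 r1 M (if even n then elt_t0 r0 r1 else elt_t1 r0 r1) {w' (n - 1)}"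
      unfolding e using W by blast+
  qed (use W in blast)+
qed

text \<open>Admissibility in terms of the original parameters, where \<open>f D\<close> is the weight \<open>\<lambda>\<^sub>D\<close> absent from
  the parameter lists.\<close>

lemma std_rep_interleave:
  assumes lo: "lo \<le> 1" "lo \<le> D"
  shows "std_rep r0 r1 (Suc (2 * D) - lo) \<kappa> (interleave D f g) \<longleftrightarrow>
    r0 \<noteq> 0 \<and> r1 \<noteq> 0 \<and> f D \<in> {r0, inverse r0} \<and>
    \<kappa> \<in> (if lo = 1 then {r0, inverse r0} else {r1, inverse r1}) \<and>
    (\<forall>i\<in>{lo..<D}. f i \<notin> {0, r0, inverse r0}) \<and> (\<forall>i\<in>{0..<D}. g i \<noteq> 0) \<and>
    inj_on f {lo..<D} \<and> inj_on g {0..<D}" (is "?L \<longleftrightarrow> ?R")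
proof -
  have L: "?L \<longleftrightarrow> r0 \<noteq> 0 \<and> r1 \<noteq> 0 \<and> f D \<in> {r0, inverse r0} \<and>
    \<kappa> \<in> (if lo = 1 then {r0, inverse r0} else {r1, inverse r1}) \<and>
    (\<forall>i\<in>{lo..D}. f i \<noteq> 0) \<and> (\<forall>i\<in>{0..<D}. g i \<noteq> 0) \<and>
    (\<forall>i\<in>{lo..D}. 0 < 2 * (D - i) \<longrightarrow> f i \<notin> {r0, inverse r0}) \<and>
    (\<forall>i\<in>{lo..D}. \<forall>j\<in>{lo..D}. D - i \<noteq> D - j \<longrightarrow> f i \<noteq> f j) \<and>
    (\<forall>i\<in>{0..<D}. \<forall>j\<in>{0..<D}. D - Suc i \<noteq> D - Suc j \<longrightarrow> g i \<noteq> g j)"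
    unfolding std_rep_def admissible_def all_positions[OF lo]
      even_chain_length[OF lo(1)] interleave_first
    by (simp add: interleave_even interleave_odd)
  show ?thesis
  proof
    assume ?L
    then have l: "\<And>i. i \<in> {lo..D} \<Longrightarrow> f i \<noteq> 0"
      "\<And>i. i \<in> {lo..D} \<Longrightarrow> 0 < 2 * (D - i) \<Longrightarrow> f i \<notin> {r0, inverse r0}"
      "\<And>i j. i \<in> {lo..D} \<Longrightarrow> j \<in> {lo..D} \<Longrightarrow> D - i \<noteq> D - j \<Longrightarrow> f i \<noteq> f j"
      "\<And>i j. i \<in> {0..<D} \<Longrightarrow> j \<in> {0..<D} \<Longrightarrow> D - Suc i \<noteq> D - Suc j \<Longrightarrow> g i \<noteq> g j"
      unfolding L by blast+
    have "inj_on f {lo..<D}"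
    proof (rule inj_onI, rule ccontr)
      fix i j assume ij: "i \<in> {lo..<D}" "j \<in> {lo..<D}" "f i = f j" "i \<noteq> j"
      then have "i < D" "j < D" by simp_all
      with \<open>i \<noteq> j\<close> have "D - i \<noteq> D - j" by arith
      then show False using l(3)[of i j] ij by auto
    qed
    moreover have "inj_on g {0..<D}"
    proof (rule inj_onI, rule ccontr)
      fix i j assume ij: "i \<in> {0..<D}" "j \<in> {0..<D}" "g i = g j" "i \<noteq> j"
      then have "i < D" "j < D" by simp_all
      with \<open>i \<noteq> j\<close> have "D - Suc i \<noteq> D - Suc j" by arith
      then show False using l(4)[of i j] ij by auto
    qed
    moreover have "f i \<notin> {0, r0, inverse r0}" if "i \<in> {lo..<D}" for i
      using l(1,2)[of i] that by auto
    ultimately show ?R using \<open>?L\<close> unfolding L by blast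
  next
    assume R: ?R
    have "f i \<noteq> f j" if ij: "i \<in> {lo..D}" "j \<in> {lo..D}" "D - i \<noteq> D - j" for i j
    proof -
      have "i \<noteq> j" using ij by auto
      consider "i < D" "j < D" | "i = D" "j < D" | "i < D" "j = D"
        using ij(1,2) \<open>i \<noteq> j\<close> by (metis atLeastAtMost_iff le_neq_implies_less)
      then show ?thesis
      proof cases
        case 1
        then show ?thesis using R ij \<open>i \<noteq> j\<close> by (auto dest: inj_onD)
      next
        case 2
        then show ?thesis using R ij(2) by (metis atLeastAtMost_iff atLeastLessThan_iff insertCI)
      next
        case 3
        then show ?thesis using R ij(1) by (metis atLeastAtMost_iff atLeastLessThan_iff insertCI)
      qed
    qed
    moreover have "f i \<noteq> 0" if "i \<in> {lo..D}" for i
      using R that by (cases "i = D") auto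
    moreover have "f i \<notin> {r0, inverse r0}" if "i \<in> {lo..D}" "0 < 2 * (D - i)" for i
      using R that by auto
    moreover have "g i \<noteq> g j" if "i \<in> {0..<D}" "j \<in> {0..<D}" "D - Suc i \<noteq> D - Suc j" for i j
      using R that by (auto dest: inj_onD)
    ultimately show ?L unfolding L using R by blast
  qed
qed

text \<open>Both cases of the theorem at once.  The projections \<open>K\<close>, \<open>R\<close>, \<open>L\<close>, \<open>N\<close> extract from a parameter tuple
  the eigenvalue at the far end, the eigenvalue of \<open>t\<^sub>0\<close> on \<open>a\<^sub>D\<close>, the \<open>\<lambda>\<^sub>i\<close> and the \<open>\<mu>\<^sub>i\<close>; the even and odd
  tuples list the first two in opposite order.\<close>

lemma block_classification:
  fixes X :: "'v daha_module set" and H :: "'v daha_module \<Rightarrow> 'p \<Rightarrow> bool"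
    and K R :: "'p \<Rightarrow> complex" and L N :: "'p \<Rightarrow> complex list"
  defines "n \<equiv> \<lambda>lo D. Suc (2 * D) - lo"
  assumes r: "r0 \<noteq> 0" "r1 \<noteq> 0" and lo: "lo \<le> 1" "lo \<le> D"
    and emb: "\<exists>emb :: complex \<Rightarrow> 'v. inj emb"
    and P: "\<And>p. p \<in> P \<longleftrightarrow> K p \<in> (if lo = 1 then {r0, inverse r0} else {r1, inverse r1}) \<and>
      R p \<in> {r0, inverse r0} \<and>
      length (L p) = D - lo \<and> distinct (L p) \<and> set (L p) \<inter> {0, r0, inverse r0} = {} \<and>
      length (N p) = D \<and> distinct (N p) \<and> 0 \<notin> set (N p)"
    and proj: "\<And>\<kappa> \<rho> ls ms. \<exists>p. K p = \<kappa> \<and> R p = \<rho> \<and> L p = ls \<and> N p = ms"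
    and proj_inj: "\<And>p q. K p = K q \<Longrightarrow> R p = R q \<Longrightarrow> L p = L q \<Longrightarrow> N p = N q \<Longrightarrow> p = q"
    and X: "\<And>M. M \<in> X \<longleftrightarrow> mf_irreducible r0 r1 (n lo D) M \<and>
      (\<exists>a b lam mu. adapted_chain r0 r1 (n lo D) M (interleave D a b) (interleave D lam mu))"
    and H: "\<And>M p. mf_irreducible r0 r1 (n lo D) M \<Longrightarrow> H M p \<longleftrightarrow>
      (\<exists>a b lam mu. adapted_chain r0 r1 (n lo D) M (interleave D a b) (interleave D lam mu) \<and>
        (if lo = 1 then elt_t0 r0 r1 else elt_t1 r0 r1) \<odot>\<^bsub>M\<^esub> (if lo = 1 then b 0 else a 0) =
          K p \<odot>\<^bsub>cspace r0 r1 M\<^esub> (if lo = 1 then b 0 else a 0) \<and>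
        elt_t0 r0 r1 \<odot>\<^bsub>M\<^esub> a D = R p \<odot>\<^bsub>cspace r0 r1 M\<^esub> a D \<and>
        L p = map lam [lo..<D] \<and> N p = map mu [0..<D])"
  shows "\<exists>F. bij_betw F P (iso_classes (nil_daha r0 r1) X) \<and> (\<forall>p\<in>P. F p = {M \<in> X. H M p})"
proof -
  define m where "m = Suc (2 * D) - lo"
  have nm: "n lo D = m" by (simp add: n_def m_def)
  have m0: "0 < m" using lo by (simp add: m_def)
  have even_m: "even m \<longleftrightarrow> lo = 1"
    unfolding m_def by (rule even_chain_length[OF lo(1)])
  note int0 = interleave_first
  note int_last = interleave_last[OF lo, folded m_def]
  \<comment> \<open>\<open>\<lambda>\<^sub>D\<close> is appended to the listed weights; the list \<open>L p\<close> starts at index \<open>lo\<close>.\<close>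
  define f where "f p = (\<lambda>i. if i = D then R p else L p ! (i - lo))" for p
  define g where "g p = (\<lambda>i. N p ! i)" for p
  have P_std: "std_rep r0 r1 m (K p) (interleave D (f p) (g p))" if p: "p \<in> P" for p
    unfolding m_def std_rep_interleave[OF lo]
  proof (intro conjI r)
    note P' = p[unfolded P]
    show "f p D \<in> {r0, inverse r0}" using P' by (simp add: f_def)
    show "K p \<in> (if lo = 1 then {r0, inverse r0} else {r1, inverse r1})" using P' by blast
    show "\<forall>i\<in>{lo..<D}. f p i \<notin> {0, r0, inverse r0}"
    proof
      fix i assume i: "i \<in> {lo..<D}"
      then have "f p i \<in> set (L p)" using P' by (auto simp: f_def)
      then show "f p i \<notin> {0, r0, inverse r0}" using P' by blast
    qed
    show "\<forall>i\<in>{0..<D}. g p i \<noteq> 0"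
    proof
      fix i assume "i \<in> {0..<D}"
      then have "g p i \<in> set (N p)" using P' by (auto simp: g_def)
      then show "g p i \<noteq> 0" using P' by metis
    qed
    show "inj_on (f p) {lo..<D}"
      using P' by (auto simp: inj_on_def f_def nth_eq_iff_index_eq)
    show "inj_on (g p) {0..<D}"
      using P' by (auto simp: inj_on_def g_def nth_eq_iff_index_eq)
  qed
  have agree: "\<forall>j<m. interleave D lam mu j = interleave D (f p) (g p) j"
    if "lam D = R p" "L p = map lam [lo..<D]" "N p = map mu [0..<D]" for lam mu p
    unfolding m_def interleave_eq_iff[OF lo] using that by (auto simp: f_def g_def)
  show ?thesis
  proof (rule std_module_classification[where n = m and K = K and N = "\<lambda>p. interleave D (f p) (g p)"])
    show "0 < m" by (rule m0)
    show "\<exists>emb :: complex \<Rightarrow> 'v. inj emb" by (rule emb)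
    show "daha_module r0 r1 M" if "M \<in> X" for M
      using that by (simp add: X mf_irreducible_def daha_module_def)
    show "std_rep r0 r1 m (K p) (interleave D (f p) (g p))" if "p \<in> P" for p
      by (rule P_std[OF that])
    show "M \<in> X \<and> H M p"
      if p: "p \<in> P" and dm: "daha_module r0 r1 M"
        and std: "std_module r0 r1 m M (K p) (interleave D (f p) (g p))" for p M
    proof -
      note mf = std_module_mf_irreducible(1)[OF P_std[OF p] m0 dm std]
      obtain w where w: "adapted_chain r0 r1 m M w (interleave D (f p) (g p))"
        and t0: "elt_t0 r0 r1 \<odot>\<^bsub>M\<^esub> w 0 = interleave D (f p) (g p) 0 \<odot>\<^bsub>cspace r0 r1 M\<^esub> w 0"
        and tl: "(if even m then elt_t0 r0 r1 else elt_t1 r0 r1) \<odot>\<^bsub>M\<^esub> w (m - 1) =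
          K p \<odot>\<^bsub>cspace r0 r1 M\<^esub> w (m - 1)"
        using std_module_mf_irreducible(2)[OF P_std[OF p] m0 dm std] by blast
      \<comment> \<open>Undo the interleaving.\<close>
      define a where "a i = w (2 * (D - i))" for i
      define b where "b i = w (Suc (2 * (D - Suc i)))" for i
      have wab: "w j = interleave D a b j" if "j < m" for j
        using interleave_collapse[OF lo that[unfolded m_def], of w] unfolding a_def b_def by simp
      have ch: "adapted_chain r0 r1 m M (interleave D a b) (interleave D (f p) (g p))"
        by (rule adapted_chain_cong[OF m0 wab w])
      have wl: "w (m - 1) = (if lo = 1 then b 0 else a 0)"
        using wab[of "m - 1"] m0 unfolding int_last by simp
      have w0: "w 0 = a D" using wab[OF m0] by (simp add: int0)
      have "L p = map (f p) [lo..<D]"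
        using p by (intro nth_equalityI) (auto simp: P f_def)
      moreover have "N p = map (g p) [0..<D]"
        using p by (intro nth_equalityI) (auto simp: P g_def)
      moreover have "interleave D (f p) (g p) 0 = R p"
        by (simp add: int0 f_def)
      ultimately have "H M p"
        unfolding H[unfolded nm, OF mf] using ch t0 tl unfolding wl w0 even_m by metis
      moreover have "M \<in> X" unfolding X nm using mf ch by blast
      ultimately show ?thesis by blast
    qed
    show "std_module r0 r1 m M (K p) (interleave D (f p) (g p))"
      if p: "p \<in> P" and M: "M \<in> X" and HM: "H M p" for p M
    proof -
      have mf: "mf_irreducible r0 r1 m M" using M by (simp add: X nm)
      from HM[unfolded H[unfolded nm, OF mf]]
      obtain a b lam mu where ch: "adapted_chain r0 r1 m M (interleave D a b) (interleave D lam mu)"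
        and e: "(if lo = 1 then elt_t0 r0 r1 else elt_t1 r0 r1) \<odot>\<^bsub>M\<^esub> (if lo = 1 then b 0 else a 0) =
          K p \<odot>\<^bsub>cspace r0 r1 M\<^esub> (if lo = 1 then b 0 else a 0)"
        and t0: "elt_t0 r0 r1 \<odot>\<^bsub>M\<^esub> a D = R p \<odot>\<^bsub>cspace r0 r1 M\<^esub> a D"
        and lists: "L p = map lam [lo..<D]" "N p = map mu [0..<D]"
        by blast
      have "R p = lam D"
        using t0 unfolding adapted_chain_std(2)[OF r m0 mf ch, unfolded int0] .
      moreover have "std_module r0 r1 m M (K p) (interleave D lam mu)"
        using adapted_chain_std(3)[OF r m0 mf ch, of "K p"] e unfolding int_last even_m by blast
      ultimately show ?thesis
        using std_module_cong[of m "interleave D lam mu" "interleave D (f p) (g p)" r0 r1 M "K p"]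
          agree[of lam p mu] lists by simp
    qed
    show "\<exists>p\<in>P. H M p" if M: "M \<in> X" for M
    proof -
      have mf: "mf_irreducible r0 r1 m M" using M by (simp add: X nm)
      from M obtain a b lam mu where ch: "adapted_chain r0 r1 m M (interleave D a b) (interleave D lam mu)"
        unfolding X nm by blast
      obtain \<kappa> where k: "(if even m then elt_t0 r0 r1 else elt_t1 r0 r1) \<odot>\<^bsub>M\<^esub> interleave D a b (m - 1) =
          \<kappa> \<odot>\<^bsub>cspace r0 r1 M\<^esub> interleave D a b (m - 1)"
        using adapted_chain_std(1)[OF r m0 mf ch] by blast
      have t0: "elt_t0 r0 r1 \<odot>\<^bsub>M\<^esub> a D = lam D \<odot>\<^bsub>cspace r0 r1 M\<^esub> a D"
        unfolding adapted_chain_std(2)[OF r m0 mf ch, unfolded int0] ..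
      have "std_rep r0 r1 m \<kappa> (interleave D lam mu)"
        using adapted_chain_std(3)[OF r m0 mf ch k] by blast
      note S = this[unfolded m_def std_rep_interleave[OF lo]]
      obtain p where p: "K p = \<kappa>" "R p = lam D" "L p = map lam [lo..<D]" "N p = map mu [0..<D]"
        using proj by blast
      have "p \<in> P"
        unfolding P p using S by (auto simp: distinct_map)
      moreover have "H M p"
        unfolding H[unfolded nm, OF mf] p using ch k t0 unfolding int_last even_m by blast
      ultimately show ?thesis by blast
    qed
    show "p = q" if p: "p \<in> P" and q: "q \<in> P" and k: "K p = K q"
      and eq: "\<forall>j<m. interleave D (f p) (g p) j = interleave D (f q) (g q) j" for p q
    proof -
      have f: "\<And>i. i \<in> {lo..D} \<Longrightarrow> f p i = f q i" and g: "\<And>i. i \<in> {0..<D} \<Longrightarrow> g p i = g q i"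
        using eq unfolding m_def interleave_eq_iff[OF lo] by blast+
      have "R p = R q" using f[of D] lo by (simp add: f_def)
      moreover have "L p = L q"
      proof (rule nth_equalityI)
        show "length (L p) = length (L q)" using p q by (simp add: P)
        fix i assume "i < length (L p)"
        then have "i < D - lo" using p by (simp add: P)
        then have "i + lo \<in> {lo..D}" "i + lo \<noteq> D" by auto
        then show "L p ! i = L q ! i" using f[of "i + lo"] by (simp add: f_def)
      qed
      moreover have "N p = N q"
      proof (rule nth_equalityI)
        show "length (N p) = length (N q)" using p q by (simp add: P)
        fix i assume "i < length (N p)"
        then show "N p ! i = N q ! i" using g[of i] p by (simp add: g_def P)
      qed
      ultimately show ?thesis using proj_inj k by blast
    qed
  qed
qed

lemma even_adapted_iff:
  assumes "1 \<le> D"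
  shows "even_adapted r0 r1 M D a b lam mu \<longleftrightarrow>
    adapted_chain r0 r1 (Suc (2 * D) - 1) M (interleave D a b) (interleave D lam mu)"
  unfolding adapted_chain_interleave[OF order_refl assms] even_adapted_def alternating_rev
  by (simp add: conj_ac)

text \<open>In dimension 1 the two conditions on the ends are not part of the odd notion, but they hold
  because the span of \<open>a\<^sub>0\<close> is the whole module.\<close>

lemma odd_adapted_iff:
  assumes dm: "daha_module r0 r1 M"
  shows "odd_adapted r0 r1 M D a b lam mu \<longleftrightarrow>
    adapted_chain r0 r1 (Suc (2 * D) - 0) M (interleave D a b) (interleave D lam mu)"
proof -
  interpret daha_module r0 r1 M by (rule dm)
  have one_dim: "preserves r0 r1 M (quot_map r0 r1 x) {a 0}"
    if "ordered_basis r0 r1 M (rev (map (interleave D a b) [0..<Suc (2 * D) - 0]))" "D = 0" for x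
  proof -
    have "rev (map (interleave D a b) [0..<Suc (2 * D) - 0]) = [a 0]"
      using that(2) by (simp add: interleave_def)
    then have "V.basis {a 0}"
      using that(1) by (simp only: ordered_basis_def list.set)
    then have "V.span {a 0} = carrier M"
      unfolding V.basis_def cspace_simps by (elim conjE)
    then show ?thesis
      unfolding preserves_def by (simp add: image_subset_iff)
  qed
  show ?thesis
    unfolding adapted_chain_interleave[OF le0 le0] odd_adapted_def odd_list_rev
    using one_dim[of "gen T0"] one_dim[of "gen T1"]
    by (cases "D = 0") (auto simp: elt_gen)
qed

theorem theorem4p3:
  fixes r0 r1 :: complex
  assumes "r0 \<noteq> 0" and "r1 \<noteq> 0"
    and large_enough: "\<exists>emb :: complex \<Rightarrow> 'v. inj emb"
  shows "(\<forall>D\<ge>1. \<exists>F :: params \<Rightarrow> 'v daha_module set.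
        bij_betw F (even_params r0 D)
          (iso_classes (nil_daha r0 r1) (even_modules r0 r1 D)) \<and>
        (\<forall>p\<in>even_params r0 D.
          F p = {M \<in> even_modules r0 r1 D. has_even_params r0 r1 D M p})) \<and>
      (\<forall>D. \<exists>F :: params \<Rightarrow> 'v daha_module set.
        bij_betw F (odd_params r0 r1 D)
          (iso_classes (nil_daha r0 r1) (odd_modules r0 r1 D)) \<and>
        (\<forall>p\<in>odd_params r0 r1 D.
          F p = {M \<in> odd_modules r0 r1 D. has_odd_params r0 r1 D M p}))"
proof (intro conjI allI impI)
  fix D :: nat assume D: "1 \<le> D"
  show "\<exists>F. bij_betw F (even_params r0 D)
          (iso_classes (nil_daha r0 r1) (even_modules r0 r1 D :: 'v daha_module set)) \<and>
        (\<forall>p\<in>even_params r0 D. F p = {M \<in> even_modules r0 r1 D. has_even_params r0 r1 D M p})"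
  proof (rule block_classification[where lo = 1 and D = D and K = fst and R = "\<lambda>p. fst (snd p)"
        and L = "\<lambda>p. fst (snd (snd p))" and N = "\<lambda>p. snd (snd (snd p))",
        OF assms(1,2) order_refl D large_enough], goal_cases)
    case (1 p)
    show ?case by (cases p) (simp add: even_params_def)
  next
    case (4 M)
    show ?case
      unfolding even_adapted_iff[OF D, symmetric] by (simp add: even_modules_def)
  next
    case (5 M p)
    show ?case
      unfolding even_adapted_iff[OF D, symmetric] by (cases p) simp
  qed (auto simp: prod_eq_iff)
next
  fix D :: nat
  have dm: "daha_module r0 r1 M" if "mf_irreducible r0 r1 n M" for n and M :: "'v daha_module"
    using that by (simp add: mf_irreducible_def daha_module_def)
  have n: "Suc (2 * D) - 0 = 2 * D + 1" by simp
  show "\<exists>F. bij_betw F (odd_params r0 r1 D)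
          (iso_classes (nil_daha r0 r1) (odd_modules r0 r1 D :: 'v daha_module set)) \<and>
        (\<forall>p\<in>odd_params r0 r1 D. F p = {M \<in> odd_modules r0 r1 D. has_odd_params r0 r1 D M p})"
  proof (rule block_classification[where lo = 0 and D = D and K = "\<lambda>p. fst (snd p)" and R = fst
        and L = "\<lambda>p. fst (snd (snd p))" and N = "\<lambda>p. snd (snd (snd p))",
        OF assms(1,2) le0 le0 large_enough], goal_cases)
    case (1 p)
    show ?case by (cases p) (auto simp: odd_params_def)
  next
    case (4 M)
    have "odd_adapted r0 r1 M D = (\<lambda>a b lam mu.
        adapted_chain r0 r1 (2 * D + 1) M (interleave D a b) (interleave D lam mu))"
      if "mf_irreducible r0 r1 (2 * D + 1) M"
      using odd_adapted_iff[OF dm[OF that], of D] unfolding n by (intro ext)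
    then show ?case
      unfolding n odd_modules_def mem_Collect_eq by (cases "mf_irreducible r0 r1 (2 * D + 1) M") simp_all
  next
    case (5 M p)
    show ?case
      unfolding odd_adapted_iff[OF dm[OF 5], symmetric] by (cases p) (auto; blast)
  qed (auto simp: prod_eq_iff)
qed

end
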